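(* For any $n,m\in\mathbb{N}$: (1) the set $I(n,m)$ of real $m\times n$ matrices $\Theta$ (identified with points of $\mathbb{R}^{mn}$) for which the subspace $\{(x,y)\in\mathbb{R}^n\times\mathbb{R}^m:y=\Theta x\}$ of $\mathbb{R}^{n+m}$ is completely irrational is hyperplane absolute winning (HAW) in $\mathbb{R}^{mn}$; and (2) the set $N^{irr}(n,m)$ of those $\Theta\in I(n,m)$ which are moreover badly approximable is HAW in $\mathbb{R}^{mn}$.
   Context: A linear subspace of $\mathbb{R}^d$ is rational if it has a basis of integer vectors; an $n$-dimensional subspace $\mathcal{L}\subset\mathbb{R}^d$, $n<d$, is completely irrational if $\mathcal{L}\cap\mathcal{M}=\{0\}$ for every rational subspace $\mathcal{M}$ of dimension $d-n$. A real $m\times n$ matrix $\Theta=(\theta_j^i)$ is badly approximable if, with $L_j(x)=\sum_i\theta_j^ix_i$, there is $c>0$ with $(\max_i|x_i|)^n(\max_j\|L_j(x)\|)^m>c$ for all $x\in\mathbb{Z}^n\setminus\{0\}$, $\|\cdot\|$ denoting distance to the nearest integer. Hyperplane absolute winning game in $\mathbb{R}^r$ with parameter $0<\beta<\frac13$: Bob chooses a closed ball $B_1$ of radius $\rho_1$; after Bob chooses $B_i$ (radius $\rho_i$), Alice chooses an affine hyperplane $L$ and removes its $\varepsilon$-neighbourhood $A_i$ with $0<\varepsilon<\beta\rho_i$; then Bob chooses a closed ball $B_{i+1}\subset B_i\setminus A_i$ of radius $\rho_{i+1}\ge\beta\rho_i$. A set $S$ is hyperplane $\beta$-absolute winning if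 Alice has a strategy guaranteeing that $\bigcap_i B_i$ intersects $S$; $S$ is HAW if it is hyperplane $\beta$-absolute winning for every $0<\beta<\frac13$. *)

theory Defs
  imports "HOL-Analysis.Analysis"
begin

(* Coordinates are taken with respect to Basis, the standard basis of real^'n and of
   products such as real^'n \<times> real^'m. *)
definition integer_vectors :: "'a::euclidean_space set" where
  "integer_vectors = {v. \<forall>b\<in>Basis. v \<bullet> b \<in> \<int>}"

definition rational_subspace :: "'a::euclidean_space set \<Rightarrow> bool" where
  "rational_subspace M \<longleftrightarrow> (\<exists>B. B \<subseteq> integer_vectors \<and> independent B \<and> span B = M)"

definition completely_irrational :: "'a::euclidean_space set \<Rightarrow> bool" where
  "completely_irrational L \<longleftrightarrow>
     subspace L \<and> dim L < DIM('a) \<and>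
     (\<forall>M. rational_subspace M \<and> dim M = DIM('a) - dim L \<longrightarrow> L \<inter> M = {0})"

definition dist_nearest_int :: "real \<Rightarrow> real" where
  "dist_nearest_int t = \<bar>t - of_int (round t)\<bar>"

definition badly_approximable :: "real ^ 'n ^ 'm \<Rightarrow> bool" where
  "badly_approximable \<Theta> \<longleftrightarrow>
     (\<exists>c>0. \<forall>x :: int ^ 'n. x \<noteq> 0 \<longrightarrow>
        (MAX i\<in>UNIV. \<bar>real_of_int (x $ i)\<bar>) ^ CARD('n) *
        (MAX j\<in>UNIV. dist_nearest_int (\<Sum>i\<in>UNIV. \<Theta> $ j $ i * real_of_int (x $ i))) ^ CARD('m)
          > c)"

definition affine_hyperplane :: "'a::euclidean_space set \<Rightarrow> bool" where
  "affine_hyperplane L \<longleftrightarrow> (\<exists>a b. a \<noteq> 0 \<and> L = {x. a \<bullet> x = b})"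

definition nbhd :: "'a::euclidean_space set \<Rightarrow> real \<Rightarrow> 'a set" where
  "nbhd L \<epsilon> = (\<Union>x\<in>L. ball x \<epsilon>)"

(* Bob's balls are given by (centre, radius).  A strategy for Alice maps the list of the balls
   Bob has chosen so far to a pair (hyperplane, epsilon); her own earlier moves are determined
   by that list and so need not be part of the history. *)
type_synonym 'a alice_strategy = "('a \<times> real) list \<Rightarrow> 'a set \<times> real"

definition legal_strategy :: "real \<Rightarrow> 'a::euclidean_space alice_strategy \<Rightarrow> bool" where
  "legal_strategy \<beta> \<sigma> \<longleftrightarrow>
     (\<forall>h. h \<noteq> [] \<and> snd (last h) > 0 \<longrightarrow>
        affine_hyperplane (fst (\<sigma> h)) \<and> 0 < snd (\<sigma> h) \<and> snd (\<sigma> h) < \<beta> * snd (last h))"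

definition legal_bob_play ::
    "real \<Rightarrow> 'a::euclidean_space alice_strategy \<Rightarrow> (nat \<Rightarrow> 'a) \<Rightarrow> (nat \<Rightarrow> real) \<Rightarrow> bool" where
  "legal_bob_play \<beta> \<sigma> c \<rho> \<longleftrightarrow>
     \<rho> 0 > 0 \<and>
     (\<forall>i. \<rho> (Suc i) \<ge> \<beta> * \<rho> i \<and>
        (let (L, \<epsilon>) = \<sigma> (map (\<lambda>k. (c k, \<rho> k)) [0..<Suc i])
         in cball (c (Suc i)) (\<rho> (Suc i)) \<subseteq> cball (c i) (\<rho> i) - nbhd L \<epsilon>))"

definition hyperplane_absolute_winning :: "real \<Rightarrow> 'a::euclidean_space set \<Rightarrow> bool" where
  "hyperplane_absolute_winning \<beta> S \<longleftrightarrow>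
     (\<exists>\<sigma>. legal_strategy \<beta> \<sigma> \<and>
        (\<forall>c \<rho>. legal_bob_play \<beta> \<sigma> c \<rho> \<longrightarrow> (\<Inter>i. cball (c i) (\<rho> i)) \<inter> S \<noteq> {}))"

definition HAW :: "'a::euclidean_space set \<Rightarrow> bool" where
  "HAW S \<longleftrightarrow> (\<forall>\<beta>. 0 < \<beta> \<and> \<beta> < 1/3 \<longrightarrow> hyperplane_absolute_winning \<beta> S)"

definition graph_subspace :: "real ^ 'n ^ 'm \<Rightarrow> ((real ^ 'n) \<times> (real ^ 'm)) set" where
  "graph_subspace \<Theta> = {(x, y). y = \<Theta> *v x}"

(* The norm of real ^ 'n ^ 'm is the Euclidean norm of the vector of all entries, so the game on
   this type is the game on the Euclidean space of dimension m * n. *)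
definition I_set :: "(real ^ 'n ^ 'm) set" where
  "I_set = {\<Theta>. completely_irrational (graph_subspace \<Theta>)}"

definition N_irr :: "(real ^ 'n ^ 'm) set" where
  "N_irr = {\<Theta> \<in> I_set. badly_approximable \<Theta>}"

end

theory Submission
  imports Defs "Jordan_Normal_Form.Determinant"
begin

text \<open>
  One strategy serves both parts. While Bob's ball has radius \<open>\<rho>\<close>, look at the image of the integer
  lattice under \<open>(x, y) \<mapsto> (x, (\<Theta> x - y) / \<rho>)\<close>, normalised to covolume 1. Alice maintains, for the
  sublattices of every rank \<open>j\<close>, a lower bound \<open>exp (- K j (d - j))\<close> on the squared covolume (a Gram
  determinant), where \<open>d = n + m\<close>. Covolumes are submodular and the bound is strictly log-convex in \<open>j\<close>, so
  at any time at most one rational subspace per rank comes close to violating it. For a given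
  subspace, Alice can in a bounded number of moves force \<open>\<Theta>\<close> into general position with respect to it:
  the relevant Gram determinant is a polynomial in \<open>\<Theta>\<close> which is large somewhere on the ball, and by
  induction on the degree polynomials can be forced to be large on a whole smaller ball, the last
  move removing the zero hyperplane of an almost affine function. In general position the
  covolume grows when \<open>\<rho>\<close> decreases, which restores the bound. The bound in rank 1 says that \<open>\<Theta>\<close> is badly
  approximable. The number of moves does not depend on the subspace, so that in each round Alice
  can in addition make \<open>\<Theta>\<close> transversal to one member of an enumeration of the \<open>m\<close>-dimensional rational
  subspaces.
\<close>

section \<open>Gram determinants\<close>

no_notation Matrix.scalar_prod (infix "\<bullet>" 70)
no_notation Matrix.vec_index (infixl "$" 100)
hide_const (open) Matrix.mat Matrix.vec Determinants.det Matrix.row Matrix.orthogonal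
hide_fact (open) Matrix.orthogonal_def

text \<open>The obstacle is that one move removes the neighbourhood of a single hyperplane, while
  infinitely many sublattices could be about to violate the bound. The bound is made for this:
  \<open>h(j) = j (d - j)\<close> satisfies \<open>h(i) + h(2 j - i) = 2 h(j) - 2 (j - i)^2\<close>,
  so by submodularity two different spans of rank \<open>j\<close> within a factor \<open>C\<close>
  of the bound would give \<open>exp (2 K) < C^2\<close>, which \<open>ln C \<le> K\<close>
  excludes. In general position the squared covolume in rank \<open>j\<close> grows like
  \<open>\<rho>\<close> to the power \<open>- 2 min j m\<close>, while the normalisation costs
  \<open>\<rho>\<close> to the power \<open>2 m j / d\<close>; the net exponent
  \<open>2 (d min j m - m j) / d\<close> is at least \<open>2 / d\<close> for
  \<open>0 < j < d\<close>. The order of choices avoids circularity: the number of forcing moves and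
  the constants of general position depend only on \<open>\<beta>\<close>, \<open>n\<close> and
  \<open>m\<close>; then come the ratio \<open>R\<close> of the radii of consecutive stages, the
  factor \<open>C\<close> that a lattice left alone can lose in one stage, and last
  \<open>K\<close>, which may depend on Bob's first ball.\<close>

definition gram_mat :: "'v::real_inner list \<Rightarrow> real mat" where
  "gram_mat xs = Matrix.mat (length xs) (length xs) (\<lambda>(i, j). (xs ! i) \<bullet> (xs ! j))"

text \<open>The squared volume of the parallelepiped spanned by the list, hence the squared covolume
  of a lattice with basis \<open>xs\<close>. Rational subspaces are handled through lists of integer
  vectors, with \<open>length\<close> as the rank.\<close>

definition gram :: "'v::real_inner list \<Rightarrow> real" where
  "gram xs = det (gram_mat xs)"

lemma gram_mat_carrier: "gram_mat xs \<in> carrier_mat (length xs) (length xs)"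
  by (simp add: gram_mat_def)

text \<open>The Gram matrices are related by \<open>A * gram_mat xs * transpose_mat A\<close>. So
  ratios such as \<open>gram (map f xs) / gram xs\<close> depend only on the span.\<close>

lemma gram_lincomb:
  fixes xs ys :: "'v::real_inner list"
  assumes A: "A \<in> carrier_mat n n" and n: "length xs = n" "length ys = n"
    and ys: "\<And>i. i < n \<Longrightarrow> ys ! i = (\<Sum>j<n. (A $$ (i, j)) *\<^sub>R (xs ! j))"
  shows "gram ys = (det A)\<^sup>2 * gram xs"
proof -
  have "gram_mat ys = A * gram_mat xs * transpose_mat A"
  proof (rule eq_matI)
    fix i j assume "i < dim_row (A * gram_mat xs * transpose_mat A)"
      "j < dim_col (A * gram_mat xs * transpose_mat A)"
    then have ij: "i < n" "j < n" using A by auto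
    have "(A * gram_mat xs * transpose_mat A) $$ (i, j)
        = (\<Sum>l<n. (\<Sum>k<n. A $$ (i, k) * ((xs ! k) \<bullet> (xs ! l))) * A $$ (j, l))"
      using A ij n by (simp add: scalar_prod_def gram_mat_def lessThan_atLeast0)
    also have "\<dots> = (\<Sum>k<n. \<Sum>l<n. A $$ (i, k) * (A $$ (j, l) * ((xs ! k) \<bullet> (xs ! l))))"
      by (subst sum.swap) (simp add: sum_distrib_right sum_distrib_left mult_ac)
    also have "\<dots> = (ys ! i) \<bullet> (ys ! j)"
      by (subst sum.swap) (simp add: ys ij inner_sum_left inner_sum_right sum_distrib_left mult_ac)
    finally show "gram_mat ys $$ (i, j) = (A * gram_mat xs * transpose_mat A) $$ (i, j)"
      using ij n by (simp add: gram_mat_def)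
  qed (use A n in \<open>auto simp: gram_mat_def\<close>)
  moreover have "gram_mat xs \<in> carrier_mat n n" using n gram_mat_carrier by metis
  ultimately show ?thesis
    using A unfolding gram_def
    by (simp add: det_mult[of _ n] det_transpose power2_eq_square)
qed

lemma span_list_lincomb:
  fixes xs :: "'v::real_vector list"
  assumes "z \<in> span (set xs)"
  obtains c where "z = (\<Sum>j<length xs. c j *\<^sub>R (xs ! j))"
proof -
  have "\<exists>c. z = (\<Sum>j<length xs. c j *\<^sub>R (xs ! j))"
    using assms
  proof (induction rule: span_induct_alt)
    case base
    show ?case by (rule exI[of _ "\<lambda>_. 0"]) simp
  next
    case (step a x y)
    then obtain c where c: "y = (\<Sum>j<length xs. c j *\<^sub>R (xs ! j))" by blast
    obtain i where i: "i < length xs" "x = xs ! i" using step by (metis in_set_conv_nth)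
    have "(\<Sum>j<length xs. (c j + (if j = i then a else 0)) *\<^sub>R (xs ! j)) = a *\<^sub>R x + y"
      using i by (simp add: scaleR_add_left sum.distrib c if_distrib[of "\<lambda>t. t *\<^sub>R _"] sum.delta cong: if_cong)
    then show ?case by (intro exI[of _ "\<lambda>j. c j + (if j = i then a else 0)"]) simp
  qed
  then show ?thesis using that by blast
qed

lemma lincomb_in_span: "(\<Sum>j<length xs. c j *\<^sub>R (xs ! j)) \<in> span (set xs)"
  by (intro span_sum span_scale span_base) auto

text \<open>Passing from \<open>w\<close> to \<open>s + w\<close> is a lower triangular change of
  list with unit diagonal, so of determinant 1; for \<open>w\<close> itself the Gram matrix is block
  diagonal.\<close>

lemma gram_snoc_orthogonal:
  fixes xs :: "'v::real_inner list"
  assumes s: "s \<in> span (set xs)" and w: "\<And>x. x \<in> set xs \<Longrightarrow> x \<bullet> w = 0"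
  shows "gram (xs @ [s + w]) = gram xs * (norm w)\<^sup>2"
proof -
  define n where "n = length xs"
  obtain c where c: "s = (\<Sum>j<n. c j *\<^sub>R (xs ! j))"
    using span_list_lincomb[OF s] unfolding n_def by blast
  define A where "A = Matrix.mat (Suc n) (Suc n)
     (\<lambda>(i, j). if i = j then 1 else if i = n then c j else (0::real))"
  have A: "A \<in> carrier_mat (Suc n) (Suc n)" by (simp add: A_def)
  have detA: "det A = 1"
  proof -
    have "det A = prod_list (diag_mat A)"
      by (rule det_lower_triangular[of "Suc n"]) (auto simp: A_def)
    also have "\<dots> = 1" by (simp add: prod_list_diag_prod A_def)
    finally show ?thesis .
  qed
  have "gram (xs @ [s + w]) = (det A)\<^sup>2 * gram (xs @ [w])"
  proof (rule gram_lincomb[OF A])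
    fix i assume i: "i < Suc n"
    show "(xs @ [s + w]) ! i = (\<Sum>j<Suc n. A $$ (i, j) *\<^sub>R (xs @ [w]) ! j)"
    proof (cases "i = n")
      case True
      have "(\<Sum>j<n. A $$ (i, j) *\<^sub>R (xs @ [w]) ! j) = s"
        unfolding c by (rule sum.cong) (use True in \<open>auto simp: A_def nth_append n_def\<close>)
      then show ?thesis using True by (simp add: A_def n_def nth_append)
    next
      case False
      then have "i < n" using i by simp
      have "(\<Sum>j<Suc n. A $$ (i, j) *\<^sub>R (xs @ [w]) ! j) = (\<Sum>j<Suc n. if j = i then (xs @ [w]) ! j else 0)"
        by (rule sum.cong) (use False i in \<open>auto simp: A_def\<close>)
      also have "\<dots> = (xs @ [s + w]) ! i" using i \<open>i < n\<close> by (simp add: nth_append n_def)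
      finally show ?thesis by simp
    qed
  qed (simp_all add: n_def)
  also have "gram (xs @ [w]) = gram xs * (norm w)\<^sup>2"
  proof -
    have w': "w \<bullet> x = 0" if "x \<in> set xs" for x
      using w[OF that] by (simp add: inner_commute)
    have eq: "gram_mat (xs @ [w]) = four_block_mat (gram_mat xs) (0\<^sub>m n 1) (0\<^sub>m 1 n)
       (Matrix.mat 1 1 (\<lambda>_. w \<bullet> w))"
      using w w' by (intro eq_matI)
        (auto simp: gram_mat_def four_block_mat_def n_def nth_append less_Suc_eq Let_def)
    show ?thesis unfolding gram_def eq
      by (subst det_four_block_mat_upper_right_zero[of _ n _ 1])
        (auto simp: gram_mat_carrier n_def power2_norm_eq_inner det_single)
  qed
  finally show ?thesis by (simp add: detA)
qed

lemma infdist_span_eq_norm: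
  fixes S :: "'v::euclidean_space set"
  assumes s: "s \<in> span S" and w: "\<And>x. x \<in> S \<Longrightarrow> x \<bullet> w = 0"
  shows "infdist (s + w) (span S) = norm w"
proof (rule antisym)
  show "infdist (s + w) (span S) \<le> norm w"
    using infdist_le[OF s, of "s + w"] by (simp add: dist_norm)
  have orth: "y \<bullet> w = 0" if "y \<in> span S" for y
    using that w by (induction rule: span_induct_alt) (auto simp: inner_left_distrib)
  have "norm w \<le> dist (s + w) y" if y: "y \<in> span S" for y
  proof -
    have "(dist (s + w) y)\<^sup>2 = (norm (s - y))\<^sup>2 + (norm w)\<^sup>2"
      using orth[OF span_diff[OF s y]] norm_add_Pythagorean[of "s - y" w]
      by (simp add: orthogonal_def dist_norm diff_add_eq)
    then have "(norm w)\<^sup>2 \<le> (dist (s + w) y)\<^sup>2" by simp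
    then show ?thesis by (rule power2_le_imp_le) simp
  qed
  then show "norm w \<le> infdist (s + w) (span S)"
    using span_zero[of S] by (metis infdist_attains_inf closed_span empty_iff)
qed

text \<open>Base times height. Most inequalities for \<open>gram\<close> below are proved by
  \<open>rev_induct\<close> with this recursion, which reduces them to comparing distances to
  spans.\<close>

lemma gram_snoc:
  fixes xs :: "'v::euclidean_space list"
  shows "gram (xs @ [z]) = gram xs * (infdist z (span (set xs)))\<^sup>2"
proof -
  obtain s w where sw: "s \<in> span (set xs)" "\<And>x. x \<in> span (set xs) \<Longrightarrow> orthogonal w x" "z = s + w"
    by (rule orthogonal_subspace_decomp_exists[of "set xs" z]) auto
  then have w: "x \<bullet> w = 0" if "x \<in> set xs" for x
    using sw(2)[OF span_base[OF that]] by (simp add: orthogonal_def inner_commute)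
  show ?thesis
    unfolding sw(3) using gram_snoc_orthogonal[OF sw(1) w] infdist_span_eq_norm[OF sw(1) w] by simp
qed

lemma gram_Nil [simp]: "gram [] = 1"
  by (simp add: gram_def gram_mat_def)

lemma gram_nonneg: "0 \<le> gram (xs :: 'v::euclidean_space list)"
  by (induction xs rule: rev_induct) (auto simp: gram_snoc)

lemma infdist_span_pos_iff:
  fixes S :: "'v::euclidean_space set"
  shows "0 < infdist z (span S) \<longleftrightarrow> z \<notin> span S"
  using in_closed_iff_infdist_zero[OF closed_span, of S z] span_zero[of S] infdist_nonneg[of z "span S"]
  by (auto simp: less_le)

lemma gram_snoc_pos_iff:
  fixes xs :: "'v::euclidean_space list"
  shows "0 < gram (xs @ [z]) \<longleftrightarrow> 0 < gram xs \<and> z \<notin> span (set xs)"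
  using gram_nonneg[of xs] infdist_span_pos_iff[of z "set xs"] infdist_nonneg[of z "span (set xs)"]
  by (auto simp: gram_snoc zero_less_mult_iff less_le)

lemma gram_pos_append:
  fixes xs :: "'v::euclidean_space list"
  shows "0 < gram (xs @ ys) \<Longrightarrow> 0 < gram xs"
  by (induction ys rule: rev_induct) (auto simp: gram_snoc_pos_iff simp flip: append_assoc)

lemma gram_pos_iff_independent:
  fixes xs :: "'v::euclidean_space list"
  shows "0 < gram xs \<longleftrightarrow> distinct xs \<and> independent (set xs)"
proof (induction xs rule: rev_induct)
  case Nil
  show ?case by (simp add: independent_empty)
next
  case (snoc z xs)
  then show ?case
    by (auto simp: gram_snoc_pos_iff independent_insert span_base)
qed

lemma dim_span_list:
  fixes xs :: "'v::euclidean_space list"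
  assumes "0 < gram xs"
  shows "dim (span (set xs)) = length xs"
  using assms by (simp add: gram_pos_iff_independent dim_eq_card_independent distinct_card)

text \<open>Enlarging the span by \<open>as\<close> can only decrease the height of each vector of
  \<open>bs\<close>. The list \<open>us\<close> stands for the intersection of two subspaces and
  \<open>us @ as @ bs\<close> for their sum.\<close>

lemma gram_append_submodular:
  fixes us :: "'v::euclidean_space list"
  shows "gram (us @ as @ bs) * gram us \<le> gram (us @ as) * gram (us @ bs)"
proof (induction bs rule: rev_induct)
  case (snoc z bs)
  have "(infdist z (span (set (us @ as @ bs))))\<^sup>2 \<le> (infdist z (span (set (us @ bs))))\<^sup>2"
    by (intro power_mono infdist_mono span_mono) (auto simp: infdist_nonneg intro: span_zero)
  then have "gram (us @ as @ bs) * gram us * (infdist z (span (set (us @ as @ bs))))\<^sup>2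
     \<le> gram (us @ as) * gram (us @ bs) * (infdist z (span (set (us @ bs))))\<^sup>2"
    using snoc by (intro mult_mono[of "_ * _"]) (auto simp: gram_nonneg)
  then show ?case
    using gram_snoc[of "us @ as @ bs" z] gram_snoc[of "us @ bs" z] by (simp add: mult_ac)
qed (simp add: mult.commute)

section \<open>Gram determinants under linear maps\<close>

lemma infdist_linear_image_le:
  fixes f :: "'v::euclidean_space \<Rightarrow> 'w::euclidean_space"
  assumes f: "linear f" and K: "\<And>v. norm (f v) \<le> K * norm v" and "0 \<le> K"
  shows "infdist (f z) (span (f ` S)) \<le> K * infdist z (span S)"
proof -
  obtain s where s: "s \<in> span S" "infdist z (span S) = dist z s"
    using infdist_attains_inf[OF closed_span, of S z] span_zero[of S] by (metis empty_iff)
  have "infdist (f z) (span (f ` S)) \<le> dist (f z) (f s)"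
    using s(1) by (intro infdist_le) (simp add: linear_span_image[OF f])
  also have "\<dots> \<le> K * dist z s"
    using K[of "z - s"] by (simp add: dist_norm linear_diff[OF f])
  finally show ?thesis using s by simp
qed

lemma infdist_linear_image_ge:
  fixes f :: "'v::euclidean_space \<Rightarrow> 'w::euclidean_space"
  assumes f: "linear f" and k: "\<And>v. v \<in> span (insert z S) \<Longrightarrow> k * norm v \<le> norm (f v)" and "0 \<le> k"
  shows "k * infdist z (span S) \<le> infdist (f z) (span (f ` S))"
proof -
  obtain y where y: "y \<in> span (f ` S)" "infdist (f z) (span (f ` S)) = dist (f z) y"
    using infdist_attains_inf[OF closed_span, of "f ` S" "f z"] span_zero[of "f ` S"] by (metis empty_iff)
  then obtain s where s: "s \<in> span S" "y = f s" by (auto simp: linear_span_image[OF f])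
  have "k * infdist z (span S) \<le> k * dist z s"
    using s \<open>0 \<le> k\<close> by (intro mult_left_mono infdist_le)
  also have "\<dots> \<le> norm (f (z - s))"
    unfolding dist_norm
  proof (rule k)
    have "s \<in> span (insert z S)" using s span_mono[of S "insert z S"] by auto
    then show "z - s \<in> span (insert z S)" by (intro span_diff) (auto intro: span_base)
  qed
  finally show ?thesis using y s by (simp add: dist_norm linear_diff[OF f])
qed

lemma gram_map_le:
  fixes f :: "'v::euclidean_space \<Rightarrow> 'w::euclidean_space"
  assumes f: "linear f" and K: "\<And>v. norm (f v) \<le> K * norm v" and "0 \<le> K"
  shows "gram (map f xs) \<le> (K\<^sup>2) ^ length xs * gram xs"
proof (induction xs rule: rev_induct)
  case (snoc z xs)
  have "gram (map f xs) * (infdist (f z) (span (f ` set xs)))\<^sup>2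
     \<le> ((K\<^sup>2) ^ length xs * gram xs) * (K * infdist z (span (set xs)))\<^sup>2"
    using snoc infdist_linear_image_le[OF assms] \<open>0 \<le> K\<close>
    by (intro mult_mono[of "gram _"] power_mono) (auto simp: gram_nonneg infdist_nonneg)
  then show ?case by (simp add: gram_snoc power_mult_distrib mult_ac)
qed simp

text \<open>The lower bound is asked on the span only, because the map of later interest,
  \<open>\<lambda>v. snd (shear D v)\<close>, has a kernel.\<close>

lemma gram_map_ge:
  fixes f :: "'v::euclidean_space \<Rightarrow> 'w::euclidean_space"
  assumes f: "linear f" and "0 \<le> k" and k: "\<And>v. v \<in> span (set xs) \<Longrightarrow> k * norm v \<le> norm (f v)"
  shows "(k\<^sup>2) ^ length xs * gram xs \<le> gram (map f xs)"
  using k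
proof (induction xs rule: rev_induct)
  case (snoc z xs)
  have "(k\<^sup>2) ^ length xs * gram xs \<le> gram (map f xs)"
    using snoc.prems span_mono[of "set xs" "set (xs @ [z])"] by (intro snoc.IH) auto
  moreover have "k * infdist z (span (set xs)) \<le> infdist (f z) (span (f ` set xs))"
    using snoc.prems by (intro infdist_linear_image_ge[OF f _ \<open>0 \<le> k\<close>]) simp
  ultimately have "((k\<^sup>2) ^ length xs * gram xs) * (k * infdist z (span (set xs)))\<^sup>2
     \<le> gram (map f xs) * (infdist (f z) (span (f ` set xs)))\<^sup>2"
    using \<open>0 \<le> k\<close> by (intro mult_mono[of "_ ^ _ * _"] power_mono) (auto simp: gram_nonneg infdist_nonneg)
  then show ?case by (simp add: gram_snoc power_mult_distrib mult_ac)
qed simp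

text \<open>In quotient form: \<open>f\<close> enlarges the volume of \<open>xs @ ys\<close> by at
  least the factor for \<open>xs\<close>, since no further height decreases. This carries growth
  over from \<open>m\<close> vectors to longer lists.\<close>

lemma gram_append_expanding:
  fixes f :: "'v::euclidean_space \<Rightarrow> 'w::euclidean_space"
  assumes f: "linear f" and k: "\<And>v. norm v \<le> norm (f v)"
  shows "gram (xs @ ys) * gram (map f xs) \<le> gram (map f (xs @ ys)) * gram xs"
proof (induction ys rule: rev_induct)
  case (snoc z ys)
  have "(infdist z (span (set (xs @ ys))))\<^sup>2 \<le> (infdist (f z) (span (f ` set (xs @ ys))))\<^sup>2"
    using infdist_linear_image_ge[OF f, of z "set (xs @ ys)" 1] k
    by (intro power_mono) (auto simp: infdist_nonneg)
  then have "gram (xs @ ys) * gram (map f xs) * (infdist z (span (set (xs @ ys))))\<^sup>2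
     \<le> gram (map f (xs @ ys)) * gram xs * (infdist (f z) (span (f ` set (xs @ ys))))\<^sup>2"
    using snoc by (intro mult_mono[of "_ * _"]) (auto simp: gram_nonneg)
  then show ?case
    using gram_snoc[of "xs @ ys" z] gram_snoc[of "map f (xs @ ys)" "f z"]
    by (simp add: mult_ac image_Un)
qed (simp add: mult.commute)

lemma gram_scale:
  "gram (map (\<lambda>v. a *\<^sub>R v) xs) = (a\<^sup>2) ^ length xs * gram (xs :: 'v::euclidean_space list)"
proof -
  have "gram (map (\<lambda>v. a *\<^sub>R v) xs) = (det (a \<cdot>\<^sub>m 1\<^sub>m (length xs)))\<^sup>2 * gram xs"
  proof (rule gram_lincomb[of _ "length xs"])
    fix i assume i: "i < length xs"
    have "(\<Sum>j<length xs. (a \<cdot>\<^sub>m 1\<^sub>m (length xs)) $$ (i, j) *\<^sub>R xs ! j)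
        = (\<Sum>j<length xs. if j = i then a *\<^sub>R xs ! j else 0)"
      using i by (intro sum.cong) auto
    then show "map (\<lambda>v. a *\<^sub>R v) xs ! i
        = (\<Sum>j<length xs. (a \<cdot>\<^sub>m 1\<^sub>m (length xs)) $$ (i, j) *\<^sub>R xs ! j)"
      using i by simp
  qed auto
  then show ?thesis by (simp add: det_smult mult.commute flip: power_mult)
qed

section \<open>Sublattices of the integer lattice\<close>

lemma integer_vectors_inner_Ints:
  assumes "x \<in> integer_vectors" "y \<in> integer_vectors"
  shows "x \<bullet> y \<in> \<int>"
  using assms by (auto simp: integer_vectors_def euclidean_inner[of x y] intro!: Ints_sum Ints_mult)

lemma integer_vectors_lincomb:
  assumes "set xs \<subseteq> integer_vectors"
  shows "(\<Sum>j<length xs. of_int (c j) *\<^sub>R (xs ! j)) \<in> integer_vectors"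
proof -
  have "xs ! j \<bullet> b \<in> \<int>" if "j < length xs" "b \<in> Basis" for j b
    using assms nth_mem[OF that(1)] that(2) by (auto simp: integer_vectors_def)
  then show ?thesis
    by (auto simp: integer_vectors_def inner_sum_left intro!: Ints_sum Ints_mult)
qed

lemma integer_vectors_diff:
  "x \<in> integer_vectors \<Longrightarrow> y \<in> integer_vectors \<Longrightarrow> x - y \<in> integer_vectors"
  by (auto simp: integer_vectors_def inner_diff_left)

lemma gram_Ints:
  assumes "set xs \<subseteq> integer_vectors"
  shows "gram xs \<in> \<int>"
proof -
  have "xs ! i \<bullet> xs ! j \<in> \<int>" if "i < length xs" "j < length xs" for i j
    using assms that by (intro integer_vectors_inner_Ints) auto
  moreover have "p i < length xs" if "p permutes {0..<length xs}" "i < length xs" for p i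
    using that permutes_in_image by fastforce
  ultimately show ?thesis
    unfolding gram_def det_def'[OF gram_mat_carrier]
    by (auto intro!: Ints_sum Ints_mult Ints_prod simp: gram_mat_def sign_def)
qed

text \<open>The discreteness of the lattice; it starts the covolume bound on Bob's first
  ball.\<close>

lemma gram_ge_1:
  assumes "set xs \<subseteq> integer_vectors" "0 < gram xs"
  shows "1 \<le> gram xs"
  using gram_Ints[OF assms(1)] assms(2) by (auto elim!: Ints_cases)

lemma lincomb_eq_0_imp:
  fixes xs :: "'v::euclidean_space list"
  assumes "0 < gram xs" "(\<Sum>j<length xs. c j *\<^sub>R (xs ! j)) = 0" "j < length xs"
  shows "c j = 0"
  using assms
proof (induction xs arbitrary: j rule: rev_induct)
  case (snoc z xs)
  have gr: "0 < gram xs" "z \<notin> span (set xs)" using snoc.prems(1) by (auto simp: gram_snoc_pos_iff)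
  have eq: "(\<Sum>j<length xs. c j *\<^sub>R (xs ! j)) + c (length xs) *\<^sub>R z = 0"
    using snoc.prems(2) by (simp add: nth_append)
  have c0: "c (length xs) = 0"
  proof (rule ccontr)
    assume nz: "c (length xs) \<noteq> 0"
    have "c (length xs) *\<^sub>R z = - (\<Sum>j<length xs. c j *\<^sub>R (xs ! j))"
      using eq by (simp add: eq_neg_iff_add_eq_0 add.commute)
    then have "c (length xs) *\<^sub>R z \<in> span (set xs)" by (simp add: span_neg lincomb_in_span)
    then have "(1 / c (length xs)) *\<^sub>R (c (length xs) *\<^sub>R z) \<in> span (set xs)" by (rule span_scale)
    then show False using nz gr by simp
  qed
  show ?case
    using snoc.IH[OF gr(1)] eq c0 snoc.prems(3) by (cases "j = length xs") auto
qed simp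

text \<open>Integer vectors that are dependent over the reals are dependent over the integers,
  because their Gram matrix is an integer matrix.\<close>
lemma integer_dependence:
  fixes ws :: "'v::euclidean_space list"
  assumes ws: "set ws \<subseteq> integer_vectors" and g: "gram ws = 0"
  obtains c :: "nat \<Rightarrow> int" and i where "i < length ws" "c i \<noteq> 0"
    "(\<Sum>j<length ws. of_int (c j) *\<^sub>R (ws ! j)) = 0"
proof -
  define n where "n = length ws"
  define G where "G = Matrix.mat n n (\<lambda>(i, j). \<lfloor>ws ! i \<bullet> ws ! j\<rfloor>)"
  have G: "G \<in> carrier_mat n n" by (simp add: G_def)
  have Gi: "of_int (G $$ (i, j)) = ws ! i \<bullet> ws ! j" if "i < n" "j < n" for i j
    using integer_vectors_inner_Ints[of "ws ! i" "ws ! j"] that ws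
    by (auto simp: G_def n_def subset_iff elim!: Ints_cases)
  have "gram_mat ws = map_mat of_int G"
    by (rule eq_matI) (use Gi G in \<open>auto simp: gram_mat_def n_def\<close>)
  then have "det G = 0" using g of_int_hom.hom_det[of G] by (simp add: gram_def)
  then obtain v where v: "v \<in> carrier_vec n" "v \<noteq> 0\<^sub>v n" "G *\<^sub>v v = 0\<^sub>v n"
    using det_0_iff_vec_prod_zero[OF G] by blast
  define c where "c = vec_index v"
  have row: "(\<Sum>j<n. G $$ (i, j) * c j) = 0" if "i < n" for i
  proof -
    have "vec_index (G *\<^sub>v v) i = 0" using v(3) that by simp
    then show ?thesis using that G v(1) by (simp add: scalar_prod_def c_def lessThan_atLeast0)
  qed
  \<comment> \<open>As \<open>c\<close> lies in the kernel of the Gram matrix, the squared length of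
    \<open>w\<close>, which is the quadratic form of that matrix at \<open>c\<close>, is 0.\<close>
  define w where "w = (\<Sum>j<n. real_of_int (c j) *\<^sub>R (ws ! j))"
  have "w \<bullet> w = (\<Sum>i<n. of_int (c i) * (\<Sum>j<n. of_int (c j) * (ws ! i \<bullet> ws ! j)))"
    by (simp add: w_def inner_sum_left inner_sum_right sum_distrib_left inner_commute mult.left_commute)
  also have "\<dots> = (\<Sum>i<n. of_int (c i) * of_int (\<Sum>j<n. G $$ (i, j) * c j))"
    by (intro sum.cong refl arg_cong2[of _ _ _ _ "(*)"]) (simp add: Gi mult.commute)
  also have "\<dots> = 0" by (simp add: row del: of_int_sum)
  finally have "w = 0" by simp
  moreover obtain i where "i < n" "c i \<noteq> 0"
    using v(1,2) unfolding c_def by (metis eq_vecI carrier_vecD index_zero_vec)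
  ultimately show ?thesis using that unfolding w_def n_def by blast
qed

text \<open>With zero coefficients after \<open>k\<close>, the change of list is a lower triangular
  matrix and its determinant is the diagonal entry \<open>c k\<close>.\<close>

lemma gram_list_update:
  fixes ws :: "'v::euclidean_space list"
  assumes k: "k < length ws" and z: "z = (\<Sum>j<length ws. c j *\<^sub>R (ws ! j))"
    and c: "\<And>j. k < j \<Longrightarrow> j < length ws \<Longrightarrow> c j = 0"
  shows "gram (ws[k := z]) = (c k)\<^sup>2 * gram ws"
proof -
  define n where "n = length ws"
  define A where "A = Matrix.mat n n (\<lambda>(i, j). if i = k then c j else if i = j then 1 else 0)"
  have A: "A \<in> carrier_mat n n" by (simp add: A_def)
  have "det A = prod_list (diag_mat A)"
    by (rule det_lower_triangular[OF _ A]) (use c in \<open>auto simp: A_def n_def\<close>)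
  also have "\<dots> = (\<Prod>i<n. if i = k then c i else 1)"
    unfolding prod_list_diag_prod lessThan_atLeast0 by (rule prod.cong) (auto simp: A_def)
  also have "\<dots> = c k" using k by (simp add: prod.delta n_def)
  finally have "det A = c k" .
  moreover have "gram (ws[k := z]) = (det A)\<^sup>2 * gram ws"
  proof (rule gram_lincomb[OF A])
    fix i assume i: "i < n"
    show "ws[k := z] ! i = (\<Sum>j<n. A $$ (i, j) *\<^sub>R ws ! j)"
    proof (cases "i = k")
      case True
      then show ?thesis using i by (simp add: A_def z n_def)
    next
      case False
      have "(\<Sum>j<n. A $$ (i, j) *\<^sub>R ws ! j) = (\<Sum>j<n. if j = i then ws ! j else 0)"
        by (rule sum.cong) (use False i in \<open>auto simp: A_def\<close>)
      then show ?thesis using False i by simp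
    qed
  qed (auto simp: n_def)
  ultimately show ?thesis by simp
qed

lemma span_eq_if_length_eq:
  fixes xs :: "'v::euclidean_space list"
  assumes "0 < gram ys" "set ys \<subseteq> span (set xs)" "0 < gram xs" "length ys = length xs"
  shows "span (set ys) = span (set xs)"
  using assms by (intro subspace_dim_equal) (auto simp: span_minimal dim_span_list simp del: dim_span)

text \<open>For integer vectors \<open>xs\<close> this says that their lattice is saturated
  (primitive): it contains every integer vector of its real span. Together with
  \<open>0 < gram xs\<close> they form a basis of that lattice.\<close>

definition generates_lattice :: "'v::euclidean_space list \<Rightarrow> bool" where
  "generates_lattice xs \<longleftrightarrow> (\<forall>z \<in> integer_vectors \<inter> span (set xs).
     \<exists>c :: nat \<Rightarrow> int. z = (\<Sum>j<length xs. of_int (c j) *\<^sub>R (xs ! j)))"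

lemma generates_lattice_Nil: "generates_lattice []"
  by (simp add: generates_lattice_def)

text \<open>Descent: among the integer extensions of \<open>us\<close> to a basis of
  \<open>V\<close>, one with the least Gram determinant generates the lattice. A missing integer
  vector could be reduced modulo the basis and exchanged for one of its vectors, which would make
  the determinant smaller.\<close>

lemma lattice_basis_extension:
  fixes us :: "'v::euclidean_space list"
  assumes us: "set us \<subseteq> integer_vectors" "0 < gram us" "generates_lattice us" "set us \<subseteq> V"
    and V: "\<exists>S \<subseteq> integer_vectors. V = span S"
  obtains as where "set (us @ as) \<subseteq> integer_vectors" "0 < gram (us @ as)"
    "span (set (us @ as)) = V" "generates_lattice (us @ as)"
proof -
  define P where "P as \<longleftrightarrow> set (us @ as) \<subseteq> integer_vectors \<and> 0 < gram (us @ as) \<and> span (set (us @ as)) = V" for as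
  obtain S where S: "S \<subseteq> integer_vectors" "V = span S" using V by blast
  have "\<exists>as. P as"
  proof -
    have ind: "independent (set us)" using us(2) by (simp add: gram_pos_iff_independent)
    obtain B where B: "set us \<subseteq> B" "B \<subseteq> set us \<union> S" "independent B" "set us \<union> S \<subseteq> span B"
      using maximal_independent_subset_extend[of "set us" "set us \<union> S"] ind by auto
    have "finite (B - set us)" using B(3) independent_imp_finite by blast
    then obtain as where as: "set as = B - set us" "distinct as" using finite_distinct_list by metis
    have un: "set (us @ as) = B" using as B(1) by auto
    have "distinct (us @ as)" using as us(2) by (auto simp: gram_pos_iff_independent)
    then have "0 < gram (us @ as)" unfolding gram_pos_iff_independent un using B(3) by simp
    moreover have "span B = V"
    proof
      show "span B \<subseteq> V" using B(2) us(4) S(2) span_base[of _ S]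
        by (intro span_minimal) auto
      show "V \<subseteq> span B" unfolding S(2) using B(4) by (intro span_minimal) auto
    qed
    moreover have "set (us @ as) \<subseteq> integer_vectors" unfolding un using B(2) us(1) S(1) by auto
    ultimately have "P as" unfolding P_def un by simp
    then show ?thesis by blast
  qed
  \<comment> \<open>Gram determinants of integer vectors are nonnegative integers, so a minimum
    exists.\<close>
  then obtain as where as: "P as" and min: "\<And>as'. P as' \<Longrightarrow> nat \<lfloor>gram (us @ as)\<rfloor> \<le> nat \<lfloor>gram (us @ as')\<rfloor>"
    using exists_least_iff[of "\<lambda>n. \<exists>as. P as \<and> nat \<lfloor>gram (us @ as)\<rfloor> = n"]
    by (metis not_le_imp_less)
  have min: "gram (us @ as) \<le> gram (us @ as')" if "P as'" for as'
    using min[OF that] as that gram_Ints[of "us @ as"] gram_Ints[of "us @ as'"]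
    by (auto simp: P_def elim!: Ints_cases)
  define ws where "ws = us @ as"
  have ws: "set ws \<subseteq> integer_vectors" "0 < gram ws" "span (set ws) = V" using as by (auto simp: P_def ws_def)
  have "generates_lattice ws"
    unfolding generates_lattice_def
  proof
    fix z assume z: "z \<in> integer_vectors \<inter> span (set ws)"
    then obtain c where c: "z = (\<Sum>j<length ws. c j *\<^sub>R (ws ! j))" using span_list_lincomb by blast
    define z' where "z' = (\<Sum>j<length ws. frac (c j) *\<^sub>R (ws ! j))"
    have z'_eq: "z' = z - (\<Sum>j<length ws. of_int \<lfloor>c j\<rfloor> *\<^sub>R (ws ! j))"
      by (simp add: z'_def c frac_def scaleR_diff_left sum_subtractf)
    have z': "z' \<in> integer_vectors"
      unfolding z'_eq using z integer_vectors_lincomb[OF ws(1)] by (intro integer_vectors_diff) auto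
    have "frac (c j) = 0" if "j < length ws" for j
    proof (rule ccontr)
      assume "frac (c j) \<noteq> 0"
      define K where "K = {j. j < length ws \<and> frac (c j) \<noteq> 0}"
      \<comment> \<open>The last index with a fractional coefficient: beyond \<open>k\<close> the
        coefficients of \<open>z'\<close> vanish, so \<open>gram_list_update\<close> applies. If
        \<open>k\<close> falls into \<open>us\<close>, then \<open>z'\<close> lies in the span of
        the saturated list \<open>us\<close>, which forces its coefficient at \<open>k\<close> to be
        an integer.\<close>
      define k where "k = Max K"
      have fin: "finite K" "K \<noteq> {}" using \<open>frac (c j) \<noteq> 0\<close> that by (auto simp: K_def)
      then have k: "k < length ws" "frac (c k) \<noteq> 0" using Max_in[OF fin] by (auto simp: K_def k_def)
      have gt: "frac (c i) = 0" if "k < i" "i < length ws" for i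
      proof (rule ccontr)
        assume "frac (c i) \<noteq> 0"
        then have "i \<in> K" using that by (simp add: K_def)
        then show False using Max_ge[OF fin(1), of i] that by (simp add: k_def)
      qed
      show False
      proof (cases "k < length us")
        case True
        have "z' = (\<Sum>j<length us. frac (c j) *\<^sub>R (us ! j))"
          unfolding z'_def by (rule sum.mono_neutral_cong_right)
            (use gt True in \<open>auto simp: ws_def nth_append\<close>)
        then have "z' \<in> span (set us)" using lincomb_in_span by metis
        then obtain e :: "nat \<Rightarrow> int" where e: "z' = (\<Sum>j<length us. of_int (e j) *\<^sub>R (us ! j))"
          using us(3) z' by (auto simp: generates_lattice_def)
        have "(\<Sum>j<length us. (frac (c j) - of_int (e j)) *\<^sub>R (us ! j)) = 0"
          using e \<open>z' = (\<Sum>j<length us. frac (c j) *\<^sub>R (us ! j))\<close>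
          by (simp add: scaleR_diff_left sum_subtractf)
        from lincomb_eq_0_imp[OF us(2) this True] have "frac (c k) = of_int (e k)" by simp
        then have "frac (c k) \<in> \<int>" by simp
        then show False using k(2) frac_eq_0_iff frac_frac by metis
      next
        case False
        define as' where "as' = as[k - length us := z']"
        have upd: "us @ as' = ws[k := z']" using False by (simp add: as'_def ws_def list_update_append)
        have gr: "gram (us @ as') = (frac (c k))\<^sup>2 * gram ws"
          unfolding upd using k gt by (intro gram_list_update) (auto simp: z'_def)
        have pos: "0 < gram (us @ as')" unfolding gr using k ws(2) by simp
        have sub: "set (us @ as') \<subseteq> span (set ws)"
        proof
          fix y assume "y \<in> set (us @ as')"
          then have "y = z' \<or> y \<in> set ws" unfolding upd using set_update_subset_insert by fastforce
          then show "y \<in> span (set ws)"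
            using lincomb_in_span[of "\<lambda>j. frac (c j)" ws] span_base[of y "set ws"] by (auto simp: z'_def)
        qed
        have "P as'"
          unfolding P_def
        proof (intro conjI)
          show "set (us @ as') \<subseteq> integer_vectors"
            unfolding upd using set_update_subset_insert[of ws k z'] ws(1) z' by auto
          show "span (set (us @ as')) = V"
            unfolding ws(3)[symmetric] using pos sub ws(2) by (intro span_eq_if_length_eq) (simp_all add: upd)
        qed (rule pos)
        then have "gram ws \<le> (frac (c k))\<^sup>2 * gram ws" using min[of as'] gr by (simp add: ws_def)
        moreover have "(frac (c k))\<^sup>2 < 1"
          using frac_lt_1[of "c k"] frac_ge_0[of "c k"] by (simp add: power_less_one_iff)
        ultimately show False using ws(2) by simp
      qed
    qed
    then have "c j = of_int \<lfloor>c j\<rfloor>" if "j < length ws" for j using that by (simp add: frac_def)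
    then show "\<exists>c :: nat \<Rightarrow> int. z = (\<Sum>j<length ws. of_int (c j) *\<^sub>R (ws ! j))"
      unfolding c by (intro exI[of _ "\<lambda>j. \<lfloor>c j\<rfloor>"] sum.cong) auto
  qed
  then show ?thesis using that ws unfolding ws_def by blast
qed

lemma gram_map_lincomb:
  fixes f :: "'v::euclidean_space \<Rightarrow> 'w::euclidean_space"
  assumes f: "linear f" and A: "A \<in> carrier_mat n n" and n: "length xs = n" "length ys = n"
    and ys: "\<And>i. i < n \<Longrightarrow> ys ! i = (\<Sum>j<n. (A $$ (i, j)) *\<^sub>R (xs ! j))"
  shows "gram (map f ys) = (det A)\<^sup>2 * gram (map f xs)"
proof (rule gram_lincomb[OF A])
  fix i assume "i < n"
  then show "map f ys ! i = (\<Sum>j<n. A $$ (i, j) *\<^sub>R map f xs ! j)"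
    using n by (simp add: ys linear_sum[OF f] linear_scale[OF f])
qed (use n in auto)

text \<open>\<open>xs\<close> is an integer combination of \<open>ws\<close> whose matrix has
  nonzero determinant, in absolute value the index of the sublattice, so its square is at least 1.
  The same factor relates the images under every \<open>f\<close>.\<close>

lemma gram_map_lattice_basis_le:
  fixes f :: "'v::euclidean_space \<Rightarrow> 'w::euclidean_space"
  assumes f: "linear f" and ws: "generates_lattice ws" and xs: "set xs \<subseteq> integer_vectors"
    "0 < gram xs" "span (set xs) = span (set ws)" "length xs = length ws"
  shows "gram (map f ws) \<le> gram (map f xs)"
proof -
  define n where "n = length ws"
  have "\<exists>c :: nat \<Rightarrow> int. xs ! i = (\<Sum>j<n. of_int (c j) *\<^sub>R (ws ! j))" if "i < n" for i
  proof -
    have "xs ! i \<in> set xs" using that xs(4) by (simp add: n_def)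
    then have "xs ! i \<in> integer_vectors \<inter> span (set ws)" using xs(1,3) span_base by blast
    then show ?thesis using ws by (auto simp: generates_lattice_def n_def)
  qed
  then obtain M :: "nat \<Rightarrow> nat \<Rightarrow> int" where
    M: "\<And>i. i < n \<Longrightarrow> xs ! i = (\<Sum>j<n. of_int (M i j) *\<^sub>R (ws ! j))" by metis
  define B where "B = Matrix.mat n n (\<lambda>(i, j). M i j)"
  define A :: "real mat" where "A = map_mat of_int B"
  have A: "A \<in> carrier_mat n n" by (simp add: A_def B_def)
  have detA: "det A = of_int (det B)" unfolding A_def by (rule of_int_hom.hom_det)
  have eq: "xs ! i = (\<Sum>j<n. A $$ (i, j) *\<^sub>R (ws ! j))" if "i < n" for i
    unfolding M[OF that] by (rule sum.cong) (use that in \<open>auto simp: A_def B_def\<close>)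
  have "gram xs = (det A)\<^sup>2 * gram ws"
    using eq xs(4) by (intro gram_lincomb[OF A]) (auto simp: n_def)
  then have "det B \<noteq> 0" using xs(2) detA by auto
  then have "0 < (det B)\<^sup>2" by simp
  then have "1 \<le> (det B)\<^sup>2" by linarith
  then have "1 \<le> (det A)\<^sup>2" unfolding detA by (metis of_int_1_le_iff of_int_power)
  moreover have "gram (map f xs) = (det A)\<^sup>2 * gram (map f ws)"
    using eq xs(4) by (intro gram_map_lincomb[OF f A]) (auto simp: n_def)
  ultimately show ?thesis using mult_right_mono[OF _ gram_nonneg, of 1 "(det A)\<^sup>2" "map f ws"] by simp
qed

text \<open>Submodularity of the covolume, applied to the two saturated lattices in
  \<open>span (set xs)\<close> and \<open>span (set ys)\<close>; \<open>us\<close> spans their intersection and \<open>ws\<close> their sum.\<close>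
lemma gram_lattice_submodular:
  fixes xs ys :: "'v::euclidean_space list"
  assumes xs: "set xs \<subseteq> integer_vectors" "0 < gram xs" "length xs = j"
    and ys: "set ys \<subseteq> integer_vectors" "0 < gram ys" "length ys = j"
    and neq: "span (set xs) \<noteq> span (set ys)"
  obtains us ws i where "i < j" "set us \<subseteq> integer_vectors" "0 < gram us" "length us = i"
    "set ws \<subseteq> integer_vectors" "0 < gram ws" "length ws = 2 * j - i"
    "\<And>f :: 'v \<Rightarrow> 'v. linear f \<Longrightarrow> gram (map f us) * gram (map f ws) \<le> gram (map f xs) * gram (map f ys)"
proof -
  define V where "V = span (integer_vectors \<inter> span (set xs) \<inter> span (set ys))"
  have V: "V \<subseteq> span (set xs)" "V \<subseteq> span (set ys)"
    unfolding V_def by (rule span_minimal, blast, rule subspace_span)+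
  have exV: "\<exists>S \<subseteq> integer_vectors. V = span S"
    by (rule exI[of _ "integer_vectors \<inter> span (set xs) \<inter> span (set ys)"]) (auto simp: V_def)
  obtain us where us: "set ([] @ us) \<subseteq> integer_vectors" "0 < gram ([] @ us)"
      "span (set ([] @ us)) = V" "generates_lattice ([] @ us)"
    by (rule lattice_basis_extension[OF _ _ generates_lattice_Nil _ exV]) simp_all
  note us = us[unfolded append_Nil]
  have usV: "set us \<subseteq> V" using us(3) span_superset by blast
  have usxs: "set us \<subseteq> span (set xs)" and usys: "set us \<subseteq> span (set ys)" using usV V by auto
  have exxs: "\<exists>S \<subseteq> integer_vectors. span (set xs) = span S" by (rule exI[of _ "set xs"]) (simp add: xs(1))
  have exys: "\<exists>S \<subseteq> integer_vectors. span (set ys) = span S" by (rule exI[of _ "set ys"]) (simp add: ys(1))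
  obtain as where as: "set (us @ as) \<subseteq> integer_vectors" "0 < gram (us @ as)"
    "span (set (us @ as)) = span (set xs)" "generates_lattice (us @ as)"
    by (rule lattice_basis_extension[OF us(1,2,4) usxs exxs])
  obtain bs where bs: "set (us @ bs) \<subseteq> integer_vectors" "0 < gram (us @ bs)"
    "span (set (us @ bs)) = span (set ys)" "generates_lattice (us @ bs)"
    by (rule lattice_basis_extension[OF us(1,2,4) usys exys])
  have la: "length (us @ as) = j" using dim_span_list[OF as(2)] dim_span_list[OF xs(2)] as(3) xs(3) by metis
  have lb: "length (us @ bs) = j" using dim_span_list[OF bs(2)] dim_span_list[OF ys(2)] bs(3) ys(3) by metis
  have i: "length us < j"
  proof (rule ccontr)
    assume "\<not> length us < j"
    then have "as = []" "bs = []" using la lb by auto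
    then show False using as(3) bs(3) neq by simp
  qed
  \<comment> \<open>\<open>us\<close> spans only the integer points common to both spans, so
    integrality is essential: an integer dependence splits into \<open>p + q = 0\<close>, where
    \<open>q\<close> is an integer vector in both spans and hence a combination of
    \<open>us\<close>.\<close>
  have pos: "0 < gram (us @ as @ bs)"
  proof (rule ccontr)
    assume "\<not> 0 < gram (us @ as @ bs)"
    then have g0: "gram (us @ as @ bs) = 0" using gram_nonneg[of "us @ as @ bs"] by linarith
    have int: "set (us @ as @ bs) \<subseteq> integer_vectors" using as(1) bs(1) by auto
    obtain c :: "nat \<Rightarrow> int" and i0 where c: "i0 < length (us @ as @ bs)" "c i0 \<noteq> 0"
      "(\<Sum>j<length (us @ as @ bs). of_int (c j) *\<^sub>R ((us @ as @ bs) ! j)) = 0"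
      by (rule integer_dependence[OF int g0])
    define p where "p = (\<Sum>k<j. of_int (c k) *\<^sub>R ((us @ as) ! k))"
    define q where "q = (\<Sum>k<length bs. of_int (c (j + k)) *\<^sub>R (bs ! k))"
    have split: "(\<Sum>k<j + l. F k) = (\<Sum>k<j. F k) + (\<Sum>k<l. F (j + k))" for l and F :: "nat \<Rightarrow> 'v"
      by (induction l) auto
    have len: "length (us @ as @ bs) = j + length bs" using la by simp
    have "p + q = 0"
    proof -
      have "((us @ as) @ bs) ! (j + k) = bs ! k" for k unfolding la[symmetric] by (rule nth_append_length_plus)
      moreover have "((us @ as) @ bs) ! k = (us @ as) ! k" if "k < j" for k
        using that la unfolding nth_append[of "us @ as"] by simp
      moreover have "(\<Sum>k<j + length bs. of_int (c k) *\<^sub>R (((us @ as) @ bs) ! k)) = 0"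
        using c(3) unfolding len by simp
      ultimately show ?thesis unfolding split p_def q_def by (simp del: append_assoc)
    qed
    have "p \<in> span (set xs)"
      unfolding p_def as(3)[symmetric] la[symmetric] by (rule lincomb_in_span)
    moreover have "q \<in> span (set bs)" unfolding q_def by (rule lincomb_in_span)
    then have "q \<in> span (set ys)" unfolding bs(3)[symmetric] using span_mono[of "set bs" "set (us @ bs)"] by auto
    moreover have "q \<in> integer_vectors"
      unfolding q_def using bs(1) by (intro integer_vectors_lincomb) auto
    moreover have "q = - p" using \<open>p + q = 0\<close> by (simp add: eq_neg_iff_add_eq_0 add.commute)
    ultimately have "q \<in> integer_vectors \<inter> span (set xs) \<inter> span (set ys)"
      using span_neg[of p "set xs"] by simp
    then have "q \<in> span (set us)" unfolding us(3) V_def by (rule span_base)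
    then have "q \<in> integer_vectors \<inter> span (set us)" using \<open>q \<in> integer_vectors\<close> by (rule IntI[rotated])
    then obtain e :: "nat \<Rightarrow> int" where e: "q = (\<Sum>k<length us. of_int (e k) *\<^sub>R (us ! k))"
      using us(4) by (auto simp: generates_lattice_def)
    \<comment> \<open>Writing \<open>q\<close> both over \<open>bs\<close> and over
      \<open>us\<close> gives a relation in the independent list \<open>us @ bs\<close>, so the
      coefficients on \<open>bs\<close> vanish; what remains is a relation in
      \<open>us @ as\<close>.\<close>
    define F where "F k = (if k < length us then - of_int (e k) else of_int (c (j + (k - length us))) :: real)" for k
    have splitu: "(\<Sum>k<length us + l. G k) = (\<Sum>k<length us. G k) + (\<Sum>k<l. G (length us + k))" for l and G :: "nat \<Rightarrow> 'v"
      by (induction l) auto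
    have "(\<Sum>k<length (us @ bs). F k *\<^sub>R ((us @ bs) ! k)) = - q + q"
    proof -
      have "(\<Sum>k<length us. F k *\<^sub>R ((us @ bs) ! k)) = - q"
        unfolding e by (simp add: F_def nth_append sum_negf)
      moreover have "(\<Sum>k<length bs. F (length us + k) *\<^sub>R ((us @ bs) ! (length us + k))) = q"
        unfolding q_def by (simp add: F_def)
      ultimately show ?thesis unfolding length_append splitu by simp
    qed
    then have zero: "F k = 0" if "k < length (us @ bs)" for k
      using lincomb_eq_0_imp[OF bs(2) _ that] by simp
    have cb: "c (j + k) = 0" if "k < length bs" for k
      using zero[of "length us + k"] that by (simp add: F_def)
    then have "q = 0" by (simp add: q_def)
    then have "p = 0" using \<open>p + q = 0\<close> by simp
    then have ca: "real_of_int (c k) = 0" if "k < j" for k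
      using lincomb_eq_0_imp[OF as(2), of "\<lambda>k. of_int (c k)" k] that la by (simp add: p_def)
    show False
    proof (cases "i0 < j")
      case True
      then show False using ca c(2) by simp
    next
      case False
      then have "i0 - j < length bs" "j + (i0 - j) = i0" using c(1) unfolding len by linarith+
      then show False using cb[of "i0 - j"] c(2) by simp
    qed
  qed
  \<comment> \<open>The lists were built without reference to \<open>f\<close>, so one choice serves
    for all linear maps, in particular for \<open>dani\<close> at every scale.\<close>
  have "gram (map f us) * gram (map f (us @ as @ bs)) \<le> gram (map f xs) * gram (map f ys)"
    if f: "linear f" for f :: "'v \<Rightarrow> 'v"
  proof -
    have "gram (map f us) * gram (map f (us @ as @ bs)) \<le> gram (map f (us @ as)) * gram (map f (us @ bs))"
      using gram_append_submodular[of "map f us" "map f as" "map f bs"] by (simp add: mult.commute)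
    also have "\<dots> \<le> gram (map f xs) * gram (map f ys)"
      using gram_map_lattice_basis_le[OF f as(4) xs(1,2)] gram_map_lattice_basis_le[OF f bs(4) ys(1,2)]
        as(3) bs(3) la lb xs(3) ys(3) by (intro mult_mono) (auto simp: gram_nonneg)
    finally show ?thesis .
  qed
  moreover have "set (us @ as @ bs) \<subseteq> integer_vectors" using as(1) bs(1) by auto
  moreover have "length (us @ as @ bs) = 2 * j - length us" using la lb by simp
  ultimately show ?thesis by (intro that[OF i us(1,2) refl _ pos])
qed

section \<open>Forcing in the hyperplane game\<close>

text \<open>From Bob's ball \<open>cball c r\<close>, Alice can reach within \<open>n\<close> moves
  a ball with \<open>Q\<close>. The property is claimed only at the moment when it is reached; the
  first alternative lets her stop early, as the number of moves used depends on Bob's radii.\<close>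

fun forces ::
    "real \<Rightarrow> nat \<Rightarrow> ('a::euclidean_space \<Rightarrow> real \<Rightarrow> bool) \<Rightarrow> 'a \<Rightarrow> real \<Rightarrow> bool" where
  "forces \<beta> 0 Q c r \<longleftrightarrow> Q c r"
| "forces \<beta> (Suc n) Q c r \<longleftrightarrow> Q c r \<or>
     (\<exists>L \<epsilon>. affine_hyperplane L \<and> 0 < \<epsilon> \<and> \<epsilon> < \<beta> * r \<and>
        (\<forall>c' r'. \<beta> * r \<le> r' \<and> cball c' r' \<subseteq> cball c r - nbhd L \<epsilon> \<longrightarrow> forces \<beta> n Q c' r'))"

lemma forces_refl: "Q c r \<Longrightarrow> forces \<beta> n Q c r"
  by (cases n) auto

lemma forces_Suc: "forces \<beta> n Q c r \<Longrightarrow> forces \<beta> (Suc n) Q c r"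
proof (induction n arbitrary: c r)
  case 0
  then show ?case by simp
next
  case (Suc n)
  from Suc.prems consider "Q c r" | L \<epsilon> where "affine_hyperplane L" "0 < \<epsilon>" "\<epsilon> < \<beta> * r"
      "\<And>c' r'. \<beta> * r \<le> r' \<Longrightarrow> cball c' r' \<subseteq> cball c r - nbhd L \<epsilon> \<Longrightarrow> forces \<beta> n Q c' r'"
    by auto
  then show ?case
  proof cases
    case 2
    then show ?thesis
      using Suc.IH unfolding forces.simps(2)[of \<beta> "Suc n"] by blast
  qed simp
qed

lemma forces_mono:
  assumes "forces \<beta> n Q c r" "n \<le> n'"
  shows "forces \<beta> n' Q c r"
  using assms(2,1) by (induction n' rule: dec_induct) (auto intro: forces_Suc simp del: forces.simps)

text \<open>Concatenation of strategies. Bob keeps at least the fraction \<open>\<beta>\<close> of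
  his radius per move, so \<open>\<beta> ^ n * r\<close> bounds from below the ball on which the
  second strategy starts; the uniform constants below rest on this.\<close>

lemma forces_trans:
  assumes "forces \<beta> n Q c r" and "0 < \<beta>" and "\<beta> < 1" and "0 < r"
    and "\<And>c' r'. Q c' r' \<Longrightarrow> \<beta> ^ n * r \<le> r' \<Longrightarrow> r' \<le> r \<Longrightarrow> cball c' r' \<subseteq> cball c r \<Longrightarrow> forces \<beta> m Q' c' r'"
  shows "forces \<beta> (n + m) Q' c r"
  using assms(1,4,5)
proof (induction n arbitrary: c r)
  case 0
  then show ?case by auto
next
  case (Suc n)
  from Suc.prems(1) consider "Q c r" | L \<epsilon> where "affine_hyperplane L" "0 < \<epsilon>" "\<epsilon> < \<beta> * r"
      "\<And>c' r'. \<beta> * r \<le> r' \<Longrightarrow> cball c' r' \<subseteq> cball c r - nbhd L \<epsilon> \<Longrightarrow> forces \<beta> n Q c' r'"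
    by auto
  then show ?case
  proof cases
    case 1
    have "\<beta> ^ Suc n * r \<le> 1 * r"
      using \<open>0 < \<beta>\<close> \<open>\<beta> < 1\<close> Suc.prems(2) by (intro mult_right_mono power_le_one) auto
    then have "forces \<beta> m Q' c r" using Suc.prems(3)[OF 1] by simp
    then show ?thesis by (rule forces_mono) simp
  next
    case 2
    have "forces \<beta> (n + m) Q' c' r'" if r': "\<beta> * r \<le> r'" "cball c' r' \<subseteq> cball c r - nbhd L \<epsilon>" for c' r'
    proof (rule Suc.IH[OF 2(4)[OF r']])
      show "0 < r'" using r' \<open>0 < \<beta>\<close> Suc.prems(2) by (smt (verit) mult_pos_pos)
      have sub: "cball c' r' \<subseteq> cball c r" using r' by auto
      have "r' \<le> r"
        using sub \<open>0 < r'\<close> Suc.prems(2) zero_le_dist[of c' c]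
        unfolding cball_subset_cball_iff by linarith
      fix c'' r'' assume *: "Q c'' r''" "\<beta> ^ n * r' \<le> r''" "r'' \<le> r'" "cball c'' r'' \<subseteq> cball c' r'"
      have "\<beta> ^ Suc n * r \<le> \<beta> ^ n * r'"
        using r'(1) \<open>0 < \<beta>\<close> by (simp add: mult.assoc mult_left_mono mult.left_commute)
      then show "forces \<beta> m Q' c'' r''"
        using * sub \<open>r' \<le> r\<close> by (intro Suc.prems(3)) auto
    qed
    then show ?thesis using 2(1-3) unfolding add_Suc forces.simps(2) by blast
  qed
qed

lemma forces_weaken:
  assumes "forces \<beta> n Q c r" and "0 < \<beta>" and "\<beta> < 1" and "0 < r"
    and "\<And>c' r'. Q c' r' \<Longrightarrow> \<beta> ^ n * r \<le> r' \<Longrightarrow> r' \<le> r \<Longrightarrow> cball c' r' \<subseteq> cball c r \<Longrightarrow> Q' c' r'"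
  shows "forces \<beta> n Q' c r"
  using forces_trans[OF assms(1-4), of 0 Q'] assms(5) by simp

lemma dist_ge_if_disjoint_nbhd:
  assumes "x \<notin> nbhd {x. a \<bullet> x = b} \<epsilon>" "a \<noteq> 0"
  shows "\<epsilon> * norm a \<le> \<bar>a \<bullet> x - b\<bar>"
proof -
  define y where "y = x - ((a \<bullet> x - b) / (a \<bullet> a)) *\<^sub>R a"
  have "a \<bullet> y = b" using assms(2) by (simp add: y_def inner_diff_right)
  then have "\<epsilon> \<le> dist y x" using assms(1) by (auto simp: nbhd_def)
  also have "dist y x = \<bar>a \<bullet> x - b\<bar> / norm a"
    using assms(2) by (simp add: y_def dist_norm power2_eq_square flip: power2_norm_eq_inner)
  finally show ?thesis using assms(2) by (simp add: pos_le_divide_eq)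
qed

text \<open>A ball that avoids a hyperplane through the centre \<open>c\<close> lies on one side of it.\<close>
lemma forces_halve:
  fixes c :: "'a::euclidean_space"
  assumes "0 < \<beta>" "\<beta> < 1" "0 < r"
  shows "forces \<beta> 1 (\<lambda>c' r'. r' \<le> r / 2) c r"
proof -
  obtain a :: 'a where a: "a \<in> Basis" using nonempty_Basis by blast
  define L where "L = {x. a \<bullet> x = a \<bullet> c}"
  have "affine_hyperplane L" using nonzero_Basis[OF a] unfolding affine_hyperplane_def L_def by blast
  moreover have "r' \<le> r / 2" if r': "\<beta> * r \<le> r'" and sub: "cball c' r' \<subseteq> cball c r - nbhd L (\<beta> * r / 2)"
    for c' r'
  proof -
    define u where "u = a \<bullet> (c' - c)"
    define s where "s = (if 0 \<le> u then 1 else - 1 :: real)"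
    have pos: "0 < r'" using r' assms by (smt (verit) mult_pos_pos)
    have "r' \<le> \<bar>u\<bar>"
    proof (rule ccontr)
      assume "\<not> r' \<le> \<bar>u\<bar>"
      then have "c' - u *\<^sub>R a \<in> cball c' r'" using a by (simp add: dist_norm)
      moreover have "c' - u *\<^sub>R a \<in> L"
        using a by (simp add: L_def u_def inner_diff_right)
      then have "c' - u *\<^sub>R a \<in> nbhd L (\<beta> * r / 2)"
        using assms by (auto simp: nbhd_def intro!: bexI[of _ "c' - u *\<^sub>R a"])
      ultimately show False using sub by blast
    qed
    \<comment> \<open>The point of Bob's ball farthest from the hyperplane gives
      \<open>\<bar>u\<bar> + r' \<le> r\<close>; with \<open>r' \<le> \<bar>u\<bar>\<close> the
      radius is halved.\<close>
    have "c' + (s * r') *\<^sub>R a \<in> cball c' r'" using a pos by (simp add: dist_norm s_def)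
    then have "c' + (s * r') *\<^sub>R a \<in> cball c r" using sub by blast
    then have "norm (c' + (s * r') *\<^sub>R a - c) \<le> r" by (simp add: dist_norm norm_minus_commute)
    moreover have "\<bar>a \<bullet> (c' + (s * r') *\<^sub>R a - c)\<bar> \<le> norm (c' + (s * r') *\<^sub>R a - c)"
      using Basis_le_norm[OF a, of "c' + (s * r') *\<^sub>R a - c"] by (simp add: inner_commute)
    moreover have "a \<bullet> (c' + (s * r') *\<^sub>R a - c) = u + s * r'"
      using a by (simp add: u_def inner_diff_right inner_add_right)
    ultimately show ?thesis using \<open>r' \<le> \<bar>u\<bar>\<close> pos by (auto simp: s_def split: if_splits)
  qed
  ultimately show ?thesis
    using assms by (auto intro!: exI[of _ L] exI[of _ "\<beta> * r / 2"])
qed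

text \<open>Bob may shrink slowly, so Alice halves the radius until it first drops to
  \<open>X\<close>. A ball reached from a radius above \<open>X\<close> has radius at least
  \<open>\<beta> * X\<close>, so the window cannot be skipped; \<open>2 ^ n\<close> limits the
  number of halvings.\<close>

lemma forces_radius_window:
  assumes \<beta>: "0 < \<beta>" "\<beta> < 1" and r: "\<beta> * X \<le> r" "r \<le> 2 ^ n * X" and X: "0 < X"
  shows "forces \<beta> n (\<lambda>c' r'. \<beta> * X \<le> r' \<and> r' \<le> X \<and> cball c' r' \<subseteq> cball c r) c r"
  using r
proof (induction n arbitrary: c r)
  case (Suc n)
  show ?case
  proof (cases "r \<le> X")
    case True
    then show ?thesis using Suc.prems by (intro forces_refl) auto
  next
    case False
    then have r0: "0 < r" using X by simp
    have "forces \<beta> (1 + n) (\<lambda>c' r'. \<beta> * X \<le> r' \<and> r' \<le> X \<and> cball c' r' \<subseteq> cball c r) c r"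
    proof (rule forces_trans[OF forces_halve[OF \<beta> r0] \<beta> r0])
      fix c' r' assume *: "r' \<le> r / 2" "\<beta> ^ 1 * r \<le> r'" "cball c' r' \<subseteq> cball c r"
      have "\<beta> * X \<le> \<beta> * r" using False \<beta> by simp
      then have "forces \<beta> n (\<lambda>c'' r''. \<beta> * X \<le> r'' \<and> r'' \<le> X \<and> cball c'' r'' \<subseteq> cball c' r') c' r'"
        using * Suc.prems(2) by (intro Suc.IH) auto
      moreover have "0 < r'" using * \<beta> r0 by (smt (verit) mult_pos_pos power_one_right)
      ultimately show "forces \<beta> n (\<lambda>c' r'. \<beta> * X \<le> r' \<and> r' \<le> X \<and> cball c' r' \<subseteq> cball c r) c' r'"
        using * \<beta> by (elim forces_weaken) auto
    qed
    then show ?thesis by simp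
  qed
qed auto

text \<open>The tasks are done one after the other, and heredity under shrinking keeps those already
  done. A task may start from a ball smaller by the factor \<open>\<beta> ^ (l * N)\<close>, which
  is why \<open>step\<close> speaks of all such balls.\<close>

lemma forces_conj:
  fixes Q :: "nat \<Rightarrow> 'a::euclidean_space \<Rightarrow> real \<Rightarrow> bool"
  assumes \<beta>: "0 < \<beta>" "\<beta> < 1" and r: "0 < r"
    and her: "\<And>i c r c' r'. i < l \<Longrightarrow> Q i c r \<Longrightarrow> 0 < r' \<Longrightarrow> r' \<le> r \<Longrightarrow> cball c' r' \<subseteq> cball c r \<Longrightarrow> Q i c' r'"
    and step: "\<And>i c' r'. i < l \<Longrightarrow> \<beta> ^ (l * N) * r \<le> r' \<Longrightarrow> r' \<le> r \<Longrightarrow> cball c' r' \<subseteq> cball c r \<Longrightarrow> forces \<beta> N (Q i) c' r'"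
  shows "forces \<beta> (l * N) (\<lambda>c' r'. \<forall>i<l. Q i c' r') c r"
proof -
  have "k \<le> l \<Longrightarrow> forces \<beta> (k * N) (\<lambda>c' r'. \<forall>i<k. Q i c' r') c r" for k
  proof (induction k)
    case (Suc k)
    have "forces \<beta> (k * N + N) (\<lambda>c' r'. \<forall>i<Suc k. Q i c' r') c r"
    proof (rule forces_trans[OF Suc.IH \<beta> r])
      fix c' r' assume *: "\<forall>i<k. Q i c' r'" "\<beta> ^ (k * N) * r \<le> r'" "r' \<le> r" "cball c' r' \<subseteq> cball c r"
      have "\<beta> ^ (l * N) \<le> \<beta> ^ (k * N)" using \<beta> Suc.prems by (intro power_decreasing) auto
      then have "\<beta> ^ (l * N) * r \<le> r'" using * r by (meson mult_right_mono order.trans less_imp_le)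
      then have f: "forces \<beta> N (Q k) c' r'" using * Suc.prems by (intro step) auto
      have "0 < \<beta> ^ (k * N) * r" using \<beta> r by simp
      then have r': "0 < r'" using * by linarith
      show "forces \<beta> N (\<lambda>c' r'. \<forall>i<Suc k. Q i c' r') c' r'"
      proof (rule forces_weaken[OF f \<beta> r'])
        fix c'' r'' assume **: "Q k c'' r''" "\<beta> ^ N * r' \<le> r''" "r'' \<le> r'" "cball c'' r'' \<subseteq> cball c' r'"
        have "0 < \<beta> ^ N * r'" using \<beta> r' by simp
        then have "0 < r''" using ** by linarith
        then show "\<forall>i<Suc k. Q i c'' r''"
          using * ** Suc.prems her[of _ c' r' r'' c''] by (auto simp: less_Suc_eq)
      qed
    qed (use Suc.prems in auto)
    then show ?case by (simp add: add.commute)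
  qed simp
  then show ?thesis by simp
qed

lemma affine_hyperplane_similarity:
  fixes L :: "'a::euclidean_space set"
  assumes "affine_hyperplane L" "0 < s"
  shows "affine_hyperplane ((\<lambda>x. c0 + s *\<^sub>R x) ` L)"
proof -
  obtain a b where ab: "a \<noteq> 0" "L = {x. a \<bullet> x = b}" using assms by (auto simp: affine_hyperplane_def)
  have "(\<lambda>x. c0 + s *\<^sub>R x) ` L = {x. a \<bullet> x = a \<bullet> c0 + s * b}"
  proof (rule Set.set_eqI, rule iffI)
    fix y assume "y \<in> {x. a \<bullet> x = a \<bullet> c0 + s * b}"
    then have "(1 / s) *\<^sub>R (y - c0) \<in> L" "y = c0 + s *\<^sub>R ((1 / s) *\<^sub>R (y - c0))"
      using ab assms(2) by (auto simp: inner_diff_right)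
    then show "y \<in> (\<lambda>x. c0 + s *\<^sub>R x) ` L" by blast
  qed (auto simp: ab inner_add_right)
  then show ?thesis using ab(1) by (auto simp: affine_hyperplane_def)
qed

text \<open>Homotheties preserve the game, so constants found for the unit ball hold for every
  ball.\<close>

lemma forces_similarity:
  fixes c :: "'a::euclidean_space"
  assumes s: "0 < s" and f: "forces \<beta> n (\<lambda>c r. Q (c0 + s *\<^sub>R c) (s * r)) c r"
  shows "forces \<beta> n Q (c0 + s *\<^sub>R c) (s * r)"
  using f
proof (induction n arbitrary: c r)
  case (Suc n)
  from Suc.prems consider "Q (c0 + s *\<^sub>R c) (s * r)"
    | L \<epsilon> where "affine_hyperplane L" "0 < \<epsilon>" "\<epsilon> < \<beta> * r"
      "\<And>c' r'. \<beta> * r \<le> r' \<Longrightarrow> cball c' r' \<subseteq> cball c r - nbhd L \<epsilon> \<Longrightarrow>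
         forces \<beta> n (\<lambda>c r. Q (c0 + s *\<^sub>R c) (s * r)) c' r'"
    by auto
  then show ?case
  proof cases
    case 2
    define g where "g = (\<lambda>x. c0 + s *\<^sub>R x)"
    have dg: "dist (g x) (g y) = s * dist x y" for x y
    proof -
      have "g x - g y = s *\<^sub>R (x - y)" by (simp add: g_def scaleR_diff_right)
      then show ?thesis using s by (simp add: dist_norm)
    qed
    have "forces \<beta> n Q c' r'"
      if r': "\<beta> * (s * r) \<le> r'" "cball c' r' \<subseteq> cball (g c) (s * r) - nbhd (g ` L) (s * \<epsilon>)" for c' r'
    proof -
      define d where "d = (1 / s) *\<^sub>R (c' - c0)"
      have c': "c' = g d" using s by (simp add: d_def g_def)
      have "cball d (r' / s) \<subseteq> cball c r - nbhd L \<epsilon>"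
      proof
        fix x assume "x \<in> cball d (r' / s)"
        then have "g x \<in> cball c' r'" using s by (simp add: c' dg pos_le_divide_eq mult.commute)
        then have *: "g x \<in> cball (g c) (s * r)" "g x \<notin> nbhd (g ` L) (s * \<epsilon>)" using r' by auto
        show "x \<in> cball c r - nbhd L \<epsilon>"
          using * s by (auto simp: dg nbhd_def)
      qed
      moreover have "\<beta> * r \<le> r' / s" using r'(1) s by (simp add: pos_le_divide_eq mult_ac)
      ultimately have "forces \<beta> n Q (c0 + s *\<^sub>R d) (s * (r' / s))"
        using 2(4) Suc.IH by blast
      then show ?thesis using s by (simp add: c' g_def)
    qed
    moreover have "affine_hyperplane (g ` L)" "0 < s * \<epsilon>" "s * \<epsilon> < \<beta> * (s * r)"
      using 2 s affine_hyperplane_similarity by (auto simp: g_def)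
    ultimately show ?thesis unfolding g_def forces.simps(2) by blast
  qed simp
qed simp

section \<open>Forcing polynomials away from zero\<close>

text \<open>Polynomials of degree at most \<open>D\<close> that are bounded by \<open>M\<close> on the unit ball together with all
  their iterated partial derivatives; \<open>g\<close> is the gradient of \<open>f\<close>.\<close>
fun bounded_poly :: "nat \<Rightarrow> real \<Rightarrow> ('a::euclidean_space \<Rightarrow> real) \<Rightarrow> bool" where
  "bounded_poly 0 M f \<longleftrightarrow> (\<exists>a. f = (\<lambda>_. a) \<and> \<bar>a\<bar> \<le> M)"
| "bounded_poly (Suc D) M f \<longleftrightarrow> (\<forall>x\<in>cball 0 1. \<bar>f x\<bar> \<le> M) \<and>
     (\<exists>g. (\<forall>x. (f has_derivative (\<lambda>h. g x \<bullet> h)) (at x)) \<and> (\<forall>b\<in>Basis. bounded_poly D M (\<lambda>x. g x \<bullet> b)))"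

lemma bounded_poly_bound: "bounded_poly D M f \<Longrightarrow> x \<in> cball 0 1 \<Longrightarrow> \<bar>f x\<bar> \<le> M"
  by (cases D) auto

lemma bounded_poly_nonneg: "bounded_poly D M f \<Longrightarrow> 0 \<le> M"
  using bounded_poly_bound[of D M f 0] by simp

lemma bounded_poly_mono: "bounded_poly D M f \<Longrightarrow> M \<le> M' \<Longrightarrow> bounded_poly D M' f"
  by (induction D arbitrary: f) (auto 0 4)

lemma bounded_poly_Suc: "bounded_poly D M f \<Longrightarrow> bounded_poly (Suc D) M f"
proof (induction D arbitrary: f)
  case 0
  then have "0 \<le> M" using bounded_poly_nonneg by blast
  moreover obtain a where "f = (\<lambda>_. a)" "\<bar>a\<bar> \<le> M" using 0 by auto
  moreover have "((\<lambda>_. a) has_derivative (\<lambda>h. 0 \<bullet> h)) (at x)" for x :: 'a by simp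
  moreover have "bounded_poly 0 M (\<lambda>x :: 'a. 0 \<bullet> b)" for b :: 'a
    using \<open>0 \<le> M\<close> by (auto intro: exI[of _ 0])
  ultimately show ?case unfolding bounded_poly.simps(2) by (intro conjI exI[of _ "\<lambda>_. 0"]) blast+
next
  case (Suc D)
  then obtain g where g: "\<forall>x. (f has_derivative (\<lambda>h. g x \<bullet> h)) (at x)"
    "\<forall>b\<in>Basis. bounded_poly D M (\<lambda>x. g x \<bullet> b)" "\<forall>x\<in>cball 0 1. \<bar>f x\<bar> \<le> M" by auto
  have "\<forall>b\<in>Basis. bounded_poly (Suc D) M (\<lambda>x. g x \<bullet> b)" using g(2) Suc.IH by blast
  then show ?case using g(1,3) unfolding bounded_poly.simps(2)[of "Suc D"] by blast
qed

lemma bounded_poly_le: "bounded_poly D M f \<Longrightarrow> D \<le> D' \<Longrightarrow> bounded_poly D' M f"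
  by (rotate_tac, induction D' rule: dec_induct) (auto intro: bounded_poly_Suc simp del: bounded_poly.simps)

lemma bounded_poly_add:
  "bounded_poly D M f \<Longrightarrow> bounded_poly D M' f' \<Longrightarrow> bounded_poly D (M + M') (\<lambda>x. f x + f' x)"
proof (induction D arbitrary: f f')
  case 0
  then obtain a a' where "f = (\<lambda>_. a)" "\<bar>a\<bar> \<le> M" "f' = (\<lambda>_. a')" "\<bar>a'\<bar> \<le> M'" by auto
  then show ?case by (auto intro!: exI[of _ "a + a'"])
next
  case (Suc D)
  then obtain g g' where g: "\<And>x. (f has_derivative (\<lambda>h. g x \<bullet> h)) (at x)"
      "\<forall>b\<in>Basis. bounded_poly D M (\<lambda>x. g x \<bullet> b)"
    and g': "\<And>x. (f' has_derivative (\<lambda>h. g' x \<bullet> h)) (at x)"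
      "\<forall>b\<in>Basis. bounded_poly D M' (\<lambda>x. g' x \<bullet> b)" by auto
  have "\<bar>f x + f' x\<bar> \<le> M + M'" if "x \<in> cball 0 1" for x
    using bounded_poly_bound[OF Suc.prems(1) that] bounded_poly_bound[OF Suc.prems(2) that] by linarith
  moreover have "((\<lambda>x. f x + f' x) has_derivative (\<lambda>h. (g x + g' x) \<bullet> h)) (at x)" for x
    using has_derivative_add[OF g(1)[of x] g'(1)[of x]] by (simp add: inner_add_left)
  moreover have "\<forall>b\<in>Basis. bounded_poly D (M + M') (\<lambda>x. (g x + g' x) \<bullet> b)"
    using Suc.IH g(2) g'(2) by (simp add: inner_add_left)
  ultimately show ?case unfolding bounded_poly.simps(2) by (intro conjI exI[of _ "\<lambda>x. g x + g' x"]) blast+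
qed

lemma bounded_poly_scale:
  "bounded_poly D M f \<Longrightarrow> bounded_poly D (\<bar>a\<bar> * M) (\<lambda>x. a * f x)"
proof (induction D arbitrary: f)
  case 0
  then obtain b where "f = (\<lambda>_. b)" "\<bar>b\<bar> \<le> M" by auto
  then show ?case by (auto intro!: exI[of _ "a * b"] mult_left_mono simp: abs_mult)
next
  case (Suc D)
  then obtain g where g: "\<And>x. (f has_derivative (\<lambda>h. g x \<bullet> h)) (at x)"
      "\<forall>b\<in>Basis. bounded_poly D M (\<lambda>x. g x \<bullet> b)" by auto
  have "\<bar>a * f x\<bar> \<le> \<bar>a\<bar> * M" if "x \<in> cball 0 1" for x
    using bounded_poly_bound[OF Suc.prems(1) that] by (simp add: abs_mult mult_left_mono)
  moreover have "((\<lambda>x. a * f x) has_derivative (\<lambda>h. (a *\<^sub>R g x) \<bullet> h)) (at x)" for x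
    using has_derivative_mult_right[OF g(1)[of x], of a] by simp
  moreover have "\<forall>b\<in>Basis. bounded_poly D (\<bar>a\<bar> * M) (\<lambda>x. (a *\<^sub>R g x) \<bullet> b)"
    using Suc.IH g(2) by simp
  ultimately show ?case unfolding bounded_poly.simps(2) by (intro conjI exI[of _ "\<lambda>x. a *\<^sub>R g x"]) blast+
qed

text \<open>The product rule lowers the degree of one factor at a time, hence the induction on
  \<open>D + D'\<close>; it produces two products, hence a factor 2 per degree.\<close>

lemma bounded_poly_mult:
  "bounded_poly D M f \<Longrightarrow> bounded_poly D' M' f' \<Longrightarrow>
   bounded_poly (D + D') (2 ^ (D + D') * (M * M')) (\<lambda>x. f x * f' x)"
proof (induction "D + D'" arbitrary: D D' f f' rule: less_induct)
  case less
  have MM: "0 \<le> M" "0 \<le> M'" using less.prems bounded_poly_nonneg by blast+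
  have big: "a * b \<le> 2 ^ n * (M * M')" if "0 \<le> a" "0 \<le> b" "a \<le> M" "b \<le> M'" for a b and n :: nat
  proof -
    have "a * b \<le> M * M'" using that by (intro mult_mono) auto
    moreover have "1 * (M * M') \<le> 2 ^ n * (M * M')" using MM by (intro mult_right_mono) auto
    ultimately show ?thesis by linarith
  qed
  show ?case
  proof (cases "D = 0")
    case True
    then obtain a where a: "f = (\<lambda>_. a)" "\<bar>a\<bar> \<le> M" using less.prems(1) by auto
    show ?thesis
      using bounded_poly_mono[OF bounded_poly_scale[OF less.prems(2), of a] big] a MM True by simp
  next
    case D: False
    show ?thesis
    proof (cases "D' = 0")
      case True
      then obtain a where a: "f' = (\<lambda>_. a)" "\<bar>a\<bar> \<le> M'" using less.prems(2) by auto
      show ?thesis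
        using bounded_poly_mono[OF bounded_poly_scale[OF less.prems(1), of a], of "2 ^ D * (M * M')"]
          big[of M "\<bar>a\<bar>" D] a MM True by (simp add: mult.commute)
    next
      case False
      with D obtain d d' where d: "D = Suc d" "D' = Suc d'" using not0_implies_Suc by blast
      obtain g where g: "\<And>x. (f has_derivative (\<lambda>h. g x \<bullet> h)) (at x)"
          "\<And>b. b \<in> Basis \<Longrightarrow> bounded_poly d M (\<lambda>x. g x \<bullet> b)"
        using less.prems(1) unfolding d bounded_poly.simps(2) by blast
      obtain g' where g': "\<And>x. (f' has_derivative (\<lambda>h. g' x \<bullet> h)) (at x)"
          "\<And>b. b \<in> Basis \<Longrightarrow> bounded_poly d' M' (\<lambda>x. g' x \<bullet> b)"
        using less.prems(2) unfolding d bounded_poly.simps(2) by blast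
      let ?G = "\<lambda>x. f x *\<^sub>R g' x + f' x *\<^sub>R g x"
      have "\<bar>f x * f' x\<bar> \<le> 2 ^ (D + D') * (M * M')" if "x \<in> cball 0 1" for x
        using bounded_poly_bound[OF less.prems(1) that] bounded_poly_bound[OF less.prems(2) that]
        by (simp add: abs_mult big)
      moreover have "((\<lambda>x. f x * f' x) has_derivative (\<lambda>h. ?G x \<bullet> h)) (at x)" for x
        using has_derivative_mult[OF g(1)[of x] g'(1)[of x]] by (simp add: inner_add_left mult.commute)
      moreover have "bounded_poly (d + Suc d') (2 ^ (D + D') * (M * M')) (\<lambda>x. ?G x \<bullet> b)" if b: "b \<in> Basis" for b
      proof -
        have "bounded_poly (Suc d + d') (2 ^ (Suc d + d') * (M * M')) (\<lambda>x. f x * (g' x \<bullet> b))"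
          by (rule less.hyps[OF _ less.prems(1)[unfolded d] g'(2)[OF b]]) (simp add: d)
        moreover have "bounded_poly (d + Suc d') (2 ^ (d + Suc d') * (M * M')) (\<lambda>x. (g x \<bullet> b) * f' x)"
          by (rule less.hyps[OF _ g(2)[OF b] less.prems(2)[unfolded d]]) (simp add: d)
        ultimately have "bounded_poly (d + Suc d') (2 ^ (d + Suc d') * (M * M') + 2 ^ (d + Suc d') * (M * M'))
            (\<lambda>x. f x * (g' x \<bullet> b) + (g x \<bullet> b) * f' x)"
          by (intro bounded_poly_add) auto
        moreover have "2 ^ (D + D') * (M * M') = 2 ^ (d + Suc d') * (M * M') + 2 ^ (d + Suc d') * (M * M')"
          by (simp add: d)
        moreover have "(\<lambda>x. ?G x \<bullet> b) = (\<lambda>x. f x * (g' x \<bullet> b) + (g x \<bullet> b) * f' x)"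
          by (simp add: inner_add_left mult.commute)
        ultimately show ?thesis by metis
      qed
      ultimately show ?thesis unfolding d add_Suc bounded_poly.simps(2)
        by (intro conjI exI[of _ ?G]) blast+
    qed
  qed
qed

lemma bounded_poly_sum:
  assumes "finite I" "\<And>i. i \<in> I \<Longrightarrow> bounded_poly D M (f i)"
  shows "bounded_poly D (real (card I) * M) (\<lambda>x. \<Sum>i\<in>I. f i x)"
  using assms
proof (induction I rule: finite_induct)
  case empty
  have "bounded_poly 0 0 (\<lambda>_. 0)" by simp
  then show ?case using bounded_poly_le[of 0 0 "\<lambda>_. 0" D] by simp
next
  case (insert i I)
  have "bounded_poly D (M + real (card I) * M) (\<lambda>x. f i x + (\<Sum>i\<in>I. f i x))"
    using insert by (intro bounded_poly_add) auto
  then show ?case using insert by (simp add: algebra_simps)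
qed

text \<open>The bound is chosen before the factors, so that it is uniform over them.\<close>

lemma bounded_poly_prod:
  assumes "0 \<le> M"
  shows "\<exists>M'. \<forall>f :: nat \<Rightarrow> 'a::euclidean_space \<Rightarrow> real. (\<forall>i<n. bounded_poly D M (f i)) \<longrightarrow>
           bounded_poly (n * D) M' (\<lambda>x. \<Prod>i<n. f i x)"
proof (induction n)
  case 0
  show ?case by (intro exI[of _ 1]) auto
next
  case (Suc n)
  then obtain M' where M': "\<And>f :: nat \<Rightarrow> 'a \<Rightarrow> real. \<forall>i<n. bounded_poly D M (f i) \<Longrightarrow>
      bounded_poly (n * D) M' (\<lambda>x. \<Prod>i<n. f i x)" by blast
  have "bounded_poly (Suc n * D) (2 ^ (n * D + D) * (M' * M)) (\<lambda>x. \<Prod>i<Suc n. f i x)"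
    if "\<forall>i<Suc n. bounded_poly D M (f i)" for f :: "nat \<Rightarrow> 'a \<Rightarrow> real"
    using bounded_poly_mult[OF M'[of f], of D M "f n"] that by (simp add: add.commute)
  then show ?case by blast
qed

lemma bounded_poly_affine:
  fixes l :: "'a::euclidean_space \<Rightarrow> real"
  assumes l: "linear l" and K: "\<And>x. \<bar>l x\<bar> \<le> K * norm x" and "0 \<le> K"
  shows "bounded_poly 1 (\<bar>a\<bar> + K) (\<lambda>x. a + l x)"
proof -
  define g where "g = (\<Sum>b\<in>Basis. l b *\<^sub>R b)"
  have lg: "l h = g \<bullet> h" for h
  proof -
    have "l h = l (\<Sum>b\<in>Basis. (h \<bullet> b) *\<^sub>R b)" by (simp add: euclidean_representation)
    also have "\<dots> = g \<bullet> h"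
      by (simp add: g_def linear_sum[OF l] linear_scale[OF l] inner_sum_left mult.commute inner_commute[of h])
    finally show ?thesis .
  qed
  have "((\<lambda>x. a + l x) has_derivative (\<lambda>h. g \<bullet> h)) (at x)" for x
    unfolding lg by (auto intro!: derivative_eq_intros)
  moreover have "\<bar>g \<bullet> b\<bar> \<le> \<bar>a\<bar> + K" if "b \<in> Basis" for b
    using K[of b] that by (simp flip: lg)
  moreover have "\<bar>a + l x\<bar> \<le> \<bar>a\<bar> + K" if "x \<in> cball 0 1" for x
  proof -
    have "K * norm x \<le> K * 1" using that \<open>0 \<le> K\<close> by (intro mult_left_mono) auto
    then show ?thesis using K[of x] by linarith
  qed
  ultimately show ?thesis by (auto intro!: exI[of _ "\<lambda>_. g"])
qed

lemma lipschitz_if_gradient_bounded: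
  fixes f :: "'a::euclidean_space \<Rightarrow> real"
  assumes S: "convex S" and g: "\<And>x. (f has_derivative (\<lambda>h. g x \<bullet> h)) (at x)"
    and B: "\<And>x. x \<in> S \<Longrightarrow> norm (g x) \<le> B" and xy: "x \<in> S" "y \<in> S"
  shows "\<bar>f x - f y\<bar> \<le> B * norm (x - y)"
proof -
  have "norm (f x - f y) \<le> B * norm (x - y)"
  proof (rule differentiable_bound[OF S])
    show "(f has_derivative (\<lambda>h. g x \<bullet> h)) (at x within S)" for x
      using g by (rule has_derivative_at_withinI)
    show "onorm (\<lambda>h. g x \<bullet> h) \<le> B" if "x \<in> S" for x
    proof (rule onorm_le)
      fix h
      have "norm (g x \<bullet> h) \<le> norm (g x) * norm h" using Cauchy_Schwarz_ineq2[of "g x" h] by simp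
      also have "\<dots> \<le> B * norm h" using B[OF that] by (intro mult_right_mono) auto
      finally show "norm (g x \<bullet> h) \<le> B * norm h" .
    qed
  qed (use xy in auto)
  then show ?thesis by simp
qed

lemma norm_le_components:
  fixes x :: "'a::euclidean_space"
  assumes "\<And>b. b \<in> Basis \<Longrightarrow> \<bar>x \<bullet> b\<bar> \<le> B"
  shows "norm x \<le> real DIM('a) * B"
  using norm_le_l1[of x] sum_bounded_above[of "Basis :: 'a set" "\<lambda>b. \<bar>x \<bullet> b\<bar>" B] assms by simp

lemma bounded_poly_lipschitz:
  fixes f :: "'a::euclidean_space \<Rightarrow> real"
  assumes f: "bounded_poly D M f" and xy: "x \<in> cball 0 1" "y \<in> cball 0 1"
  shows "\<bar>f x - f y\<bar> \<le> real DIM('a) * M * norm (x - y)"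
proof (cases D)
  case 0
  then show ?thesis using f bounded_poly_nonneg[OF f] by auto
next
  case (Suc d)
  then obtain g where g: "\<And>x. (f has_derivative (\<lambda>h. g x \<bullet> h)) (at x)"
      "\<And>b. b \<in> Basis \<Longrightarrow> bounded_poly d M (\<lambda>x. g x \<bullet> b)" using f by auto
  show ?thesis
    by (rule lipschitz_if_gradient_bounded[OF convex_cball g(1) norm_le_components xy])
      (use bounded_poly_bound[OF g(2)] in auto)
qed

text \<open>The mean value inequality for \<open>f\<close> minus its linear part at
  \<open>c\<close>, on the segment from \<open>c\<close> to \<open>x\<close>: there the gradient
  differs from \<open>g c\<close> by at most a Lipschitz constant times
  \<open>norm (x - c)\<close>.\<close>

lemma bounded_poly_taylor:
  fixes f :: "'a::euclidean_space \<Rightarrow> real"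
  assumes g: "\<And>x. (f has_derivative (\<lambda>h. g x \<bullet> h)) (at x)"
      "\<And>b. b \<in> Basis \<Longrightarrow> bounded_poly D M (\<lambda>x. g x \<bullet> b)"
    and xy: "x \<in> cball 0 1" "c \<in> cball 0 1"
  shows "\<bar>f x - f c - g c \<bullet> (x - c)\<bar> \<le> (real DIM('a))\<^sup>2 * M * (norm (x - c))\<^sup>2"
proof -
  define S where "S = closed_segment c x"
  have S: "S \<subseteq> cball 0 1" unfolding S_def using xy by (intro closed_segment_subset) auto
  obtain b0 :: 'a where "b0 \<in> Basis" using nonempty_Basis by blast
  then have "0 \<le> M" using bounded_poly_nonneg[OF g(2)] by blast
  have "\<bar>(f x - g c \<bullet> x) - (f c - g c \<bullet> c)\<bar> \<le> (real DIM('a) * (real DIM('a) * M * norm (x - c))) * norm (x - c)"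
  proof (rule lipschitz_if_gradient_bounded[of S])
    show "((\<lambda>x. f x - g c \<bullet> x) has_derivative (\<lambda>h. (g y - g c) \<bullet> h)) (at y)" for y
      unfolding inner_diff_left by (intro has_derivative_diff g(1) has_derivative_inner_right has_derivative_ident)
    show "norm (g y - g c) \<le> real DIM('a) * (real DIM('a) * M * norm (x - c))" if y: "y \<in> S" for y
    proof (rule norm_le_components)
      fix b :: 'a assume b: "b \<in> Basis"
      have "\<bar>g y \<bullet> b - g c \<bullet> b\<bar> \<le> real DIM('a) * M * norm (y - c)"
        using y S xy by (intro bounded_poly_lipschitz[OF g(2)[OF b]]) auto
      also have "\<dots> \<le> real DIM('a) * M * norm (x - c)"
        using segment_bound(1)[of y c x] y \<open>0 \<le> M\<close> by (intro mult_left_mono) (auto simp: S_def)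
      finally show "\<bar>(g y - g c) \<bullet> b\<bar> \<le> real DIM('a) * M * norm (x - c)" by (simp add: inner_diff_left)
    qed
  qed (auto simp: S_def)
  then show ?thesis by (simp add: power2_eq_square inner_diff_right algebra_simps)
qed

text \<open>By induction on the degree: either the gradient is small everywhere, or Alice first forces
  one partial derivative away from 0, shrinks the ball until \<open>f\<close> is almost affine on it, and
  removes the zero hyperplane of the affine approximation at the centre.\<close>
lemma forces_bounded_poly_away_from_0:
  assumes \<beta>: "0 < \<beta>" "\<beta> < 1" and "0 < \<eta>" and "0 < M"
  shows "\<exists>N \<delta>. 0 < \<delta> \<and> (\<forall>f :: 'a::euclidean_space \<Rightarrow> real. bounded_poly D M f \<and> (\<exists>x\<in>cball 0 1. \<eta> \<le> \<bar>f x\<bar>) \<longrightarrow>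
           forces \<beta> N (\<lambda>c r. \<forall>x\<in>cball c r. \<delta> \<le> \<bar>f x\<bar>) 0 1)"
  using \<open>0 < \<eta>\<close>
proof (induction D arbitrary: \<eta>)
  case 0
  have "forces \<beta> 0 (\<lambda>c r. \<forall>x\<in>cball c r. \<eta> \<le> \<bar>f x\<bar>) 0 1"
    if "bounded_poly 0 M f \<and> (\<exists>x\<in>cball 0 1. \<eta> \<le> \<bar>f x\<bar>)" for f :: "'a \<Rightarrow> real"
    using that by auto
  then show ?case using 0 by blast
next
  case (Suc D)
  define E where "E = real DIM('a)"
  have E: "0 < E" by (simp add: E_def)
  \<comment> \<open>If all partial derivatives stay below \<open>\<theta>\<close>, then
    \<open>f\<close> varies by at most \<open>E * \<theta> * 2 = \<eta> / 2\<close> from the point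
    where it is large.\<close>
  define \<theta> where "\<theta> = \<eta> / (4 * E)"
  have "0 < \<theta>" using Suc.prems E by (simp add: \<theta>_def)
  from Suc.IH[OF this] obtain N \<delta> where \<delta>: "0 < \<delta>" and
    IH: "\<And>f :: 'a \<Rightarrow> real. bounded_poly D M f \<Longrightarrow> (\<exists>x\<in>cball 0 1. \<theta> \<le> \<bar>f x\<bar>) \<Longrightarrow>
           forces \<beta> N (\<lambda>c r. \<forall>x\<in>cball c r. \<delta> \<le> \<bar>f x\<bar>) 0 1" by blast
  define K where "K = E\<^sup>2 * M"
  have K: "0 < K" using E \<open>0 < M\<close> by (simp add: K_def)
  \<comment> \<open>On a ball of radius \<open>s \<le> X\<close> the Taylor error is at most
    \<open>K * s\<^sup>2 \<le> s * (\<beta> * \<delta> / 4)\<close>, half of what removing the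
    \<open>\<beta> * s / 2\<close>-neighbourhood yields where the gradient has norm at least
    \<open>\<delta>\<close>. The bound \<open>\<beta> ^ N\<close> puts \<open>X\<close> below the
    radii left by the first phase.\<close>
  define X where "X = min (\<beta> ^ N) (\<beta> * \<delta> / (4 * K))"
  have X: "0 < X" "X \<le> \<beta> ^ N" "K * X \<le> \<beta> * \<delta> / 4"
    using \<beta> \<delta> K by (auto simp: X_def min_def field_simps)
  obtain n where n: "1 / X < 2 ^ n" using real_arch_pow[of 2 "1 / X"] by auto
  then have n: "1 \<le> 2 ^ n * X" using X by (simp add: field_simps)
  \<comment> \<open>The first term belongs to the case of a small gradient; in the other case the
    final estimate is proportional to a radius of which only \<open>s \<ge> \<beta> * X\<close> is
    known.\<close>
  define \<delta>' where "\<delta>' = min (\<eta> / 2) (\<beta> * X * (\<beta> * \<delta> / 4))"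
  have "0 < \<delta>'" using Suc.prems \<beta> \<delta> X by (simp add: \<delta>'_def)
  moreover have "forces \<beta> (N + (n + 1)) (\<lambda>c r. \<forall>x\<in>cball c r. \<delta>' \<le> \<bar>f x\<bar>) 0 1"
    if bp: "bounded_poly (Suc D) M f" and ex: "\<exists>x\<in>cball 0 1. \<eta> \<le> \<bar>f x\<bar>" for f :: "'a \<Rightarrow> real"
  proof -
    obtain g where g: "\<And>x. (f has_derivative (\<lambda>h. g x \<bullet> h)) (at x)"
      "\<And>b. b \<in> Basis \<Longrightarrow> bounded_poly D M (\<lambda>x. g x \<bullet> b)" using bp by auto
    show ?thesis
    proof (cases "\<exists>b\<in>Basis. \<exists>x\<in>cball 0 1. \<theta> \<le> \<bar>g x \<bullet> b\<bar>")
      case False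
      obtain y where y: "y \<in> cball 0 1" "\<eta> \<le> \<bar>f y\<bar>" using ex by blast
      have "\<delta>' \<le> \<bar>f x\<bar>" if x: "x \<in> cball 0 1" for x
      proof -
        have "\<bar>f x - f y\<bar> \<le> (E * \<theta>) * norm (x - y)"
          unfolding E_def using False
          by (intro lipschitz_if_gradient_bounded[OF convex_cball[of 0 1] g(1) norm_le_components x y(1)])
            (meson less_imp_le not_le)
        also have "\<dots> \<le> (E * \<theta>) * 2"
          using x y(1) norm_triangle_ineq4[of x y] E \<open>0 < \<theta>\<close> by (intro mult_left_mono) auto
        also have "\<dots> = \<eta> / 2" using E by (simp add: \<theta>_def)
        finally show ?thesis using y(2) unfolding \<delta>'_def by linarith
      qed
      then show ?thesis by (intro forces_refl) auto
    next
      case True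
      then obtain b where b: "b \<in> Basis" "\<exists>x\<in>cball 0 1. \<theta> \<le> \<bar>g x \<bullet> b\<bar>" by blast
      show ?thesis
      proof (rule forces_trans[OF IH[OF g(2)[OF b(1)] b(2)] \<beta>])
        fix c :: 'a and r :: real
        assume gb: "\<forall>x\<in>cball c r. \<delta> \<le> \<bar>g x \<bullet> b\<bar>" and r: "\<beta> ^ N * 1 \<le> r" "r \<le> 1" and sub: "cball c r \<subseteq> cball 0 1"
        have r0: "0 < r" using r X by linarith
        have "\<beta> * X \<le> 1 * X" using \<beta> X by (intro mult_right_mono) auto
        then have "\<beta> * X \<le> r" using X r by linarith
        from forces_radius_window[OF \<beta> this _ X(1), of n c] r n
        have "forces \<beta> n (\<lambda>c' r'. \<beta> * X \<le> r' \<and> r' \<le> X \<and> cball c' r' \<subseteq> cball c r) c r" by linarith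
        then show "forces \<beta> (n + 1) (\<lambda>c r. \<forall>x\<in>cball c r. \<delta>' \<le> \<bar>f x\<bar>) c r"
        proof (rule forces_trans[OF _ \<beta> r0])
          fix d s assume s: "\<beta> * X \<le> s \<and> s \<le> X \<and> cball d s \<subseteq> cball c r"
          have s0: "0 < s" using s \<beta> X by (smt (verit) mult_pos_pos)
          have sub': "cball d s \<subseteq> cball 0 1" using s sub by blast
          have d: "d \<in> cball d s" using s0 by simp
          then have "\<delta> \<le> \<bar>g d \<bullet> b\<bar>" using gb s by blast
          then have gd: "\<delta> \<le> norm (g d)" using Basis_le_norm[OF b(1), of "g d"] by linarith
          then have gd0: "g d \<noteq> 0" using \<delta> by auto
          define L where "L = {x. g d \<bullet> x = g d \<bullet> d - f d}"
          have "\<delta>' \<le> \<bar>f x\<bar>" if x: "x \<in> cball d s" "x \<notin> nbhd L (\<beta> * s / 2)" for x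
          proof -
            have "(\<beta> * s / 2) * norm (g d) \<le> \<bar>g d \<bullet> x - (g d \<bullet> d - f d)\<bar>"
              using x(2) gd0 unfolding L_def by (rule dist_ge_if_disjoint_nbhd)
            moreover have "(\<beta> * s / 2) * \<delta> \<le> (\<beta> * s / 2) * norm (g d)"
              using gd \<beta> s0 by (intro mult_left_mono) auto
            moreover have "\<bar>f x - f d - g d \<bullet> (x - d)\<bar> \<le> K * (norm (x - d))\<^sup>2"
              unfolding K_def E_def using x d sub' by (intro bounded_poly_taylor[OF g]) blast+
            moreover have "K * (norm (x - d))\<^sup>2 \<le> K * s\<^sup>2"
              using K x(1) s0 by (intro mult_left_mono power_mono) (auto simp: dist_norm norm_minus_commute)
            moreover have "K * s\<^sup>2 \<le> s * (\<beta> * \<delta> / 4)"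
            proof -
              have "K * s \<le> K * X" using s K by simp
              then have "s * (K * s) \<le> s * (\<beta> * \<delta> / 4)" using X(3) s0 by (intro mult_left_mono) auto
              then show ?thesis by (simp add: power2_eq_square mult_ac)
            qed
            moreover have "\<delta>' \<le> s * (\<beta> * \<delta> / 4)"
            proof -
              have "\<beta> * X * (\<beta> * \<delta> / 4) \<le> s * (\<beta> * \<delta> / 4)" using s \<beta> \<delta> by (intro mult_right_mono) auto
              then show ?thesis by (simp add: \<delta>'_def)
            qed
            moreover have "(\<beta> * s / 2) * \<delta> = s * (\<beta> * \<delta> / 4) + s * (\<beta> * \<delta> / 4)" by simp
            moreover have "g d \<bullet> x - (g d \<bullet> d - f d) = f d + g d \<bullet> (x - d)" by (simp add: inner_diff_right)
            ultimately show ?thesis by linarith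
          qed
          moreover have "affine_hyperplane L" using gd0 unfolding affine_hyperplane_def L_def by blast
          ultimately have "\<exists>L \<epsilon>. affine_hyperplane L \<and> 0 < \<epsilon> \<and> \<epsilon> < \<beta> * s \<and>
              (\<forall>c' r'. \<beta> * s \<le> r' \<and> cball c' r' \<subseteq> cball d s - nbhd L \<epsilon> \<longrightarrow> (\<forall>x\<in>cball c' r'. \<delta>' \<le> \<bar>f x\<bar>))"
            using \<beta> s0 by (intro exI[of _ L] exI[of _ "\<beta> * s / 2"]) auto
          then show "forces \<beta> 1 (\<lambda>c r. \<forall>x\<in>cball c r. \<delta>' \<le> \<bar>f x\<bar>) d s" by simp
        qed
      qed simp
    qed
  qed
  ultimately show ?case by blast
qed

section \<open>From stages to a winning strategy\<close>

text \<open>Alice's memory is the pair of the last stage reached and a bound on the number of moves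
  until the next one.\<close>
lemma winning_if_stages:
  fixes S :: "'a::euclidean_space set"
  assumes \<beta>: "0 < \<beta>"
    and stages: "\<And>c0 r0. 0 < r0 \<Longrightarrow> \<exists>Inv :: nat \<Rightarrow> 'a \<Rightarrow> real \<Rightarrow> bool. Inv 0 c0 r0 \<and>
       (\<forall>k c r. Inv k c r \<longrightarrow> \<not> Inv (Suc k) c r) \<and>
       (\<forall>k c r. 0 < r \<and> Inv k c r \<longrightarrow> (\<exists>n. forces \<beta> n (Inv (Suc k)) c r)) \<and>
       (\<forall>x. (\<forall>k. \<exists>c r. Inv k c r \<and> x \<in> cball c r) \<longrightarrow> x \<in> S)"
  shows "hyperplane_absolute_winning \<beta> S"
proof -
  define good where "good Inv \<longleftrightarrow>
       (\<forall>k c r. Inv k c r \<longrightarrow> \<not> Inv (Suc k) c r) \<and>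
       (\<forall>k c r. 0 < r \<and> Inv k c r \<longrightarrow> (\<exists>n. forces \<beta> n (Inv (Suc k)) c r)) \<and>
       (\<forall>x. (\<forall>k. \<exists>c r. Inv k c r \<and> x \<in> cball c r) \<longrightarrow> x \<in> S)" for Inv :: "nat \<Rightarrow> 'a \<Rightarrow> real \<Rightarrow> bool"
  \<comment> \<open>The stages may depend on Bob's first ball, which Alice reads off as
    \<open>hd h\<close>; this later lets the constant \<open>K\<close> depend on it.\<close>
  have "\<exists>J. \<forall>b :: 'a \<times> real. 0 < snd b \<longrightarrow> J b 0 (fst b) (snd b) \<and> good (J b)"
    by (rule choice) (use stages in \<open>auto simp: good_def\<close>)
  then obtain J where J: "\<And>b :: 'a \<times> real. 0 < snd b \<Longrightarrow> J b 0 (fst b) (snd b)" "\<And>b. 0 < snd b \<Longrightarrow> good (J b)"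
    by blast
  define legal where "legal r L \<epsilon> \<longleftrightarrow> affine_hyperplane L \<and> 0 < \<epsilon> \<and> \<epsilon> < \<beta> * r" for r \<epsilon> :: real and L :: "'a set"
  define reply where "reply b L \<epsilon> b' \<longleftrightarrow> \<beta> * snd b \<le> snd b' \<and>
      cball (fst b') (snd b') \<subseteq> cball (fst b) (snd b) - nbhd L \<epsilon>" for b b' :: "'a \<times> real" and L \<epsilon>
  define useful where "useful Q n b L \<epsilon> \<longleftrightarrow> legal (snd b) L \<epsilon> \<and>
      (\<forall>b'. reply b L \<epsilon> b' \<longrightarrow> forces \<beta> (n - 1) Q (fst b') (snd b'))" for Q n b L \<epsilon>
  \<comment> \<open>Legality is demanded for every history with a positive last radius, including
    those that no play produces, so a legal move without a purpose is the default.\<close>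
  define move where "move Q n b = (SOME p. legal (snd b) (fst p) (snd p) \<and>
      ((\<exists>L \<epsilon>. useful Q n b L \<epsilon>) \<longrightarrow> useful Q n b (fst p) (snd p)))" for Q n b
  have legal_ex: "\<exists>L \<epsilon>. legal r L \<epsilon>" if "0 < r" for r
  proof -
    obtain a :: 'a where "a \<in> Basis" using nonempty_Basis by blast
    then have "affine_hyperplane {x. a \<bullet> x = 0}" unfolding affine_hyperplane_def using nonzero_Basis by blast
    moreover have "0 < \<beta> * r" using \<beta> that by simp
    ultimately show ?thesis unfolding legal_def using dense[of 0 "\<beta> * r"] by blast
  qed
  have move: "legal (snd b) (fst (move Q n b)) (snd (move Q n b)) \<and>
      ((\<exists>L \<epsilon>. useful Q n b L \<epsilon>) \<longrightarrow> useful Q n b (fst (move Q n b)) (snd (move Q n b)))" if "0 < snd b" for Q n b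
    unfolding move_def
  proof (rule someI_ex)
    show "\<exists>p. legal (snd b) (fst p) (snd p) \<and> ((\<exists>L \<epsilon>. useful Q n b L \<epsilon>) \<longrightarrow> useful Q n b (fst p) (snd p))"
    proof (cases "\<exists>L \<epsilon>. useful Q n b L \<epsilon>")
      case True
      then obtain L \<epsilon> where "useful Q n b L \<epsilon>" by blast
      then show ?thesis by (intro exI[of _ "(L, \<epsilon>)"]) (auto simp: useful_def)
    next
      case False
      then show ?thesis using legal_ex[OF that] by force
    qed
  qed
  define fuel where "fuel Q b = (SOME n. forces \<beta> n Q (fst b) (snd b))" for Q and b :: "'a \<times> real"
  \<comment> \<open>Entering the next stage resets the counter to a number of moves that suffices
    from the current ball; otherwise the counter decreases by 1.\<close>
  define upd where "upd Inv s b = (if Inv (Suc (fst s)) (fst b) (snd b)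
      then (Suc (fst s), fuel (Inv (Suc (Suc (fst s)))) b) else (fst s, snd s - 1))"
    for Inv :: "nat \<Rightarrow> 'a \<Rightarrow> real \<Rightarrow> bool" and s :: "nat \<times> nat" and b
  define state where "state h = foldl (upd (J (hd h))) (0, fuel (J (hd h) (Suc 0)) (hd h)) (tl h)" for h
  define \<sigma> where "\<sigma> h = move (J (hd h) (Suc (fst (state h)))) (snd (state h)) (last h)" for h
  have "legal_strategy \<beta> \<sigma>"
    unfolding legal_strategy_def \<sigma>_def using move unfolding legal_def by blast
  moreover have "(\<Inter>i. cball (c i) (\<rho> i)) \<inter> S \<noteq> {}" if play: "legal_bob_play \<beta> \<sigma> c \<rho>" for c \<rho>
  proof -
    define b where "b i = (c i, \<rho> i)" for i
    define Inv where "Inv = J (b 0)"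
    define h where "h i = map b [0..<Suc i]" for i
    have h: "h i \<noteq> []" "hd (h i) = b 0" "last (h i) = b i" for i
      by (auto simp: h_def hd_map last_map simp del: upt_Suc)
    have \<rho>0: "0 < \<rho> 0" and \<rho>S: "\<And>i. \<beta> * \<rho> i \<le> \<rho> (Suc i)" using play by (auto simp: legal_bob_play_def)
    have step: "reply (b i) (fst (\<sigma> (h i))) (snd (\<sigma> (h i))) (b (Suc i))" for i
      using play unfolding legal_bob_play_def reply_def b_def h_def by (auto simp: Let_def split_beta)
    have pos: "0 < \<rho> i" for i
    proof (induction i)
      case (Suc i)
      then have "0 < \<beta> * \<rho> i" using \<beta> by simp
      then show ?case using \<rho>S[of i] by linarith
    qed (rule \<rho>0)
    have Inv0: "Inv 0 (c 0) (\<rho> 0)" and good: "good Inv"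
      using J[of "b 0"] \<rho>0 by (auto simp: Inv_def b_def)
    have next_ex: "forces \<beta> (fuel (Inv (Suc k)) (b i)) (Inv (Suc k)) (c i) (\<rho> i)" if "Inv k (c i) (\<rho> i)" for k i
    proof -
      have "\<exists>n. forces \<beta> n (Inv (Suc k)) (fst (b i)) (snd (b i))"
        using good that pos[of i] by (auto simp: good_def b_def)
      from someI_ex[OF this] show ?thesis by (simp add: fuel_def b_def)
    qed
    have excl: "\<not> Inv (Suc k) (c i) (\<rho> i)" if "Inv k (c i) (\<rho> i)" for k i
      using good that by (auto simp: good_def)
    define s where "s i = state (h i)" for i
    have s0: "s 0 = (0, fuel (Inv (Suc 0)) (b 0))" by (simp add: s_def state_def h_def Inv_def)
    have sS: "s (Suc i) = upd Inv (s i) (b (Suc i))" for i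
    proof -
      have "h (Suc i) = h i @ [b (Suc i)]" by (simp add: h_def)
      then have "tl (h (Suc i)) = tl (h i) @ [b (Suc i)]" using h(1)[of i] by simp
      then show ?thesis unfolding s_def state_def h(2) Inv_def[symmetric] by simp
    qed
    \<comment> \<open>The counter never runs out before the next stage. That stage does not hold yet
      at the current ball, because consecutive stages exclude each other, so \<open>forces\<close>
      must supply a hyperplane and \<open>move\<close> finds one that makes progress.\<close>
    have inv: "forces \<beta> (snd (s i)) (Inv (Suc (fst (s i)))) (c i) (\<rho> i) \<and> \<not> Inv (Suc (fst (s i))) (c i) (\<rho> i)" for i
    proof (induction i)
      case 0
      show ?case using next_ex[OF Inv0] excl[OF Inv0] by (simp add: s0)
    next
      case (Suc i)
      define k n where "k = fst (s i)" and "n = snd (s i)"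
      have f: "forces \<beta> n (Inv (Suc k)) (c i) (\<rho> i)" and nI: "\<not> Inv (Suc k) (c i) (\<rho> i)"
        using Suc.IH by (auto simp: k_def n_def)
      then obtain m where m: "n = Suc m" by (cases n) auto
      from f nI obtain L \<epsilon> where "affine_hyperplane L" "0 < \<epsilon>" "\<epsilon> < \<beta> * \<rho> i"
        "\<forall>c' r'. \<beta> * \<rho> i \<le> r' \<and> cball c' r' \<subseteq> cball (c i) (\<rho> i) - nbhd L \<epsilon> \<longrightarrow> forces \<beta> m (Inv (Suc k)) c' r'"
        unfolding m forces.simps(2) by blast
      then have "useful (Inv (Suc k)) n (b i) L \<epsilon>"
        by (auto simp: useful_def legal_def reply_def b_def m)
      moreover have "\<sigma> (h i) = move (Inv (Suc k)) n (b i)"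
        by (simp add: \<sigma>_def h k_def n_def s_def Inv_def)
      ultimately have "useful (Inv (Suc k)) n (b i) (fst (\<sigma> (h i))) (snd (\<sigma> (h i)))"
        using move[of "b i" "Inv (Suc k)" n] pos[of i] by (auto simp: b_def)
      then have f': "forces \<beta> m (Inv (Suc k)) (c (Suc i)) (\<rho> (Suc i))"
        using step[of i] by (auto simp: useful_def m b_def)
      show ?case
      proof (cases "Inv (Suc k) (c (Suc i)) (\<rho> (Suc i))")
        case True
        then have "s (Suc i) = (Suc k, fuel (Inv (Suc (Suc k))) (b (Suc i)))"
          by (simp add: sS upd_def k_def b_def)
        then show ?thesis using next_ex[OF True] excl[OF True] by simp
      next
        case False
        then have "s (Suc i) = (k, m)" using m by (simp add: sS upd_def k_def n_def b_def)
        then show ?thesis using f' False by simp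
      qed
    qed
    have reach: "\<exists>i'. fst (s i') = Suc k \<and> Inv (Suc k) (c i') (\<rho> i')" if "fst (s i) = k" "snd (s i) = n" for i k n
      using that
    proof (induction n arbitrary: i rule: less_induct)
      case (less n)
      show ?case
      proof (cases "Inv (Suc k) (c (Suc i)) (\<rho> (Suc i))")
        case True
        then have "fst (s (Suc i)) = Suc k" using less.prems by (simp add: sS upd_def b_def)
        then show ?thesis using True by blast
      next
        case False
        then have *: "s (Suc i) = (k, n - 1)" using less.prems by (simp add: sS upd_def b_def)
        have "n \<noteq> 0"
        proof
          assume "n = 0"
          then show False using inv[of i] less.prems by simp
        qed
        then show ?thesis using less.IH[of "n - 1" "Suc i"] * by simp
      qed
    qed
    have all: "\<exists>i. fst (s i) = k \<and> Inv k (c i) (\<rho> i)" for k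
    proof (induction k)
      case 0
      show ?case using Inv0 s0 by (intro exI[of _ 0]) simp
    next
      case (Suc k)
      then show ?case using reach by blast
    qed
    have "(\<Inter>i. cball (c i) (\<rho> i)) \<noteq> {}"
    proof (rule compact_nest)
      have dec: "cball (c (Suc i)) (\<rho> (Suc i)) \<subseteq> cball (c i) (\<rho> i)" for i
        using step[of i] by (auto simp: reply_def b_def)
      show "cball (c j) (\<rho> j) \<subseteq> cball (c i) (\<rho> i)" if "i \<le> j" for i j
        using that by (induction j rule: dec_induct) (use dec in auto)
      show "cball (c i) (\<rho> i) \<noteq> {}" for i using pos[of i] by simp
    qed auto
    then obtain x where "x \<in> (\<Inter>i. cball (c i) (\<rho> i))" by blast
    then have x: "x \<in> cball (c i) (\<rho> i)" for i by blast
    then have "\<forall>k. \<exists>c r. Inv k c r \<and> x \<in> cball c r" using all by blast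
    then have "x \<in> S" using good by (auto simp: good_def)
    then show ?thesis using x by blast
  qed
  ultimately show ?thesis unfolding hyperplane_absolute_winning_def by blast
qed

section \<open>General position\<close>

lemma dim_orthogonal_complement_unit:
  fixes e :: "'a::euclidean_space"
  assumes V: "subspace V" and e: "e \<in> V" "norm e = 1"
  shows "dim (V \<inter> {v. e \<bullet> v = 0}) = dim V - 1"
proof -
  have "dim {y \<in> V. \<forall>x \<in> span {e}. orthogonal x y} + dim (span {e}) = dim V"
    using V e by (intro dim_subspace_orthogonal_to_vectors) (auto simp: span_minimal)
  moreover have "{y \<in> V. \<forall>x \<in> span {e}. orthogonal x y} = V \<inter> {v. e \<bullet> v = 0}"
    using span_base[of e "{e}"] by (auto simp: orthogonal_def span_singleton)
  moreover have "dim (span {e}) = 1" using e(2) by (auto simp: dim_insert)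
  ultimately show ?thesis by simp
qed

text \<open>A unit vector of \<open>V\<close> at which \<open>norm (T v)\<close> is maximal splits off.\<close>
lemma singular_value_decomposition:
  fixes T :: "'a::euclidean_space \<Rightarrow> 'b::euclidean_space"
  assumes T: "linear T" and "subspace V" "subspace W" "T ` V \<subseteq> W" "dim V \<le> dim W"
  shows "\<exists>E f s. span E = V \<and> (\<forall>e\<in>E. norm e = 1) \<and> pairwise orthogonal E \<and>
    (\<forall>e\<in>E. norm (f e) = 1 \<and> T e = s e *\<^sub>R f e \<and> 0 \<le> s e \<and> f e \<in> W) \<and>
    (\<forall>e\<in>E. \<forall>e'\<in>E. e \<noteq> e' \<longrightarrow> f e \<bullet> f e' = 0)"
  using assms(2-)
proof (induction "dim V" arbitrary: V W)
  case 0
  then have "V = {0}" using subspace_0 by (auto simp: dim_eq_0)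
  then show ?case by (intro exI[of _ "{}"]) auto
next
  case (Suc n)
  define K where "K = V \<inter> sphere 0 1"
  have "compact K" unfolding K_def using closed_subspace[OF Suc.prems(1)] by (intro closed_Int_compact) auto
  moreover have "K \<noteq> {}"
  proof -
    have "V \<noteq> {0}" using Suc.hyps(2) by auto
    then obtain v where "v \<in> V" "v \<noteq> 0" using subspace_0[OF Suc.prems(1)] by blast
    then have "(1 / norm v) *\<^sub>R v \<in> K" using subspace_scale[OF Suc.prems(1)] by (simp add: K_def)
    then show ?thesis by blast
  qed
  moreover have "continuous_on K (\<lambda>v. norm (T v))"
    using linear_continuous_on[OF linear_conv_bounded_linear[THEN iffD1, OF T]] by (intro continuous_on_norm)
  ultimately obtain e where e: "e \<in> K" "\<And>v. v \<in> K \<Longrightarrow> norm (T v) \<le> norm (T e)"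
    using continuous_attains_sup[of K "\<lambda>v. norm (T v)"] by blast
  have eV: "e \<in> V" "norm e = 1" using e(1) by (auto simp: K_def)
  have bound: "norm (T v) \<le> norm (T e) * norm v" if "v \<in> V" for v
  proof (cases "v = 0")
    case True
    then show ?thesis using linear_0[OF T] by simp
  next
    case False
    then have "(1 / norm v) *\<^sub>R v \<in> K" using subspace_scale[OF Suc.prems(1) that] by (simp add: K_def)
    from e(2)[OF this] show ?thesis using False by (simp add: linear_scale[OF T] field_simps)
  qed
  \<comment> \<open>First variation at the maximum: replacing \<open>e\<close> by
    \<open>e + t v\<close> changes the squared norm of the image by \<open>2 t p\<close> to first
    order, but that of the vector only to second order.\<close>
  have orth: "T e \<bullet> T v = 0" if v: "v \<in> V" "e \<bullet> v = 0" for v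
  proof (rule ccontr)
    define p where "p = T e \<bullet> T v"
    assume "T e \<bullet> T v \<noteq> 0"
    then have p: "p \<noteq> 0" by (simp add: p_def)
    define C where "C = (norm (T e))\<^sup>2 * (norm v)\<^sup>2 - (norm (T v))\<^sup>2"
    have ineq: "2 * t * p \<le> t\<^sup>2 * C" for t
    proof -
      have "norm (T (e + t *\<^sub>R v)) \<le> norm (T e) * norm (e + t *\<^sub>R v)"
        using v(1) eV(1) Suc.prems(1) by (intro bound) (simp add: subspace_add subspace_scale)
      then have "(norm (T (e + t *\<^sub>R v)))\<^sup>2 \<le> (norm (T e))\<^sup>2 * (norm (e + t *\<^sub>R v))\<^sup>2"
        using power_mono[of _ _ 2] by (fastforce simp: power_mult_distrib)
      moreover have "(norm (T (e + t *\<^sub>R v)))\<^sup>2 = (norm (T e))\<^sup>2 + 2 * t * p + t\<^sup>2 * (norm (T v))\<^sup>2"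
        unfolding linear_add[OF T] linear_scale[OF T] power2_norm_eq_inner p_def
        by (simp add: inner_add_left inner_add_right inner_commute power2_eq_square algebra_simps)
      moreover have "(norm (e + t *\<^sub>R v))\<^sup>2 = 1 + t\<^sup>2 * (norm v)\<^sup>2"
        using v(2) eV(2) unfolding power2_norm_eq_inner
        by (simp add: inner_add_left inner_add_right inner_commute power2_eq_square algebra_simps norm_eq_1)
      ultimately show ?thesis by (simp add: C_def algebra_simps)
    qed
    \<comment> \<open>With this choice
      \<open>2 * t * p = 2 * (\<bar>C\<bar> + 1) * t\<^sup>2\<close>, which exceeds
      \<open>t\<^sup>2 * C\<close>.\<close>
    define t where "t = p / (\<bar>C\<bar> + 1)"
    have C1: "\<bar>C\<bar> + 1 \<noteq> 0" by linarith
    then have "p = t * (\<bar>C\<bar> + 1)" by (simp add: t_def)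
    then have "2 * t * p = 2 * (\<bar>C\<bar> + 1) * t\<^sup>2" by (metis mult.assoc mult.commute power2_eq_square)
    then have "(2 * (\<bar>C\<bar> + 1)) * t\<^sup>2 \<le> C * t\<^sup>2" using ineq[of t] by (simp add: mult.commute)
    moreover have "0 < t\<^sup>2" using p C1 by (simp add: t_def)
    ultimately have "2 * (\<bar>C\<bar> + 1) \<le> C" by (simp add: mult_le_cancel_right)
    then show False by (simp add: distrib_left)
  qed
  \<comment> \<open>If \<open>T e = 0\<close>, any unit vector of \<open>W\<close> will do, and
    \<open>W\<close> is nonzero because \<open>dim V \<le> dim W\<close>.\<close>
  obtain w where w: "w \<in> W" "norm w = 1" "T e = norm (T e) *\<^sub>R w"
  proof (cases "T e = 0")
    case True
    have "dim W \<noteq> 0" using Suc.hyps(2) Suc.prems(4) by linarith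
    then have "W \<noteq> {0}" by auto
    then obtain u where "u \<in> W" "u \<noteq> 0" using subspace_0[OF Suc.prems(2)] by blast
    then show ?thesis using that[of "(1 / norm u) *\<^sub>R u"] True subspace_scale[OF Suc.prems(2)] by simp
  next
    case False
    then show ?thesis
      using that[of "(1 / norm (T e)) *\<^sub>R T e"] Suc.prems(3) eV subspace_scale[OF Suc.prems(2)] by auto
  qed
  define V' where "V' = V \<inter> {v. e \<bullet> v = 0}"
  define W' where "W' = W \<inter> {v. w \<bullet> v = 0}"
  have sub: "subspace V'" "subspace W'"
    unfolding V'_def W'_def using Suc.prems(1,2) by (auto intro!: subspace_inter subspace_hyperplane)
  have dims: "dim V' = n" "dim W' = dim W - 1"
    unfolding V'_def W'_def dim_orthogonal_complement_unit[OF Suc.prems(1) eV]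
      dim_orthogonal_complement_unit[OF Suc.prems(2) w(1,2)] using Suc.hyps(2) by simp_all
  have "T ` V' \<subseteq> W'"
  proof
    fix y assume "y \<in> T ` V'"
    then obtain v where v: "v \<in> V" "e \<bullet> v = 0" "y = T v" by (auto simp: V'_def)
    have "w \<bullet> T v = 0"
    proof (cases "T e = 0")
      case True
      then show ?thesis using bound[OF v(1)] by simp
    next
      case False
      then show ?thesis using orth[OF v(1,2)] w(3) by (metis inner_scaleR_left mult_eq_0_iff norm_eq_zero)
    qed
    then show "y \<in> W'" using Suc.prems(3) v by (auto simp: W'_def)
  qed
  moreover have "dim V' \<le> dim W'" using dims Suc.hyps(2) Suc.prems(4) by simp
  ultimately obtain E f s where E: "span E = V'" "\<forall>x\<in>E. norm x = 1" "pairwise orthogonal E"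
    and f: "\<forall>x\<in>E. norm (f x) = 1 \<and> T x = s x *\<^sub>R f x \<and> 0 \<le> s x \<and> f x \<in> W'"
      "\<forall>x\<in>E. \<forall>x'\<in>E. x \<noteq> x' \<longrightarrow> f x \<bullet> f x' = 0"
    using Suc.hyps(1)[OF dims(1)[symmetric] sub] by blast
  have EV': "x \<in> V" "e \<bullet> x = 0" if "x \<in> E" for x using span_base[OF that] E(1) by (auto simp: V'_def)
  have eE: "e \<notin> E" using EV'(2)[of e] eV(2) by (auto simp: norm_eq_1)
  define f' where "f' = (\<lambda>x. if x = e then w else f x)"
  define s' where "s' = (\<lambda>x. if x = e then norm (T e) else s x)"
  have "span (insert e E) = V"
  proof
    show "span (insert e E) \<subseteq> V" using EV' eV Suc.prems(1) by (intro span_minimal) auto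
    show "V \<subseteq> span (insert e E)"
    proof
      fix v assume v: "v \<in> V"
      have "v - (e \<bullet> v) *\<^sub>R e \<in> V'"
        using v eV Suc.prems(1) unfolding V'_def
        by (auto simp: subspace_diff subspace_scale inner_diff_right norm_eq_1)
      then have "v - (e \<bullet> v) *\<^sub>R e \<in> span (insert e E)" using E(1) span_mono[of E "insert e E"] by auto
      moreover have "(e \<bullet> v) *\<^sub>R e \<in> span (insert e E)" by (intro span_scale span_base) simp
      ultimately have "(v - (e \<bullet> v) *\<^sub>R e) + (e \<bullet> v) *\<^sub>R e \<in> span (insert e E)" by (rule span_add)
      then show "v \<in> span (insert e E)" by simp
    qed
  qed
  moreover have "pairwise orthogonal (insert e E)"
    using E(3) EV'(2) by (auto simp: pairwise_insert orthogonal_def inner_commute)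
  moreover have "f' x \<bullet> f' x' = 0" if "x \<in> insert e E" "x' \<in> insert e E" "x \<noteq> x'" for x x'
    using that f eE by (auto simp: f'_def W'_def inner_commute)
  moreover have "\<forall>x\<in>insert e E. norm (f' x) = 1 \<and> T x = s' x *\<^sub>R f' x \<and> 0 \<le> s' x \<and> f' x \<in> W"
    using f w eE by (auto simp: f'_def s'_def W'_def)
  ultimately show ?case using E(2) eV(2)
    by (intro exI[of _ "insert e E"] exI[of _ f'] exI[of _ s']) auto
qed

section \<open>Shears that make a subspace transversal\<close>

lemma norm_matrix_vector_le:
  fixes A :: "real ^ 'n ^ 'm"
  shows "norm (A *v x) \<le> norm A * norm x"
proof -
  have "norm (A *v x) = L2_set (\<lambda>i. norm (A $ i \<bullet> x)) UNIV"
    by (simp add: norm_vec_def matrix_vector_mult_def inner_vec_def)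
  also have "\<dots> \<le> L2_set (\<lambda>i. norm (A $ i) * norm x) UNIV"
    by (intro L2_set_mono) (auto simp: Cauchy_Schwarz_ineq2)
  also have "\<dots> = norm A * norm x" by (simp add: L2_set_left_distrib norm_vec_def)
  finally show ?thesis .
qed

text \<open>The effect of moving \<Theta>, seen at a given scale: see
  \<open>dani_shear\<close>.\<close>

definition shear :: "real ^ 'n ^ 'm \<Rightarrow> (real ^ 'n) \<times> (real ^ 'm) \<Rightarrow> (real ^ 'n) \<times> (real ^ 'm)" where
  "shear D v = (fst v, snd v + D *v fst v)"

lemma linear_shear: "linear (shear D)"
  by (rule linearI) (auto simp: shear_def matrix_vector_right_distrib vec.scale scaleR_add_right
      matrix_vector_mult_scaleR)

lemma norm_shear_le: "norm (shear D v) \<le> (1 + norm D) * norm v"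
proof -
  have "shear D v = v + (0, D *v fst v)" by (simp add: shear_def prod_eq_iff)
  then have "norm (shear D v) \<le> norm v + norm (D *v fst v)"
    using norm_triangle_ineq[of v "(0, D *v fst v)"] by (simp add: norm_prod_def)
  also have "norm (D *v fst v) \<le> norm D * norm v"
    using norm_matrix_vector_le[of D "fst v"] norm_fst_le[of "fst v" "snd v"] mult_left_mono[OF _ norm_ge_zero, of _ _ D]
    by (smt (verit) prod.collapse)
  finally show ?thesis by (simp add: algebra_simps)
qed

text \<open>The singular value decomposition of \<open>snd\<close> on \<open>V\<close> gives an
  orthonormal basis of vectors \<open>e\<close> with \<open>snd e = s e *\<^sub>R f e\<close>, where
  the \<open>f e\<close> are orthonormal and the \<open>fst e\<close> are orthogonal of squared
  length \<open>1 - (s e)\<^sup>2\<close>. The matrix \<open>D\<close> sends \<open>fst e\<close> to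
  a small multiple of \<open>f e\<close>, which fills in where \<open>s e\<close> is small. Room for
  the \<open>f e\<close> is the reason for \<open>dim V \<le> CARD('m)\<close>.\<close>

lemma exists_transversal_shear:
  fixes V :: "((real ^ 'n) \<times> (real ^ 'm)) set"
  assumes V: "subspace V" "dim V \<le> CARD('m)"
  shows "\<exists>D. norm D \<le> 1 \<and> (\<forall>v\<in>V. norm v / (CARD('m))\<^sup>2 \<le> norm (snd (shear D v)))"
proof -
  \<comment> \<open>\<open>D\<close> will have \<open>CARD('m)\<close> rows, each a sum of at most
    \<open>CARD('m)\<close> vectors of norm at most \<open>\<tau>\<close>; this choice gives
    \<open>norm D \<le> 1\<close>.\<close>
  define \<tau> where "\<tau> = 1 / real (CARD('m)\<^sup>2)"
  have \<tau>: "0 < \<tau>" "\<tau> \<le> 1" by (auto simp: \<tau>_def divide_simps)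
  have "dim V \<le> dim (UNIV :: (real ^ 'm) set)" using V(2) by simp
  from singular_value_decomposition[OF linear_snd V(1) subspace_UNIV subset_UNIV this]
  obtain E :: "((real ^ 'n) \<times> (real ^ 'm)) set" and f s where svd: "span E = V \<and> (\<forall>e\<in>E. norm e = 1) \<and>
      pairwise orthogonal E \<and> (\<forall>e\<in>E. norm (f e) = 1 \<and> snd e = s e *\<^sub>R f e \<and> 0 \<le> s e \<and> f e \<in> UNIV) \<and>
      (\<forall>e\<in>E. \<forall>e'\<in>E. e \<noteq> e' \<longrightarrow> f e \<bullet> f e' = 0)" by (elim exE)
  then have E: "span E = V" "\<And>e. e \<in> E \<Longrightarrow> norm e = 1" "pairwise orthogonal E"
    and f: "\<And>e. e \<in> E \<Longrightarrow> norm (f e) = 1" "\<And>e. e \<in> E \<Longrightarrow> snd e = s e *\<^sub>R f e" "\<And>e. e \<in> E \<Longrightarrow> 0 \<le> s e"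
      "\<And>e e'. e \<in> E \<Longrightarrow> e' \<in> E \<Longrightarrow> e \<noteq> e' \<Longrightarrow> f e \<bullet> f e' = 0"
    by simp_all
  have "0 \<notin> E" using E(2)[of 0] by auto
  then have indE: "independent E" by (rule pairwise_orthogonal_independent[OF E(3)])
  then have finE: "finite E" by (rule independent_imp_finite)
  have cardE: "card E \<le> CARD('m)" using dim_eq_card_independent[OF indE] dim_span[of E] E(1) V(2) by simp
  have fst_orth: "fst e \<bullet> fst e' = (if e = e' then 1 - (s e)\<^sup>2 else 0)" if "e \<in> E" "e' \<in> E" for e e'
  proof -
    have "e \<bullet> e' = (if e = e' then 1 else 0)"
      using E(2)[OF that(1)] pairwiseD[OF E(3) that] by (auto simp: norm_eq_1 orthogonal_def)
    moreover have "snd e \<bullet> snd e' = (if e = e' then (s e)\<^sup>2 else 0)"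
      using f(1)[OF that(1)] f(4)[OF that] by (auto simp: f(2) that norm_eq_1 power2_eq_square)
    ultimately show ?thesis by (auto simp: inner_prod_def)
  qed
  have s1: "s e \<le> 1" if "e \<in> E" for e
    using inner_ge_zero[of "fst e"] fst_orth[OF that that] f(3)[OF that] power2_le_imp_le[of "s e" 1] by simp
  define D :: "real ^ 'n ^ 'm" where "D = (\<chi> i. \<Sum>e\<in>E. (\<tau> * f e $ i) *\<^sub>R fst e)"
  have Dv: "D *v q = (\<Sum>e\<in>E. (\<tau> * (fst e \<bullet> q)) *\<^sub>R f e)" for q
  proof (rule Finite_Cartesian_Product.vec_eq_iff[THEN iffD2], rule)
    fix i
    have "(D *v q) $ i = D $ i \<bullet> q" by (simp add: matrix_vector_mult_def inner_vec_def)
    also have "\<dots> = (\<Sum>e\<in>E. (\<tau> * (fst e \<bullet> q)) *\<^sub>R f e) $ i"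
      by (simp add: D_def inner_sum_left sum_component mult_ac)
    finally show "(D *v q) $ i = (\<Sum>e\<in>E. (\<tau> * (fst e \<bullet> q)) *\<^sub>R f e) $ i" .
  qed
  have "norm D \<le> 1"
  proof -
    have "norm (D $ i) \<le> \<tau> * CARD('m)" for i
    proof -
      have "norm (D $ i) \<le> (\<Sum>e\<in>E. norm ((\<tau> * f e $ i) *\<^sub>R fst e))" unfolding D_def vec_lambda_beta by (rule norm_sum)
      also have "\<dots> \<le> (\<Sum>e\<in>E. \<tau>)"
      proof (rule sum_mono)
        fix e assume e: "e \<in> E"
        have "\<bar>f e $ i\<bar> \<le> 1" using component_le_norm_cart[of "f e" i] f(1)[OF e] by simp
        moreover have "norm (fst e) \<le> 1" using norm_fst_le[of "fst e" "snd e"] E(2)[OF e] by simp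
        ultimately have "\<bar>f e $ i\<bar> * norm (fst e) \<le> 1 * 1" by (intro mult_mono) auto
        then show "norm ((\<tau> * f e $ i) *\<^sub>R fst e) \<le> \<tau>" using \<tau> by (simp add: abs_mult mult.assoc mult_left_le)
      qed
      also have "\<dots> \<le> \<tau> * CARD('m)" using cardE \<tau> by (simp add: mult.commute)
      finally show ?thesis .
    qed
    then have "(\<Sum>i\<in>UNIV. norm (D $ i)) \<le> of_nat (card (UNIV :: 'm set)) * (\<tau> * CARD('m))"
      by (intro sum_bounded_above) auto
    moreover have "norm D \<le> (\<Sum>i\<in>UNIV. norm (D $ i))" unfolding norm_vec_def by (rule L2_set_le_sum) auto
    moreover have "of_nat (card (UNIV :: 'm set)) * (\<tau> * CARD('m)) = 1" by (simp add: \<tau>_def power2_eq_square)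
    ultimately show ?thesis by linarith
  qed
  moreover have "\<tau> * norm v \<le> norm (snd (shear D v))" if v: "v \<in> V" for v
  proof -
    obtain u where u: "v = (\<Sum>e\<in>E. u e *\<^sub>R e)" using v E(1) span_finite[OF finE] by auto
    \<comment> \<open>The coefficient of \<open>f e\<close> in the second component of the sheared
      \<open>e\<close>; it is at least \<open>\<tau>\<close> because
      \<open>\<tau> * (s e)\<^sup>2 \<le> s e\<close>.\<close>
    define \<kappa> where "\<kappa> e = s e + \<tau> * (1 - (s e)\<^sup>2)" for e
    have se: "snd (shear D e) = \<kappa> e *\<^sub>R f e" if e: "e \<in> E" for e
    proof -
      have "D *v fst e = (\<Sum>e'\<in>E. if e' = e then (\<tau> * (1 - (s e)\<^sup>2)) *\<^sub>R f e else 0)"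
        unfolding Dv by (rule sum.cong) (use e fst_orth in auto)
      also have "\<dots> = (\<tau> * (1 - (s e)\<^sup>2)) *\<^sub>R f e" using e finE by simp
      finally show ?thesis using f(2)[OF e] by (simp add: shear_def \<kappa>_def scaleR_add_left)
    qed
    have \<kappa>: "\<tau> \<le> \<kappa> e" if e: "e \<in> E" for e
    proof -
      have "(s e)\<^sup>2 \<le> s e" using f(3)[OF e] s1[OF e] by (simp add: power2_eq_square mult_left_le)
      moreover have "\<tau> * (s e)\<^sup>2 \<le> 1 * (s e)\<^sup>2" using \<tau> by (intro mult_right_mono) auto
      ultimately show ?thesis by (simp add: \<kappa>_def algebra_simps)
    qed
    have lin: "linear (\<lambda>v. snd (shear D v))" using linear_compose[OF linear_shear linear_snd] by (simp add: o_def)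
    have "snd (shear D v) = (\<Sum>e\<in>E. u e *\<^sub>R snd (shear D e))"
      unfolding u linear_sum[OF lin] linear_scale[OF lin] ..
    also have "\<dots> = (\<Sum>e\<in>E. (u e * \<kappa> e) *\<^sub>R f e)" by (rule sum.cong) (auto simp: se)
    finally have "(norm (snd (shear D v)))\<^sup>2 = (\<Sum>e\<in>E. (norm ((u e * \<kappa> e) *\<^sub>R f e))\<^sup>2)"
      using norm_sum_Pythagorean[OF finE, of "\<lambda>e. (u e * \<kappa> e) *\<^sub>R f e"] f(4)
      by (simp add: pairwise_def orthogonal_def)
    also have "\<dots> \<ge> (\<Sum>e\<in>E. (\<tau> * u e)\<^sup>2)"
    proof (rule sum_mono)
      fix e assume e: "e \<in> E"
      have "\<bar>\<tau> * u e\<bar> \<le> \<bar>u e * \<kappa> e\<bar>" using \<kappa>[OF e] \<tau> by (simp add: abs_mult mult.commute[of "\<bar>u e\<bar>"] mult_right_mono)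
      then show "(\<tau> * u e)\<^sup>2 \<le> (norm ((u e * \<kappa> e) *\<^sub>R f e))\<^sup>2" using f(1)[OF e] by (simp add: abs_le_square_iff)
    qed
    moreover have "(norm v)\<^sup>2 = (\<Sum>e\<in>E. (u e)\<^sup>2)"
      using norm_sum_Pythagorean[OF finE, of "\<lambda>e. u e *\<^sub>R e"] E(2,3)
      by (simp add: u pairwise_def orthogonal_def)
    ultimately have "(\<tau> * norm v)\<^sup>2 \<le> (norm (snd (shear D v)))\<^sup>2"
      by (simp add: power_mult_distrib sum_distrib_left)
    then show ?thesis by (rule power2_le_imp_le) simp
  qed
  ultimately show ?thesis by (intro exI[of _ D]) (simp add: \<tau>_def)
qed

lemma linear_matrix_vector_component: "linear (\<lambda>D :: real ^ 'n ^ 'm. (D *v q) \<bullet> b)"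
  by (rule linearI)
    (auto simp: matrix_vector_mult_add_rdistrib inner_add_left scaleR_matrix_vector_assoc[symmetric])

lemma linear_snd_shear: "linear (\<lambda>v. snd (shear D v))"
  using linear_compose[OF linear_shear linear_snd] by (simp add: o_def)

lemma gram_orthonormal:
  assumes "\<And>i j. i < length ys \<Longrightarrow> j < length ys \<Longrightarrow> ys ! i \<bullet> ys ! j = (if i = j then 1 else 0)"
  shows "gram ys = 1"
proof -
  have "gram_mat ys = 1\<^sub>m (length ys)" by (rule eq_matI) (auto simp: gram_mat_def assms)
  then show ?thesis by (simp add: gram_def)
qed

text \<open>The entries of the Gram matrix are quadratic in \<open>D\<close>, so the Leibniz formula
  gives degree \<open>2 l\<close>. The vectors have norm at most 1, so the bound depends on
  \<open>l\<close> and the dimensions alone.\<close>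

lemma bounded_poly_gram_shear:
  "\<exists>M. 0 < M \<and> (\<forall>ys :: ((real ^ 'n) \<times> (real ^ 'm)) list. length ys = l \<and> (\<forall>y\<in>set ys. norm y \<le> 1) \<longrightarrow>
     bounded_poly (l * 2) M (\<lambda>D. gram (map (\<lambda>v. snd (shear D v)) ys)))"
proof -
  define M0 :: real where "M0 = real (card (Basis :: (real ^ 'm) set)) * (2 ^ (1 + 1) * (2 * 2))"
  have "0 \<le> M0" by (simp add: M0_def)
  from bounded_poly_prod[OF this, of l 2, where 'a = "real ^ 'n ^ 'm"]
  obtain M1 where M1: "\<And>f :: nat \<Rightarrow> real ^ 'n ^ 'm \<Rightarrow> real. \<forall>i<l. bounded_poly 2 M0 (f i) \<Longrightarrow>
      bounded_poly (l * 2) M1 (\<lambda>x. \<Prod>i<l. f i x)" by blast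
  define M where "M = real (card {p. p permutes {0..<l}}) * M1"
  have "bounded_poly (l * 2) M (\<lambda>D. gram (map (\<lambda>v. snd (shear D v)) ys))"
    if ys: "length ys = l" "\<forall>y\<in>set ys. norm y \<le> 1" for ys :: "((real ^ 'n) \<times> (real ^ 'm)) list"
  proof -
    define a where "a i b D = snd (ys ! i) \<bullet> b + (D *v fst (ys ! i)) \<bullet> b" for i b and D :: "real ^ 'n ^ 'm"
    have a: "bounded_poly 1 2 (a i b)" if i: "i < l" and b: "b \<in> Basis" for i b
    proof -
      have n1: "norm (ys ! i) \<le> 1" using ys i by auto
      have nb: "norm b = 1" using b by simp
      have "\<bar>snd (ys ! i) \<bullet> b\<bar> \<le> norm (snd (ys ! i)) * norm b" by (rule Cauchy_Schwarz_ineq2)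
      then have 1: "\<bar>snd (ys ! i) \<bullet> b\<bar> \<le> 1"
        using n1 nb norm_snd_le[of "snd (ys ! i)" "fst (ys ! i)"] by simp
      have 2: "\<bar>(D *v fst (ys ! i)) \<bullet> b\<bar> \<le> 1 * norm D" for D :: "real ^ 'n ^ 'm"
      proof -
        have "\<bar>(D *v fst (ys ! i)) \<bullet> b\<bar> \<le> norm (D *v fst (ys ! i)) * norm b" by (rule Cauchy_Schwarz_ineq2)
        also have "\<dots> \<le> norm D * norm (fst (ys ! i))" using norm_matrix_vector_le nb by simp
        also have "\<dots> \<le> norm D * 1"
          using n1 norm_fst_le[of "fst (ys ! i)" "snd (ys ! i)"] by (intro mult_left_mono) auto
        finally show ?thesis by simp
      qed
      show ?thesis unfolding a_def
        by (rule bounded_poly_mono[OF bounded_poly_affine[OF linear_matrix_vector_component 2]]) (use 1 in auto)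
    qed
    define en where "en i j D = (\<Sum>b\<in>Basis. a i b D * a j b D)" for i j D
    have en: "bounded_poly 2 M0 (en i j)" if "i < l" "j < l" for i j
      unfolding en_def[abs_def] M0_def
    proof (rule bounded_poly_sum)
      fix b :: "real ^ 'm" assume "b \<in> Basis"
      then show "bounded_poly 2 (2 ^ (1 + 1) * (2 * 2)) (\<lambda>D. a i b D * a j b D)"
        using bounded_poly_mult[OF a a, of i b j b] that by (simp add: numeral_2_eq_2)
    qed simp
    have entry: "snd (shear D (ys ! i)) \<bullet> snd (shear D (ys ! j)) = en i j D" for D i j
      unfolding en_def a_def by (subst euclidean_inner) (simp add: shear_def inner_add_left)
    have "gram (map (\<lambda>v. snd (shear D v)) ys) = (\<Sum>p | p permutes {0..<l}. signof p * (\<Prod>i<l. en i (p i) D))" for D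
    proof -
      have "gram_mat (map (\<lambda>v. snd (shear D v)) ys) \<in> carrier_mat l l"
        using ys(1) gram_mat_carrier[of "map (\<lambda>v. snd (shear D v)) ys"] by simp
      from det_def'[OF this] have "gram (map (\<lambda>v. snd (shear D v)) ys) =
        (\<Sum>p | p permutes {0..<l}. signof p * (\<Prod>i = 0..<l. gram_mat (map (\<lambda>v. snd (shear D v)) ys) $$ (i, p i)))"
        by (simp add: gram_def)
      also have "\<dots> = (\<Sum>p | p permutes {0..<l}. signof p * (\<Prod>i<l. en i (p i) D))"
      proof (intro sum.cong refl arg_cong2[of _ _ _ _ "(*)"])
        fix p assume "p \<in> {p. p permutes {0..<l}}"
        then have "p i < l" if "i < l" for i using that permutes_in_image by fastforce
        then show "(\<Prod>i = 0..<l. gram_mat (map (\<lambda>v. snd (shear D v)) ys) $$ (i, p i)) = (\<Prod>i<l. en i (p i) D)"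
          unfolding lessThan_atLeast0 by (intro prod.cong) (auto simp: gram_mat_def ys(1) entry)
      qed
      finally show ?thesis .
    qed
    moreover have "bounded_poly (l * 2) M (\<lambda>D. \<Sum>p | p permutes {0..<l}. signof p * (\<Prod>i<l. en i (p i) D))"
      unfolding M_def
    proof (rule bounded_poly_sum)
      fix p assume "p \<in> {p. p permutes {0..<l}}"
      then have p: "p i < l" if "i < l" for i using that permutes_in_image by fastforce
      have "bounded_poly (l * 2) M1 (\<lambda>D. \<Prod>i<l. en i (p i) D)" using en p by (intro M1) auto
      from bounded_poly_scale[OF this, of "signof p"]
      show "bounded_poly (l * 2) M1 (\<lambda>D. signof p * (\<Prod>i<l. en i (p i) D))" by (simp add: sign_def split: if_splits)
    qed (simp add: finite_permutations)
    ultimately show ?thesis by simp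
  qed
  then have "bounded_poly (l * 2) (max M 1) (\<lambda>D. gram (map (\<lambda>v. snd (shear D v)) ys))"
    if "length ys = l" "\<forall>y\<in>set ys. norm y \<le> 1" for ys :: "((real ^ 'n) \<times> (real ^ 'm)) list"
    using that bounded_poly_mono by fastforce
  then show ?thesis by (intro exI[of _ "max M 1"]) auto
qed

text \<open>The polynomial of \<open>bounded_poly_gram_shear\<close> is at least
  \<open>(\<tau>\<^sup>2) ^ l\<close> at the matrix from \<open>exists_transversal_shear\<close>.
  \<open>N\<close> and \<open>\<delta>\<close> are chosen before \<open>ys\<close>: this uniformity
  bounds the number of moves per subspace.\<close>

lemma forces_transversal_orthonormal:
  assumes \<beta>: "0 < \<beta>" "\<beta> < 1" and l: "l \<le> CARD('m)"
  shows "\<exists>N \<delta>. 0 < \<delta> \<and> (\<forall>ys :: ((real ^ 'n) \<times> (real ^ 'm)) list. length ys = l \<and>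
     (\<forall>i<l. \<forall>j<l. ys ! i \<bullet> ys ! j = (if i = j then 1 else 0)) \<longrightarrow>
     forces \<beta> N (\<lambda>c r. \<forall>D\<in>cball c r. \<delta> \<le> gram (map (\<lambda>v. snd (shear D v)) ys)) 0 1)"
proof -
  obtain M where M: "0 < M" "\<And>ys :: ((real ^ 'n) \<times> (real ^ 'm)) list. length ys = l \<Longrightarrow> \<forall>y\<in>set ys. norm y \<le> 1 \<Longrightarrow>
     bounded_poly (l * 2) M (\<lambda>D. gram (map (\<lambda>v. snd (shear D v)) ys))"
    using bounded_poly_gram_shear[of l] by blast
  define \<tau> where "\<tau> = 1 / real (CARD('m)\<^sup>2)"
  have \<tau>: "0 < \<tau>" by (simp add: \<tau>_def)
  then have "0 < (\<tau>\<^sup>2) ^ l" by simp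
  from forces_bounded_poly_away_from_0[OF \<beta> this M(1), of "l * 2", where 'a = "real ^ 'n ^ 'm"]
  obtain N \<delta> where N: "0 < \<delta>" "\<And>f :: real ^ 'n ^ 'm \<Rightarrow> real. bounded_poly (l * 2) M f \<Longrightarrow>
      \<exists>x\<in>cball 0 1. (\<tau>\<^sup>2) ^ l \<le> \<bar>f x\<bar> \<Longrightarrow> forces \<beta> N (\<lambda>c r. \<forall>x\<in>cball c r. \<delta> \<le> \<bar>f x\<bar>) 0 1" by blast
  have "forces \<beta> N (\<lambda>c r. \<forall>D\<in>cball c r. \<delta> \<le> gram (map (\<lambda>v. snd (shear D v)) ys)) 0 1"
    if ys: "length ys = l" "\<forall>i<l. \<forall>j<l. ys ! i \<bullet> ys ! j = (if i = j then 1 else 0)"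
    for ys :: "((real ^ 'n) \<times> (real ^ 'm)) list"
  proof -
    have g1: "gram ys = 1" using ys by (intro gram_orthonormal) auto
    have "norm (ys ! i) = 1" if "i < l" for i
    proof -
      from ys(2) that have "(ys ! i) \<bullet> (ys ! i) = (if i = i then 1 else 0)" by blast
      then show ?thesis unfolding norm_eq_1 by simp
    qed
    then have "\<forall>y\<in>set ys. norm y \<le> 1" unfolding all_set_conv_all_nth ys(1) by simp
    then have bp: "bounded_poly (l * 2) M (\<lambda>D. gram (map (\<lambda>v. snd (shear D v)) ys))"
      by (rule M(2)[OF ys(1)])
    have "dim (span (set ys)) = l" using dim_span_list[of ys] g1 ys(1) by simp
    then obtain D :: "real ^ 'n ^ 'm" where D: "norm D \<le> 1"
      "\<And>v. v \<in> span (set ys) \<Longrightarrow> norm v / real (CARD('m)\<^sup>2) \<le> norm (snd (shear D v))"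
      using exists_transversal_shear[OF subspace_span, of "set ys"] l by auto
    have "(\<tau>\<^sup>2) ^ length ys * gram ys \<le> gram (map (\<lambda>v. snd (shear D v)) ys)"
      using D(2) \<tau> by (intro gram_map_ge linear_snd_shear) (auto simp: \<tau>_def)
    then have "\<exists>x\<in>cball 0 1. (\<tau>\<^sup>2) ^ l \<le> \<bar>gram (map (\<lambda>v. snd (shear x v)) ys)\<bar>"
      using D(1) g1 ys(1) by (intro bexI[of _ D]) auto
    from N(2)[OF bp this] show ?thesis by (simp add: gram_nonneg)
  qed
  then show ?thesis using N(1) by blast
qed

lemma exists_orthonormal_list:
  fixes ws :: "'v::euclidean_space list"
  assumes "0 < gram ws"
  obtains ys A where "length ys = length ws" "A \<in> carrier_mat (length ws) (length ws)"
    "\<forall>i<length ws. \<forall>j<length ws. ys ! i \<bullet> ys ! j = (if i = j then 1 else 0)"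
    "\<And>i. i < length ws \<Longrightarrow> ws ! i = (\<Sum>j<length ws. (A $$ (i, j)) *\<^sub>R (ys ! j))"
proof -
  define n where "n = length ws"
  obtain B where B: "B \<subseteq> span (set ws)" "pairwise orthogonal B" "\<And>x. x \<in> B \<Longrightarrow> norm x = 1" "independent B"
    "card B = dim (span (set ws))" "span B = span (set ws)"
    using orthonormal_basis_subspace[OF subspace_span, of "set ws"] by metis
  obtain ys where ys: "set ys = B" "distinct ys"
    using finite_distinct_list[OF independent_imp_finite[OF B(4)]] by blast
  have len: "length ys = n" using B(5) ys dim_span_list[OF assms] distinct_card[of ys] by (simp add: n_def)
  have on: "ys ! i \<bullet> ys ! j = (if i = j then 1 else 0)" if "i < n" "j < n" for i j
  proof -
    have "ys ! i \<in> B" "ys ! j \<in> B" using that len ys(1) by auto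
    moreover have "ys ! i = ys ! j \<longleftrightarrow> i = j" using that len ys(2) by (simp add: nth_eq_iff_index_eq)
    ultimately show ?thesis using B(3) pairwiseD[OF B(2)] by (auto simp: norm_eq_1 orthogonal_def)
  qed
  have "\<exists>c. ws ! i = (\<Sum>j<n. c j *\<^sub>R (ys ! j))" if "i < n" for i
  proof -
    have "ws ! i \<in> span (set ws)" using that by (intro span_base) (simp add: n_def)
    then have "ws ! i \<in> span (set ys)" using B(6) ys(1) by simp
    from span_list_lincomb[OF this] show ?thesis unfolding len by blast
  qed
  then obtain c where c: "\<And>i. i < n \<Longrightarrow> ws ! i = (\<Sum>j<n. c i j *\<^sub>R (ys ! j))" by metis
  show ?thesis
  proof (rule that[of ys "Matrix.mat n n (\<lambda>(i, j). c i j)"])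
    show "ws ! i = (\<Sum>j<length ws. Matrix.mat n n (\<lambda>(i, j). c i j) $$ (i, j) *\<^sub>R ys ! j)" if "i < length ws" for i
      using that c[of i] unfolding n_def[symmetric] by simp
  qed (use len on in \<open>auto simp: n_def\<close>)
qed

text \<open>Up to the scalar \<open>\<rho> powr (m / (n + m))\<close> this is the unimodular map
  \<open>(x, y) \<mapsto> (exp (- m t) x, exp (n t) (\<Theta> x - y))\<close> of the Dani correspondence, with
  \<open>\<rho> = exp (- (n + m) t)\<close>.\<close>
definition dani :: "real ^ 'n ^ 'm \<Rightarrow> real \<Rightarrow> (real ^ 'n) \<times> (real ^ 'm) \<Rightarrow> (real ^ 'n) \<times> (real ^ 'm)" where
  "dani \<Theta> \<rho> v = (fst v, (1 / \<rho>) *\<^sub>R (\<Theta> *v fst v - snd v))"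

lemma linear_dani: "linear (dani \<Theta> \<rho>)"
  by (rule linearI) (auto simp: dani_def matrix_vector_right_distrib matrix_vector_mult_scaleR algebra_simps)

text \<open>Moving \<Theta> within a ball of radius \<open>\<rho>\<close> around it becomes a shear
  by a matrix of norm at most 1.\<close>

lemma dani_shear:
  assumes "0 < \<rho>"
  shows "dani \<Theta>' \<rho> v = shear ((1 / \<rho>) *\<^sub>R (\<Theta>' - \<Theta>)) (dani \<Theta> \<rho> v)"
  using assms
  by (simp add: dani_def shear_def scaleR_matrix_vector_assoc[symmetric] matrix_vector_mult_diff_rdistrib
      flip: scaleR_add_right)

text \<open>A homothety turns \<open>cball \<Theta> \<rho>\<close> into the unit ball of shears.
  Expressing the images of \<open>xs\<close> under \<open>dani \<Theta> \<rho>\<close> in an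
  orthonormal basis of their span multiplies both sides by the same squared determinant, which
  reduces the claim to orthonormal lists.\<close>

lemma forces_transversal:
  assumes \<beta>: "0 < \<beta>" "\<beta> < 1"
  shows "\<exists>N \<delta>. 0 < \<delta> \<and> (\<forall>(xs :: ((real ^ 'n) \<times> (real ^ 'm)) list) \<Theta> \<rho>. length xs \<le> CARD('m) \<longrightarrow> 0 < \<rho> \<longrightarrow>
     forces \<beta> N (\<lambda>c r. \<forall>\<Theta>'\<in>cball c r. \<delta> * gram (map (dani \<Theta> \<rho>) xs) \<le> gram (map (\<lambda>v. snd (dani \<Theta>' \<rho> v)) xs)) \<Theta> \<rho>)"
proof -
  have "\<forall>l\<in>{..CARD('m)}. \<exists>p. 0 < snd p \<and> (\<forall>ys :: ((real ^ 'n) \<times> (real ^ 'm)) list. length ys = l \<and>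
     (\<forall>i<l. \<forall>j<l. ys ! i \<bullet> ys ! j = (if i = j then 1 else 0)) \<longrightarrow>
     forces \<beta> (fst p) (\<lambda>c r. \<forall>D\<in>cball c r. snd p \<le> gram (map (\<lambda>v. snd (shear D v)) ys)) 0 1)"
    using forces_transversal_orthonormal[OF \<beta>, where 'n = 'n and 'm = 'm] by fastforce
  then obtain p where p: "\<And>l. l \<le> CARD('m) \<Longrightarrow> 0 < snd (p l)"
    "\<And>(ys :: ((real ^ 'n) \<times> (real ^ 'm)) list). length ys \<le> CARD('m) \<Longrightarrow>
     \<forall>i<length ys. \<forall>j<length ys. ys ! i \<bullet> ys ! j = (if i = j then 1 else 0) \<Longrightarrow>
     forces \<beta> (fst (p (length ys))) (\<lambda>c r. \<forall>D\<in>cball c r. snd (p (length ys)) \<le> gram (map (\<lambda>v. snd (shear D v)) ys)) 0 1"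
    unfolding bchoice_iff by fastforce
  define N where "N = (\<Sum>l\<le>CARD('m). fst (p l))"
  define \<delta> where "\<delta> = Min ((\<lambda>l. snd (p l)) ` {..CARD('m)})"
  have "0 < \<delta>" unfolding \<delta>_def using p(1) by (subst Min_gr_iff) auto
  moreover have "forces \<beta> N (\<lambda>c r. \<forall>\<Theta>'\<in>cball c r. \<delta> * gram (map (dani \<Theta> \<rho>) xs) \<le> gram (map (\<lambda>v. snd (dani \<Theta>' \<rho> v)) xs)) \<Theta> \<rho>"
    if len: "length xs \<le> CARD('m)" and \<rho>: "0 < \<rho>" for xs :: "((real ^ 'n) \<times> (real ^ 'm)) list" and \<Theta> \<rho>
  proof (cases "0 < gram (map (dani \<Theta> \<rho>) xs)")
    case False
    then have "gram (map (dani \<Theta> \<rho>) xs) = 0" using gram_nonneg[of "map (dani \<Theta> \<rho>) xs"] by linarith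
    then show ?thesis by (intro forces_refl) (simp add: gram_nonneg)
  next
    case True
    define ws where "ws = map (dani \<Theta> \<rho>) xs"
    obtain ys A where ys: "length ys = length ws" "A \<in> carrier_mat (length ws) (length ws)"
      "\<forall>i<length ws. \<forall>j<length ws. ys ! i \<bullet> ys ! j = (if i = j then 1 else 0)"
      "\<And>i. i < length ws \<Longrightarrow> ws ! i = (\<Sum>j<length ws. (A $$ (i, j)) *\<^sub>R (ys ! j))"
      by (rule exists_orthonormal_list[OF True[folded ws_def]]) blast
    have lw: "length ws = length xs" by (simp add: ws_def)
    define k where "k = length ys"
    have k: "k \<le> CARD('m)" using len ys(1) lw by (simp add: k_def)
    have "gram ys = 1" using ys by (intro gram_orthonormal) auto
    then have gw: "gram ws = (det A)\<^sup>2" using gram_lincomb[OF ys(2) ys(1) refl ys(4)] by simp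
    have gf: "gram (map f ws) = (det A)\<^sup>2 * gram (map f ys)"
      if "linear f" for f :: "(real ^ 'n) \<times> (real ^ 'm) \<Rightarrow> real ^ 'm"
      using gram_map_lincomb[OF that ys(2) ys(1) refl ys(4)] .
    have "forces \<beta> (fst (p k)) (\<lambda>c r. \<forall>D\<in>cball c r. snd (p k) \<le> gram (map (\<lambda>v. snd (shear D v)) ys)) 0 1"
      using p(2)[of ys] k ys(1,3) by (simp add: k_def)
    moreover have "fst (p k) \<le> N" unfolding N_def using k by (intro member_le_sum) auto
    ultimately have "forces \<beta> N (\<lambda>c r. \<forall>D\<in>cball c r. snd (p k) \<le> gram (map (\<lambda>v. snd (shear D v)) ys)) 0 1"
      by (rule forces_mono)
    then have "forces \<beta> N (\<lambda>c r. \<forall>\<Theta>'\<in>cball (\<Theta> + \<rho> *\<^sub>R c) (\<rho> * r).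
        \<delta> * gram ws \<le> gram (map (\<lambda>v. snd (dani \<Theta>' \<rho> v)) xs)) 0 1"
    proof (rule forces_weaken[OF _ \<beta>])
      fix c r assume D: "\<forall>D\<in>cball c r. snd (p k) \<le> gram (map (\<lambda>v. snd (shear D v)) ys)"
      show "\<forall>\<Theta>'\<in>cball (\<Theta> + \<rho> *\<^sub>R c) (\<rho> * r). \<delta> * gram ws \<le> gram (map (\<lambda>v. snd (dani \<Theta>' \<rho> v)) xs)"
      proof
        fix \<Theta>' assume \<Theta>': "\<Theta>' \<in> cball (\<Theta> + \<rho> *\<^sub>R c) (\<rho> * r)"
        define E where "E = (1 / \<rho>) *\<^sub>R (\<Theta>' - \<Theta>)"
        have "(\<Theta> + \<rho> *\<^sub>R c) - \<Theta>' = \<rho> *\<^sub>R (c - E)" using \<rho> by (simp add: E_def algebra_simps)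
        then have "E \<in> cball c r" using \<Theta>' \<rho> by (simp add: dist_norm)
        then have "snd (p k) \<le> gram (map (\<lambda>v. snd (shear E v)) ys)" using D by blast
        moreover have "\<delta> \<le> snd (p k)" unfolding \<delta>_def using k by (intro Min_le) auto
        ultimately have "\<delta> \<le> gram (map (\<lambda>v. snd (shear E v)) ys)" by linarith
        then have "(det A)\<^sup>2 * \<delta> \<le> (det A)\<^sup>2 * gram (map (\<lambda>v. snd (shear E v)) ys)" by (rule mult_left_mono) simp
        also have "\<dots> = gram (map (\<lambda>v. snd (shear E v)) ws)" by (simp add: gf linear_snd_shear)
        also have "map (\<lambda>v. snd (shear E v)) ws = map (\<lambda>v. snd (dani \<Theta>' \<rho> v)) xs"
          unfolding ws_def E_def dani_shear[OF \<rho>, of \<Theta>' _ \<Theta>] by simp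
        finally show "\<delta> * gram ws \<le> gram (map (\<lambda>v. snd (dani \<Theta>' \<rho> v)) xs)" by (simp add: gw mult.commute)
      qed
    qed simp
    then have "forces \<beta> N (\<lambda>c r. \<forall>\<Theta>'\<in>cball c r. \<delta> * gram ws \<le> gram (map (\<lambda>v. snd (dani \<Theta>' \<rho> v)) xs))
        (\<Theta> + \<rho> *\<^sub>R 0) (\<rho> * 1)"
      by (rule forces_similarity[OF \<rho>, where ?c0.0 = \<Theta> and c = 0 and r = 1 and
        Q = "\<lambda>c r. \<forall>\<Theta>'\<in>cball c r. \<delta> * gram ws \<le> gram (map (\<lambda>v. snd (dani \<Theta>' \<rho> v)) xs)"])
    then show ?thesis unfolding ws_def by simp
  qed
  ultimately show ?thesis by blast
qed

section \<open>Covolumes under the flow\<close>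

text \<open>The shear has operator norm at most \<open>1 + 2 = 3\<close>, which costs a factor 9 per
  vector in the squared volume.\<close>

lemma gram_dani_le:
  assumes "0 < \<rho>" "norm (\<Theta>' - \<Theta>) \<le> 2 * \<rho>"
  shows "gram (map (dani \<Theta>' \<rho>) xs) \<le> 9 ^ length xs * gram (map (dani \<Theta> \<rho>) xs)"
proof -
  define D where "D = (1 / \<rho>) *\<^sub>R (\<Theta>' - \<Theta>)"
  have D: "norm D \<le> 2" using assms by (simp add: D_def divide_le_eq)
  have "norm (shear D v) \<le> 3 * norm v" for v
  proof -
    have "(1 + norm D) * norm v \<le> 3 * norm v" using D by (intro mult_right_mono) auto
    then show ?thesis using norm_shear_le[of D v] by linarith
  qed
  then have "gram (map (shear D) (map (dani \<Theta> \<rho>) xs)) \<le> (3\<^sup>2) ^ length (map (dani \<Theta> \<rho>) xs) * gram (map (dani \<Theta> \<rho>) xs)"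
    by (intro gram_map_le linear_shear) auto
  moreover have "map (shear D) (map (dani \<Theta> \<rho>) xs) = map (dani \<Theta>' \<rho>) xs"
    unfolding D_def dani_shear[OF assms(1), of \<Theta>' _ \<Theta>] by simp
  ultimately have "gram (map (dani \<Theta>' \<rho>) xs) \<le> (3\<^sup>2) ^ length xs * gram (map (dani \<Theta> \<rho>) xs)"
    by (simp only: length_map)
  then show ?thesis by simp
qed

text \<open>The flow: passing from radius \<open>\<rho>\<close> to \<open>\<rho>'\<close> at fixed
  \<Theta> is a stretch by \<open>\<rho> / \<rho>'\<close>, see \<open>dani_stretch\<close>.\<close>

definition stretch :: "real \<Rightarrow> 'a::real_vector \<times> 'b::real_vector \<Rightarrow> 'a \<times> 'b" where
  "stretch t v = (fst v, t *\<^sub>R snd v)"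

lemma linear_stretch: "linear (stretch t)"
  by (rule linearI) (auto simp: stretch_def scaleR_add_right)

lemma norm_stretch_le:
  fixes v :: "'a::real_normed_vector \<times> 'b::real_normed_vector"
  assumes "0 \<le> t" "t \<le> 1"
  shows "norm (stretch t v) \<le> norm v"
proof -
  have "t * norm (snd v) \<le> 1 * norm (snd v)" using assms by (intro mult_right_mono) auto
  then have "(t * norm (snd v))\<^sup>2 \<le> (norm (snd v))\<^sup>2" using assms by (intro power_mono) auto
  then show ?thesis using assms by (simp add: norm_prod_def stretch_def)
qed

lemma norm_stretch_ge:
  fixes v :: "'a::real_normed_vector \<times> 'b::real_normed_vector"
  assumes "1 \<le> t"
  shows "norm v \<le> norm (stretch t v)"
proof -
  have "stretch (1 / t) (stretch t v) = v" using assms by (simp add: stretch_def)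
  then show ?thesis using norm_stretch_le[of "1 / t" "stretch t v"] assms by simp
qed

lemma dani_stretch:
  assumes "0 < \<rho>" "0 < \<rho>'"
  shows "dani \<Theta> \<rho>' v = stretch (\<rho> / \<rho>') (dani \<Theta> \<rho> v)"
  using assms by (simp add: dani_def stretch_def)

lemma gram_dani_radius_mono:
  fixes xs :: "((real ^ 'n) \<times> (real ^ 'm)) list"
  assumes "0 < \<rho>'" "\<rho>' \<le> \<rho>"
  shows "gram (map (dani \<Theta> \<rho>) xs) \<le> gram (map (dani \<Theta> \<rho>') xs)"
proof -
  have \<rho>: "0 < \<rho>" using assms by linarith
  have eq: "map (dani \<Theta> \<rho>) xs = map (stretch (\<rho>' / \<rho>)) (map (dani \<Theta> \<rho>') xs)"
    using dani_stretch[OF assms(1) \<rho>, of \<Theta>] by simp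
  have "gram (map (stretch (\<rho>' / \<rho>)) (map (dani \<Theta> \<rho>') xs)) \<le> (1\<^sup>2) ^ length (map (dani \<Theta> \<rho>') xs) * gram (map (dani \<Theta> \<rho>') xs)"
    using norm_stretch_le[of "\<rho>' / \<rho>"] assms \<rho> by (intro gram_map_le linear_stretch) auto
  then show ?thesis unfolding eq by simp
qed

text \<open>After projection by \<open>snd\<close> the stretch is a multiplication by
  \<open>\<rho> / \<rho>'\<close>, which gives the full power for \<open>ys\<close>; the vectors
  \<open>zs\<close> lose nothing by \<open>gram_append_expanding\<close>.\<close>

lemma gram_dani_expansion:
  fixes ys zs :: "((real ^ 'n) \<times> (real ^ 'm)) list"
  assumes "0 < \<rho>'" "\<rho>' \<le> \<rho>"
  shows "gram (map (dani \<Theta> \<rho>) (ys @ zs)) * (((\<rho> / \<rho>')\<^sup>2) ^ length ys * gram (map (\<lambda>v. snd (dani \<Theta> \<rho> v)) ys))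
    \<le> gram (map (dani \<Theta> \<rho>') (ys @ zs)) * gram (map (dani \<Theta> \<rho>) ys)"
proof -
  have \<rho>: "0 < \<rho>" using assms by linarith
  define t where "t = \<rho> / \<rho>'"
  have t: "1 \<le> t" using assms by (simp add: t_def)
  have eq: "map (dani \<Theta> \<rho>') us = map (stretch t) (map (dani \<Theta> \<rho>) us)" for us
    using dani_stretch[OF \<rho> assms(1), of \<Theta>] by (simp add: t_def)
  have "((\<rho> / \<rho>')\<^sup>2) ^ length ys * gram (map (\<lambda>v. snd (dani \<Theta> \<rho> v)) ys)
      = gram (map (\<lambda>v. t *\<^sub>R v) (map (\<lambda>v. snd (dani \<Theta> \<rho> v)) ys))"
    unfolding gram_scale by (simp add: t_def)
  also have "map (\<lambda>v. t *\<^sub>R v) (map (\<lambda>v. snd (dani \<Theta> \<rho> v)) ys) = map snd (map (stretch t) (map (dani \<Theta> \<rho>) ys))"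
    by (simp add: stretch_def)
  also have "gram \<dots> \<le> (1\<^sup>2) ^ length (map (stretch t) (map (dani \<Theta> \<rho>) ys)) * gram (map (stretch t) (map (dani \<Theta> \<rho>) ys))"
    by (intro gram_map_le linear_snd) (auto simp: norm_snd_le)
  finally have "gram (map (dani \<Theta> \<rho>) (ys @ zs)) * (((\<rho> / \<rho>')\<^sup>2) ^ length ys * gram (map (\<lambda>v. snd (dani \<Theta> \<rho> v)) ys))
      \<le> gram (map (dani \<Theta> \<rho>) (ys @ zs)) * gram (map (stretch t) (map (dani \<Theta> \<rho>) ys))"
    by (intro mult_left_mono) (auto simp: gram_nonneg)
  also have "\<dots> \<le> gram (map (dani \<Theta> \<rho>') (ys @ zs)) * gram (map (dani \<Theta> \<rho>) ys)"
    unfolding eq map_append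
    using gram_append_expanding[OF linear_stretch norm_stretch_ge[OF t], of "map (dani \<Theta> \<rho>) ys" "map (dani \<Theta> \<rho>) zs"]
    by simp
  finally show ?thesis .
qed

text \<open>Only \<open>m\<close> directions expand, so general position is forced for the first
  \<open>CARD('m)\<close> vectors of \<open>xs\<close> and the others follow. It is forced once, at
  scale \<open>\<rho>\<close>, and then serves all smaller scales.\<close>

lemma forces_dani_expansion:
  assumes \<beta>: "0 < \<beta>" "\<beta> < 1"
  shows "\<exists>N \<delta>. 0 < \<delta> \<and> (\<forall>(xs :: ((real ^ 'n) \<times> (real ^ 'm)) list) \<Theta> \<rho>.
     length xs \<le> CARD('n) + CARD('m) \<longrightarrow> 0 < \<rho> \<longrightarrow>
     forces \<beta> N (\<lambda>c r. \<forall>\<Theta>'\<in>cball c r. \<forall>\<rho>'. 0 < \<rho>' \<and> \<rho>' \<le> \<rho> \<longrightarrow>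
        \<delta> * (((\<rho> / \<rho>')\<^sup>2) ^ min (length xs) (CARD('m)) * gram (map (dani \<Theta> \<rho>) xs)) \<le> gram (map (dani \<Theta>' \<rho>') xs)) \<Theta> \<rho>)"
proof -
  obtain N \<delta> where \<delta>: "0 < \<delta>" and N: "\<And>(xs :: ((real ^ 'n) \<times> (real ^ 'm)) list) \<Theta> \<rho>. length xs \<le> CARD('m) \<Longrightarrow> 0 < \<rho> \<Longrightarrow>
     forces \<beta> N (\<lambda>c r. \<forall>\<Theta>'\<in>cball c r. \<delta> * gram (map (dani \<Theta> \<rho>) xs) \<le> gram (map (\<lambda>v. snd (dani \<Theta>' \<rho> v)) xs)) \<Theta> \<rho>"
    using forces_transversal[OF \<beta>, where 'n = 'n and 'm = 'm] by blast
  define d where "d = CARD('n) + CARD('m)"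
  \<comment> \<open>The cost of exchanging \<Theta> and \<open>\<Theta>'\<close> at scale
    \<open>\<rho>\<close>; it is paid once for \<open>xs\<close> and once for
    \<open>ys\<close>.\<close>
  define P :: real where "P = 9 ^ d"
  have P: "0 < P" by (simp add: P_def)
  have "forces \<beta> N (\<lambda>c r. \<forall>\<Theta>'\<in>cball c r. \<forall>\<rho>'. 0 < \<rho>' \<and> \<rho>' \<le> \<rho> \<longrightarrow>
        \<delta> / (P * P) * (((\<rho> / \<rho>')\<^sup>2) ^ min (length xs) (CARD('m)) * gram (map (dani \<Theta> \<rho>) xs)) \<le> gram (map (dani \<Theta>' \<rho>') xs)) \<Theta> \<rho>"
    if len: "length xs \<le> d" and \<rho>: "0 < \<rho>" for xs :: "((real ^ 'n) \<times> (real ^ 'm)) list" and \<Theta> \<rho>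
  proof -
    define ys zs where "ys = take (CARD('m)) xs" and "zs = drop (CARD('m)) xs"
    have xs: "xs = ys @ zs" by (simp add: ys_def zs_def)
    have ly: "length ys = min (length xs) (CARD('m))" by (simp add: ys_def min.commute)
    have "forces \<beta> N (\<lambda>c r. \<forall>\<Theta>'\<in>cball c r. \<delta> * gram (map (dani \<Theta> \<rho>) ys) \<le> gram (map (\<lambda>v. snd (dani \<Theta>' \<rho> v)) ys)) \<Theta> \<rho>"
      using ly \<rho> by (intro N) auto
    then show ?thesis
    proof (rule forces_weaken[OF _ \<beta> \<rho>], intro ballI allI impI)
      fix c r \<Theta>' \<rho>'
      assume H: "\<forall>\<Theta>'\<in>cball c r. \<delta> * gram (map (dani \<Theta> \<rho>) ys) \<le> gram (map (\<lambda>v. snd (dani \<Theta>' \<rho> v)) ys)"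
        and sub: "cball c r \<subseteq> cball \<Theta> \<rho>" and \<Theta>': "\<Theta>' \<in> cball c r" and \<rho>': "0 < \<rho>' \<and> \<rho>' \<le> \<rho>"
      define X X1 Y Y1 S F q where "X = gram (map (dani \<Theta>' \<rho>) xs)" and "X1 = gram (map (dani \<Theta> \<rho>) xs)"
        and "Y = gram (map (dani \<Theta>' \<rho>) ys)" and "Y1 = gram (map (dani \<Theta> \<rho>) ys)"
        and "S = gram (map (\<lambda>v. snd (dani \<Theta>' \<rho> v)) ys)" and "F = gram (map (dani \<Theta>' \<rho>') xs)"
        and "q = ((\<rho> / \<rho>')\<^sup>2) ^ length ys"
      have nn: "0 \<le> X" "0 \<le> X1" "0 \<le> Y" "0 \<le> Y1" "0 \<le> S" "0 \<le> F" "0 \<le> q"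
        by (auto simp: X_def X1_def Y_def Y1_def S_def F_def q_def gram_nonneg)
      have "dist \<Theta> \<Theta>' \<le> \<rho>" using sub \<Theta>' by auto
      then have nd: "norm (\<Theta>' - \<Theta>) \<le> 2 * \<rho>" "norm (\<Theta> - \<Theta>') \<le> 2 * \<rho>"
        using \<rho> by (auto simp: dist_norm norm_minus_commute)
      have pw: "(9::real) ^ length us * g \<le> P * g" if "length us \<le> d" "0 \<le> g" for us :: "((real ^ 'n) \<times> (real ^ 'm)) list" and g
        unfolding P_def using that by (intro mult_right_mono power_increasing) auto
      have ly': "length ys \<le> d" using ly len by simp
      have YY1: "Y \<le> P * Y1" unfolding Y_def Y1_def
        by (rule order_trans[OF gram_dani_le[OF \<rho> nd(1)] pw[OF ly' gram_nonneg]])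
      have X1X: "X1 \<le> P * X" unfolding X_def X1_def
        by (rule order_trans[OF gram_dani_le[OF \<rho> nd(2)] pw[OF len gram_nonneg]])
      have Y1Y: "Y1 \<le> P * Y" unfolding Y_def Y1_def
        by (rule order_trans[OF gram_dani_le[OF \<rho> nd(2)] pw[OF ly' gram_nonneg]])
      have SY1: "\<delta> * Y1 \<le> S" using H \<Theta>' by (simp add: S_def Y1_def)
      have main: "X * (q * S) \<le> F * Y"
        unfolding X_def q_def S_def F_def Y_def xs using \<rho>' by (intro gram_dani_expansion) auto
      show "\<delta> / (P * P) * (((\<rho> / \<rho>')\<^sup>2) ^ min (length xs) (CARD('m)) * gram (map (dani \<Theta> \<rho>) xs)) \<le> gram (map (dani \<Theta>' \<rho>') xs)"
      proof (cases "X1 = 0")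
        case True
        then show ?thesis using nn(6) by (simp add: X1_def F_def)
      next
        case False
        then have "0 < gram (map (dani \<Theta> \<rho>) ys)"
          using nn(2) gram_pos_append[of "map (dani \<Theta> \<rho>) ys" "map (dani \<Theta> \<rho>) zs"] by (simp add: X1_def xs)
        then have "0 < Y1" by (simp add: Y1_def)
        then have "0 < P * Y" using Y1Y by linarith
        then have Y: "0 < Y" using P by (simp add: zero_less_mult_iff)
        have "(\<delta> / (P * P) * (q * X1)) * Y \<le> (\<delta> / (P * P) * (q * (P * X))) * (P * Y1)"
          using X1X YY1 \<delta> P nn by (intro mult_mono mult_left_mono) auto
        also have "\<dots> = X * (q * (\<delta> * Y1))" using P by simp
        also have "\<dots> \<le> X * (q * S)" using SY1 nn by (intro mult_left_mono) auto
        also have "\<dots> \<le> F * Y" by (rule main)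
        finally have "\<delta> / (P * P) * (q * X1) \<le> F" by (rule mult_right_le_imp_le[OF _ Y])
        then show ?thesis by (simp add: q_def X1_def F_def ly)
      qed
    qed
  qed
  moreover have "0 < \<delta> / (P * P)" using \<delta> P by simp
  ultimately show ?thesis unfolding d_def by blast
qed

text \<open>The map \<open>g\<close> of the proof inverts \<open>dani \<Theta> \<rho>\<close> and
  has operator norm at most \<open>1 + norm \<Theta> + \<rho>\<close>.\<close>

lemma gram_le_gram_dani:
  fixes xs :: "((real ^ 'n) \<times> (real ^ 'm)) list"
  assumes \<rho>: "0 < \<rho>"
  shows "gram xs \<le> ((1 + norm \<Theta> + \<rho>)\<^sup>2) ^ length xs * gram (map (dani \<Theta> \<rho>) xs)"
proof -
  define g where "g v = (fst v, \<Theta> *v fst v - \<rho> *\<^sub>R snd v)" for v :: "(real ^ 'n) \<times> (real ^ 'm)"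
  have lin: "linear g"
    by (rule linearI) (auto simp: g_def matrix_vector_right_distrib matrix_vector_mult_scaleR algebra_simps)
  have "norm (g v) \<le> (1 + norm \<Theta> + \<rho>) * norm v" for v
  proof -
    have "norm (g v) \<le> norm (fst v) + norm (\<Theta> *v fst v - \<rho> *\<^sub>R snd v)"
      unfolding g_def by (rule norm_Pair_le)
    also have "norm (\<Theta> *v fst v - \<rho> *\<^sub>R snd v) \<le> norm \<Theta> * norm (fst v) + \<rho> * norm (snd v)"
      using norm_triangle_ineq4[of "\<Theta> *v fst v" "\<rho> *\<^sub>R snd v"] norm_matrix_vector_le[of \<Theta> "fst v"] \<rho> by simp
    also have "norm (fst v) + (norm \<Theta> * norm (fst v) + \<rho> * norm (snd v)) \<le> norm v + (norm \<Theta> * norm v + \<rho> * norm v)"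
      using norm_fst_le[of "fst v" "snd v"] norm_snd_le[of "snd v" "fst v"] \<rho>
      by (intro add_mono mult_left_mono) auto
    finally show ?thesis by (simp add: algebra_simps)
  qed
  then have "gram (map g (map (dani \<Theta> \<rho>) xs)) \<le> ((1 + norm \<Theta> + \<rho>)\<^sup>2) ^ length (map (dani \<Theta> \<rho>) xs) * gram (map (dani \<Theta> \<rho>) xs)"
    using \<rho> by (intro gram_map_le lin) auto
  moreover have "map g (map (dani \<Theta> \<rho>) xs) = xs"
    using \<rho> by (simp add: g_def dani_def map_idI)
  ultimately show ?thesis by simp
qed

text \<open>As \<open>f\<close> kills \<open>ps\<close> and does not expand, each height over
  \<open>ps @ qs\<close> is at least the height of its image over the images of \<open>qs\<close>.
  Meant for block triangular maps.\<close>

lemma gram_append_ge_quotient: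
  fixes f :: "'v::euclidean_space \<Rightarrow> 'w::euclidean_space"
  assumes f: "linear f" and le: "\<And>v. norm (f v) \<le> norm v" and 0: "\<And>p. p \<in> set ps \<Longrightarrow> f p = 0"
  shows "gram ps * gram (map f qs) \<le> gram (ps @ qs)"
proof (induction qs rule: rev_induct)
  case (snoc z qs)
  have "span (f ` set (ps @ qs)) = span (f ` set qs)"
  proof
    have "f ` set (ps @ qs) \<subseteq> insert 0 (f ` set qs)" using 0 by auto
    then show "span (f ` set (ps @ qs)) \<subseteq> span (f ` set qs)" by (metis span_insert_0 span_mono)
    show "span (f ` set qs) \<subseteq> span (f ` set (ps @ qs))" by (rule span_mono) auto
  qed
  then have "infdist (f z) (span (f ` set qs)) \<le> infdist z (span (set (ps @ qs)))"
    using infdist_linear_image_le[OF f, of 1 z "set (ps @ qs)"] le by simp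
  then have "(infdist (f z) (span (f ` set qs)))\<^sup>2 \<le> (infdist z (span (set (ps @ qs))))\<^sup>2"
    by (intro power_mono) (auto simp: infdist_nonneg)
  with snoc have "(gram ps * gram (map f qs)) * (infdist (f z) (span (f ` set qs)))\<^sup>2
      \<le> gram (ps @ qs) * (infdist z (span (set (ps @ qs))))\<^sup>2"
    by (intro mult_mono[of "_ * _"]) (auto simp: gram_nonneg)
  then show ?case using gram_snoc[of "ps @ qs" z] by (simp add: gram_snoc mult.assoc)
qed simp

text \<open>\<open>dani \<Theta> \<rho>\<close> is block triangular with determinant of absolute
  value \<open>(1 / \<rho>) ^ CARD('m)\<close>, and \<open>xs\<close> spans a sublattice of the
  lattice of the standard basis \<open>ws\<close>. The vectors \<open>(0, b)\<close> come first in
  \<open>ws\<close> because \<open>fst\<close> kills their images.\<close>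

lemma gram_dani_full_rank_ge:
  fixes xs :: "((real ^ 'n) \<times> (real ^ 'm)) list"
  assumes xs: "set xs \<subseteq> integer_vectors" "0 < gram xs" "length xs = CARD('n) + CARD('m)" and \<rho>: "0 < \<rho>"
  shows "((1 / \<rho>)\<^sup>2) ^ CARD('m) \<le> gram (map (dani \<Theta> \<rho>) xs)"
proof -
  obtain es :: "(real ^ 'm) list" where es: "set es = Basis" "distinct es"
    using finite_distinct_list[OF finite_Basis] by blast
  obtain fs :: "(real ^ 'n) list" where fs: "set fs = Basis" "distinct fs"
    using finite_distinct_list[OF finite_Basis] by blast
  have le: "length es = CARD('m)" "length fs = CARD('n)"
    using es fs distinct_card[of es] distinct_card[of fs] by auto
  define ps :: "((real ^ 'n) \<times> (real ^ 'm)) list" where "ps = map (\<lambda>b. (0, b)) es"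
  define qs :: "((real ^ 'n) \<times> (real ^ 'm)) list" where "qs = map (\<lambda>b. (b, 0)) fs"
  define ws where "ws = ps @ qs"
  have setw: "set ws = Basis" by (auto simp: ws_def ps_def qs_def es fs Basis_prod_def)
  have lenw: "length ws = CARD('n) + CARD('m)" by (simp add: ws_def ps_def qs_def le)
  have distw: "distinct ws"
    using es fs by (auto simp: ws_def ps_def qs_def distinct_map inj_on_def)
  have on: "gram us = 1" if "set us \<subseteq> Basis" "distinct us" for us :: "'e::euclidean_space list"
  proof (rule gram_orthonormal)
    fix i j assume "i < length us" "j < length us"
    moreover from this have "us ! i \<in> Basis" "us ! j \<in> Basis" using that(1) by auto
    ultimately show "us ! i \<bullet> us ! j = (if i = j then 1 else 0)"
      using that(2) by (simp add: inner_Basis nth_eq_iff_index_eq)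
  qed
  have gl: "generates_lattice ws"
    unfolding generates_lattice_def
  proof
    fix z :: "(real ^ 'n) \<times> (real ^ 'm)" assume "z \<in> integer_vectors \<inter> span (set ws)"
    then have z: "z \<bullet> b \<in> \<int>" if "b \<in> Basis" for b using that by (auto simp: integer_vectors_def)
    have "z = (\<Sum>b\<in>set ws. (z \<bullet> b) *\<^sub>R b)" unfolding setw by (simp add: euclidean_representation)
    also have "\<dots> = (\<Sum>b\<in>set ws. of_int \<lfloor>z \<bullet> b\<rfloor> *\<^sub>R b)"
      by (rule sum.cong) (use z setw in auto)
    also have "\<dots> = (\<Sum>j<length ws. of_int \<lfloor>z \<bullet> (ws ! j)\<rfloor> *\<^sub>R (ws ! j))"
      using distw by (intro sum.reindex_bij_betw[symmetric, OF bij_betw_nth]) auto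
    finally show "\<exists>c :: nat \<Rightarrow> int. z = (\<Sum>j<length ws. of_int (c j) *\<^sub>R (ws ! j))"
      by (rule exI[of _ "\<lambda>j. \<lfloor>z \<bullet> (ws ! j)\<rfloor>"])
  qed
  have "((1 / \<rho>)\<^sup>2) ^ CARD('m) = gram (map (dani \<Theta> \<rho>) ps) * gram (map fst (map (dani \<Theta> \<rho>) qs))"
  proof -
    have "map (dani \<Theta> \<rho>) ps = map (\<lambda>v. (- 1 / \<rho>) *\<^sub>R v) ps" by (simp add: ps_def dani_def)
    then have "gram (map (dani \<Theta> \<rho>) ps) = ((- 1 / \<rho>)\<^sup>2) ^ length ps * gram ps" using gram_scale by metis
    moreover have "gram ps = 1" using es by (intro on) (auto simp: ps_def Basis_prod_def distinct_map inj_on_def)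
    moreover have "map fst (map (dani \<Theta> \<rho>) qs) = fs" by (simp add: qs_def dani_def map_idI)
    moreover have "gram fs = 1" using fs by (intro on) auto
    ultimately show ?thesis by (simp add: ps_def le power2_eq_square)
  qed
  also have "\<dots> \<le> gram (map (dani \<Theta> \<rho>) ps @ map (dani \<Theta> \<rho>) qs)"
    by (intro gram_append_ge_quotient linear_fst) (auto simp: norm_fst_le ps_def dani_def)
  also have "\<dots> = gram (map (dani \<Theta> \<rho>) ws)" by (simp add: ws_def)
  also have "\<dots> \<le> gram (map (dani \<Theta> \<rho>) xs)"
  proof (rule gram_map_lattice_basis_le[OF linear_dani gl xs(1,2)])
    have "0 < gram ws" using on[of ws] setw distw by simp
    then show "span (set xs) = span (set ws)"
      using xs lenw setw by (intro span_eq_if_length_eq) auto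
  qed (simp add: lenw xs(3))
  finally show ?thesis .
qed

text \<open>In rank \<open>n + m\<close> the power of \<open>r\<close> is
  \<open>r ^ (2 * CARD('m))\<close>, which cancels the squared determinant of
  \<open>dani \<Theta> r\<close>. The exponent is linear in the rank, so submodularity survives the
  normalisation.\<close>

definition covol :: "real ^ 'n ^ 'm \<Rightarrow> real \<Rightarrow> ((real ^ 'n) \<times> (real ^ 'm)) list \<Rightarrow> real" where
  "covol \<Theta> r xs = r powr (2 * CARD('m) / (CARD('n) + CARD('m)) * length xs) * gram (map (dani \<Theta> r) xs)"

text \<open>The lower bound is logarithmically convex in the rank, and equals 1 in the ranks 0 and
  \<open>n + m\<close>, in which the covolumes are bounded below for free.\<close>
definition covol_bound :: "real \<Rightarrow> real ^ 'n ^ 'm \<Rightarrow> real \<Rightarrow> bool" where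
  "covol_bound K c r \<longleftrightarrow> (\<forall>\<Theta>\<in>cball c r. \<forall>xs :: ((real ^ 'n) \<times> (real ^ 'm)) list.
     set xs \<subseteq> integer_vectors \<and> 0 < gram xs \<longrightarrow>
     exp (- K * (real (length xs) * (real (CARD('n) + CARD('m)) - real (length xs)))) \<le> covol \<Theta> r xs)"

lemma length_le_if_gram_pos:
  fixes xs :: "((real ^ 'n) \<times> (real ^ 'm)) list"
  assumes "0 < gram xs"
  shows "length xs \<le> CARD('n) + CARD('m)"
  using dim_span_list[OF assms] dim_subset_UNIV[of "span (set xs)"] by simp

lemma covol_nonneg: "0 \<le> covol \<Theta> r xs"
  by (simp add: covol_def gram_nonneg)

lemma covol_Nil: "0 < r \<Longrightarrow> covol \<Theta> r [] = 1"
  by (simp add: covol_def)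

lemma covol_full_rank_ge:
  fixes xs :: "((real ^ 'n) \<times> (real ^ 'm)) list"
  assumes xs: "set xs \<subseteq> integer_vectors" "0 < gram xs" "length xs = CARD('n) + CARD('m)" and r: "0 < r"
  shows "1 \<le> covol \<Theta> r xs"
proof -
  have nz: "real (CARD('n)) + real (CARD('m)) \<noteq> 0" by (simp add: add_nonneg_eq_0_iff)
  have "r powr (2 * CARD('m) / (CARD('n) + CARD('m)) * length xs) = r powr real (2 * CARD('m))"
    using xs(3) nz by simp
  also have "\<dots> = (r\<^sup>2) ^ CARD('m)" using r by (simp only: powr_realpow power_mult)
  finally have eq: "r powr (2 * CARD('m) / (CARD('n) + CARD('m)) * length xs) = (r\<^sup>2) ^ CARD('m)" .
  have "1 = (r\<^sup>2) ^ CARD('m) * ((1 / r)\<^sup>2) ^ CARD('m)"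
    using r by (simp add: power_one_over flip: power_mult_distrib)
  also have "\<dots> \<le> (r\<^sup>2) ^ CARD('m) * gram (map (dani \<Theta> r) xs)"
    using gram_dani_full_rank_ge[OF xs r] by (intro mult_left_mono) auto
  finally show ?thesis unfolding covol_def eq .
qed

lemma same_span_lincomb:
  fixes xs ys :: "'v::euclidean_space list"
  assumes "span (set xs) = span (set ys)" "length xs = length ys"
  obtains A where "A \<in> carrier_mat (length ys) (length ys)"
    "\<And>i. i < length ys \<Longrightarrow> xs ! i = (\<Sum>j<length ys. (A $$ (i, j)) *\<^sub>R (ys ! j))"
proof -
  have "\<exists>c. xs ! i = (\<Sum>j<length ys. c j *\<^sub>R (ys ! j))" if "i < length ys" for i
  proof -
    have "xs ! i \<in> span (set xs)" using that assms(2) by (intro span_base) simp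
    then have "xs ! i \<in> span (set ys)" using assms(1) by simp
    from span_list_lincomb[OF this] show ?thesis by blast
  qed
  then obtain c where c: "\<And>i. i < length ys \<Longrightarrow> xs ! i = (\<Sum>j<length ys. c i j *\<^sub>R (ys ! j))" by metis
  show ?thesis
    by (rule that[of "Matrix.mat (length ys) (length ys) (\<lambda>(i, j). c i j)"]) (auto simp: c)
qed

text \<open>Two sublattices of the same rank that both nearly violate the bound would, by
  submodularity, violate it at their intersection or at their sum.\<close>
lemma dangerous_span_unique:
  fixes xs ys :: "((real ^ 'n) \<times> (real ^ 'm)) list"
  assumes inv: "covol_bound K c r" and r: "0 < r"
    and C: "1 \<le> C" "ln C \<le> K"
    and xs: "set xs \<subseteq> integer_vectors" "0 < gram xs" "length xs = j"
      "covol c r xs < C * exp (- K * (real j * (real (CARD('n) + CARD('m)) - real j)))"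
    and ys: "set ys \<subseteq> integer_vectors" "0 < gram ys" "length ys = j"
      "covol c r ys < C * exp (- K * (real j * (real (CARD('n) + CARD('m)) - real j)))"
  shows "span (set xs) = span (set ys)"
proof (rule ccontr)
  assume neq: "span (set xs) \<noteq> span (set ys)"
  show False
  proof (rule gram_lattice_submodular[OF xs(1-3) ys(1-3) neq])
    fix us ws :: "((real ^ 'n) \<times> (real ^ 'm)) list" and i assume i: "i < j"
      and us: "set us \<subseteq> integer_vectors" "0 < gram us" "length us = i"
      and ws: "set ws \<subseteq> integer_vectors" "0 < gram ws" "length ws = 2 * j - i"
      and sub: "\<And>f :: (real ^ 'n) \<times> (real ^ 'm) \<Rightarrow> (real ^ 'n) \<times> (real ^ 'm). linear f \<Longrightarrow>
        gram (map f us) * gram (map f ws) \<le> gram (map f xs) * gram (map f ys)"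
    define d where "d = real (CARD('n) + CARD('m))"
    define a where "a = 2 * real (CARD('m)) / real (CARD('n) + CARD('m))"
    define h where "h t = t * (d - t)" for t :: real
    have cv: "covol c r zs = r powr (a * length zs) * gram (map (dani c r) zs)" for zs :: "((real ^ 'n) \<times> (real ^ 'm)) list"
      by (simp add: covol_def a_def)
    have lw: "real (length ws) = 2 * real j - real i" using ws(3) i by simp
    have "c \<in> cball c r" using r by simp
    then have bu: "exp (- K * h i) \<le> covol c r us" and bw: "exp (- K * h (2 * real j - real i)) \<le> covol c r ws"
      using inv us ws lw unfolding covol_bound_def h_def d_def by (metis, metis)
    have "exp (- K * h i) * exp (- K * h (2 * real j - real i)) \<le> covol c r us * covol c r ws"
      using bu bw by (intro mult_mono) (auto simp: covol_nonneg)
    also have "\<dots> = r powr (a * i + a * (2 * real j - real i)) * (gram (map (dani c r) us) * gram (map (dani c r) ws))"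
      unfolding cv us(3) lw by (simp add: powr_add)
    also have "\<dots> \<le> r powr (a * i + a * (2 * real j - real i)) * (gram (map (dani c r) xs) * gram (map (dani c r) ys))"
      using sub[OF linear_dani] by (intro mult_left_mono) auto
    also have "a * i + a * (2 * real j - real i) = a * j + a * j" by (simp add: algebra_simps)
    also have "r powr (a * j + a * j) * (gram (map (dani c r) xs) * gram (map (dani c r) ys)) = covol c r xs * covol c r ys"
      unfolding cv xs(3) ys(3) powr_add by (simp only: mult_ac)
    also have "\<dots> < (C * exp (- K * h j)) * (C * exp (- K * h j))"
      using xs(4) ys(4) by (intro mult_strict_mono') (auto simp: covol_nonneg h_def d_def)
    also have "\<dots> = C * C * exp (- K * h j + - K * h j)" unfolding exp_add by simp
    finally have lt: "exp (- K * h i + - K * h (2 * real j - real i)) < C * C * exp (- K * h j + - K * h j)"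
      by (simp only: exp_add)
    define s where "s = real j - real i"
    have s: "1 \<le> s" using i by (simp add: s_def)
    have K: "0 \<le> K" using C ln_ge_zero[of C] by linarith
    \<comment> \<open>Strict concavity of \<open>h\<close>: its second difference with step
      \<open>s\<close> yields the factor \<open>exp (2 * K * s\<^sup>2)\<close>, which is at least
      \<open>exp (2 * K)\<close> and hence at least \<open>C * C\<close>.\<close>
    have "h i + h (2 * real j - real i) = h j + h j - 2 * s\<^sup>2"
      by (simp add: h_def s_def power2_eq_square algebra_simps)
    then have "- K * (h i + h (2 * real j - real i)) = - K * (h j + h j - 2 * s\<^sup>2)" by (simp only:)
    then have "- K * h i + - K * h (2 * real j - real i) = 2 * K * s\<^sup>2 + (- K * h j + - K * h j)"
      by (simp add: algebra_simps)
    then have "exp (2 * K * s\<^sup>2) * exp (- K * h j + - K * h j) < C * C * exp (- K * h j + - K * h j)"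
      using lt by (simp only: exp_add[symmetric])
    then have "exp (2 * K * s\<^sup>2) < C * C" by simp
    moreover have "C * C \<le> exp (2 * K * s\<^sup>2)"
    proof -
      have "1 \<le> s\<^sup>2" using s by (simp add: one_le_power)
      then have "2 * K * 1 \<le> 2 * K * s\<^sup>2" using K by (intro mult_left_mono) auto
      moreover have "C * C = exp (ln C + ln C)" unfolding exp_add using C(1) by simp
      ultimately show ?thesis using C(2) by simp
    qed
    ultimately show False by linarith
  qed
qed

text \<open>What a lattice left alone can lose in a stage: the power of \<open>r\<close> loses at
  most \<open>s ^ (2 * CARD('m))\<close>, moving \<Theta> at scale \<open>r\<close> at most
  \<open>9 ^ (CARD('n) + CARD('m))\<close>, and shrinking the radius only enlarges the Gram
  determinant.\<close>

lemma covol_ge_if_safe: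
  fixes xs :: "((real ^ 'n) \<times> (real ^ 'm)) list"
  assumes gr: "0 < gram xs" and r': "0 < r'" "r' \<le> r" "s * r \<le> r'" and s: "0 < s" "s \<le> 1" and dist: "norm (c - \<Theta>) \<le> 2 * r"
  shows "s ^ (2 * CARD('m)) / 9 ^ (CARD('n) + CARD('m)) * covol c r xs \<le> covol \<Theta> r' xs"
proof -
  define a where "a = 2 * real (CARD('m)) / real (CARD('n) + CARD('m)) * real (length xs)"
  define g where "g = gram (map (dani c r) xs)"
  define g' where "g' = gram (map (dani \<Theta> r') xs)"
  define P :: real where "P = 9 ^ (CARD('n) + CARD('m))"
  have len: "length xs \<le> CARD('n) + CARD('m)" by (rule length_le_if_gram_pos[OF gr])
  have r: "0 < r" using r' by linarith
  have a: "0 \<le> a" "a \<le> real (2 * CARD('m))"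
  proof -
    have "a = real (2 * CARD('m)) * (real (length xs) / real (CARD('n) + CARD('m)))" by (simp add: a_def)
    also have "\<dots> \<le> real (2 * CARD('m)) * 1" using len by (intro mult_left_mono) (auto simp: divide_le_eq_1)
    finally show "a \<le> real (2 * CARD('m))" by simp
  qed (simp add: a_def)
  have nn: "0 \<le> g" "0 \<le> g'" by (auto simp: g_def g'_def gram_nonneg)
  have P: "0 < P" by (simp add: P_def)
  have "g \<le> 9 ^ length xs * gram (map (dani \<Theta> r) xs)" unfolding g_def by (rule gram_dani_le[OF r dist])
  also have "\<dots> \<le> P * g'"
    unfolding P_def g'_def using len gram_dani_radius_mono[OF r'(1,2)]
    by (intro mult_mono power_increasing) (auto simp: gram_nonneg)
  finally have gg: "g / P \<le> g'" using P by (simp add: pos_divide_le_eq mult.commute)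
  have "s ^ (2 * CARD('m)) = s powr real (2 * CARD('m))" using s by (simp only: powr_realpow)
  also have "\<dots> \<le> s powr a" using a s by (intro powr_mono') auto
  finally have "s ^ (2 * CARD('m)) * r powr a \<le> s powr a * r powr a" by (intro mult_right_mono) auto
  also have "\<dots> = (s * r) powr a" using s r by (simp add: powr_mult)
  also have "\<dots> \<le> r' powr a" using r' s r a by (intro powr_mono2) auto
  finally have "(s ^ (2 * CARD('m)) * r powr a) * (g / P) \<le> r' powr a * g'"
    using gg nn P s by (intro mult_mono) auto
  then show ?thesis by (simp add: covol_def a_def g_def g'_def P_def mult_ac)
qed

text \<open>The net exponent \<open>2 \<mu> - 2 m j / d\<close> equals \<open>2 n j / d\<close> for
  \<open>j \<le> m\<close> and \<open>2 m (d - j) / d\<close> otherwise, hence is at least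
  \<open>2 / d\<close>. A ratio of radii of at least \<open>t0\<close> therefore outweighs
  \<open>\<delta>\<close>.\<close>

lemma covol_ge_if_expanded:
  fixes xs :: "((real ^ 'n) \<times> (real ^ 'm)) list"
  assumes len: "0 < length xs" "length xs < CARD('n) + CARD('m)" and r': "0 < r'" and r: "r' \<le> r" "t0 \<le> r / r'"
    and t0: "0 < t0" "1 \<le> \<delta> * t0 powr (2 / real (CARD('n) + CARD('m)))" and \<delta>: "0 < \<delta>"
    and ex: "\<delta> * (((r / r')\<^sup>2) ^ min (length xs) (CARD('m)) * gram (map (dani c r) xs)) \<le> gram (map (dani \<Theta> r') xs)"
  shows "covol c r xs \<le> covol \<Theta> r' xs"
proof -
  define d where "d = real (CARD('n) + CARD('m))"
  define j where "j = real (length xs)"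
  define a where "a = 2 * real (CARD('m)) / d * j"
  define \<mu> where "\<mu> = min (length xs) (CARD('m))"
  define t where "t = r / r'"
  have d: "0 < d" unfolding d_def by (simp only: of_nat_0_less_iff) simp
  have t: "1 \<le> t" using r r' by (simp add: t_def)
  have e: "2 / d \<le> 2 * real \<mu> - a"
  proof -
    have "1 \<le> d * real \<mu> - real (CARD('m)) * j"
    proof (cases "length xs \<le> CARD('m)")
      case True
      then have "d * real \<mu> - real (CARD('m)) * j = real (CARD('n) * length xs)"
        by (simp add: \<mu>_def d_def j_def algebra_simps)
      moreover have "1 \<le> CARD('n) * length xs" using len by (simp add: Suc_le_eq)
      then have "real 1 \<le> real (CARD('n) * length xs)" by (rule of_nat_mono)
      ultimately show ?thesis by (simp only: of_nat_1)
    next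
      case False
      then have "d * real \<mu> - real (CARD('m)) * j = real (CARD('m)) * (d - j)"
        by (simp add: \<mu>_def algebra_simps)
      also have "d - j = real (CARD('n) + CARD('m) - length xs)" using len by (simp add: d_def j_def of_nat_diff)
      also have "real (CARD('m)) * \<dots> = real (CARD('m) * (CARD('n) + CARD('m) - length xs))" by simp
      finally have "d * real \<mu> - real (CARD('m)) * j = real (CARD('m) * (CARD('n) + CARD('m) - length xs))" .
      moreover have "1 \<le> CARD('m) * (CARD('n) + CARD('m) - length xs)" using len by (simp add: Suc_le_eq)
      then have "real 1 \<le> real (CARD('m) * (CARD('n) + CARD('m) - length xs))" by (rule of_nat_mono)
      ultimately show ?thesis by (simp only: of_nat_1)
    qed
    moreover have "2 * real \<mu> - a = 2 * (d * real \<mu> - real (CARD('m)) * j) / d"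
      using d by (simp add: a_def field_simps)
    ultimately show ?thesis using d by (simp add: divide_le_cancel)
  qed
  have "1 \<le> \<delta> * t0 powr (2 / d)" using t0 by (simp add: d_def)
  also have "\<dots> \<le> \<delta> * t powr (2 / d)" using r t0 \<delta> d by (intro mult_left_mono powr_mono2) (auto simp: t_def)
  also have "\<dots> \<le> \<delta> * t powr (2 * real \<mu> - a)" using t e \<delta> by (intro mult_left_mono powr_mono) auto
  finally have "1 * covol c r xs \<le> \<delta> * t powr (2 * real \<mu> - a) * covol c r xs"
    by (intro mult_right_mono covol_nonneg)
  also have "\<dots> = r' powr a * (\<delta> * ((t\<^sup>2) ^ \<mu> * gram (map (dani c r) xs)))"
  proof -
    have e1: "(t\<^sup>2) ^ \<mu> = t powr (2 * real \<mu>)"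
      using t powr_realpow[of t "2 * \<mu>"] by (simp add: power_mult)
    have e2: "r powr a = t powr a * r' powr a" using t r' by (simp add: t_def flip: powr_mult)
    have e3: "t powr (2 * real \<mu> - a) * t powr a = t powr (2 * real \<mu>)" by (simp flip: powr_add)
    have e4: "covol c r xs = r powr a * gram (map (dani c r) xs)" by (simp add: covol_def a_def d_def j_def)
    show ?thesis unfolding e1 e4 e2 e3[symmetric] by (simp only: mult_ac)
  qed
  also have "\<dots> \<le> r' powr a * gram (map (dani \<Theta> r') xs)"
    using ex by (intro mult_left_mono) (auto simp: t_def \<mu>_def)
  also have "\<dots> = covol \<Theta> r' xs" by (simp add: covol_def a_def d_def j_def)
  finally show ?thesis by simp
qed

lemma gram_snd_dani_pos:
  fixes q :: "((real ^ 'n) \<times> (real ^ 'm)) list"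
  assumes "0 < \<rho>" "0 < gram (map (\<lambda>v. snd (dani \<Theta> \<rho> v)) q)"
  shows "0 < gram (map (\<lambda>v. snd (dani \<Theta> 1 v)) q)"
proof -
  have "map (\<lambda>v. snd (dani \<Theta> 1 v)) q = map (\<lambda>w. \<rho> *\<^sub>R w) (map (\<lambda>v. snd (dani \<Theta> \<rho> v)) q)"
    using assms(1) by (simp add: dani_def)
  then show ?thesis using assms by (simp only: gram_scale) simp
qed

text \<open>One stage takes a radius in \<open>[\<beta> * X, X]\<close> to one in
  \<open>[\<beta> * (R * X), R * X]\<close>, restores the bound and gains transversality to
  \<open>q\<close>. One subspace per rank is selected at the start of the stage and brought into
  general position; then the radius is shrunk. \<open>R\<close> and \<open>K0\<close> precede
  \<open>K\<close> and all balls.\<close>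

lemma forces_next_stage:
  assumes \<beta>: "0 < \<beta>" "\<beta> < 1"
  shows "\<exists>R K0. 0 < R \<and> R < \<beta> \<and> 0 \<le> K0 \<and> (\<forall>K (c :: real ^ 'n ^ 'm) r X q. K0 \<le> K \<longrightarrow> 0 < X \<longrightarrow> \<beta> * X \<le> r \<longrightarrow> r \<le> X \<longrightarrow>
     covol_bound K c r \<longrightarrow> length q = CARD('m) \<longrightarrow> 0 < gram q \<longrightarrow>
     (\<exists>k. forces \<beta> k (\<lambda>c' r'. \<beta> * (R * X) \<le> r' \<and> r' \<le> R * X \<and> covol_bound K c' r' \<and>
        (\<forall>\<Theta>\<in>cball c' r'. gram (map (\<lambda>v. snd (dani \<Theta> 1 v)) q) \<noteq> 0)) c r))"
proof -
  define m where "m = CARD('m)"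
  define d where "d = CARD('n) + CARD('m)"
  have d0: "0 < d" and md: "m \<le> d" by (auto simp: d_def m_def)
  obtain N1 \<delta>1 where \<delta>1: "0 < \<delta>1" and N1: "\<And>(xs :: ((real ^ 'n) \<times> (real ^ 'm)) list) \<Theta> \<rho>. length xs \<le> d \<Longrightarrow> 0 < \<rho> \<Longrightarrow>
     forces \<beta> N1 (\<lambda>c r. \<forall>\<Theta>'\<in>cball c r. \<forall>\<rho>'. 0 < \<rho>' \<and> \<rho>' \<le> \<rho> \<longrightarrow>
        \<delta>1 * (((\<rho> / \<rho>')\<^sup>2) ^ min (length xs) m * gram (map (dani \<Theta> \<rho>) xs)) \<le> gram (map (dani \<Theta>' \<rho>') xs)) \<Theta> \<rho>"
    using forces_dani_expansion[OF \<beta>, where 'n = 'n and 'm = 'm] unfolding d_def m_def by blast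
  obtain N2 \<delta>2 where \<delta>2: "0 < \<delta>2" and N2: "\<And>(xs :: ((real ^ 'n) \<times> (real ^ 'm)) list) \<Theta> \<rho>. length xs \<le> m \<Longrightarrow> 0 < \<rho> \<Longrightarrow>
     forces \<beta> N2 (\<lambda>c r. \<forall>\<Theta>'\<in>cball c r. \<delta>2 * gram (map (dani \<Theta> \<rho>) xs) \<le> gram (map (\<lambda>v. snd (dani \<Theta>' \<rho> v)) xs)) \<Theta> \<rho>"
    using forces_transversal[OF \<beta>, where 'n = 'n and 'm = 'm] unfolding m_def by blast
  define N where "N = max N1 N2"
  \<comment> \<open>The worst loss of radius while the \<open>d\<close> tasks of a stage are carried
    out.\<close>
  define \<kappa> where "\<kappa> = \<beta> ^ (d * N)"
  have \<kappa>: "0 < \<kappa>" "\<kappa> \<le> 1" using \<beta> by (auto simp: \<kappa>_def power_le_one)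
  define P :: real where "P = 9 ^ d"
  have P: "1 \<le> P" "0 < P" by (auto simp: P_def)
  \<comment> \<open>Forcing for one rank starts from a later ball with
    \<open>r1 \<ge> \<kappa> * r\<close>; referring it back to the start of the stage costs at most
    \<open>(\<kappa>\<^sup>2) ^ d\<close> for the radius and \<open>P\<close> for the
    centre.\<close>
  define \<delta> where "\<delta> = \<delta>1 * (\<kappa>\<^sup>2) ^ d / P"
  have \<delta>: "0 < \<delta>" using \<delta>1 \<kappa> P by (simp add: \<delta>_def)
  \<comment> \<open>\<open>R \<le> \<kappa>\<close> keeps the new window reachable after the tasks,
    \<open>R \<le> \<beta> / 2\<close> separates the windows of consecutive stages, and the last
    term gives \<open>\<delta> * (\<beta> / R) powr (2 / real d) \<ge> 1\<close>, so that expansion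
    beats \<open>\<delta>\<close>.\<close>
  define R where "R = min (min \<kappa> (\<beta> / 2)) (\<beta> * \<delta> powr (real d / 2))"
  have R0: "0 < R" using \<beta> \<kappa> \<delta> by (simp add: R_def)
  have "R \<le> min \<kappa> (\<beta> / 2)" unfolding R_def by (rule min.cobounded1)
  then have "R \<le> \<kappa>" "R \<le> \<beta> / 2" by simp_all
  then have R: "0 < R" "R \<le> \<kappa>" "R < \<beta>" "R \<le> \<beta> * \<delta> powr (real d / 2)"
    using R0 \<beta> by (simp_all add: R_def)
  have t0: "1 \<le> \<delta> * (\<beta> / R) powr (2 / real d)"
  proof -
    have "\<delta> powr (- (real d / 2)) \<le> \<beta> / R"
      using R \<delta> by (simp add: powr_minus field_simps)
    then have "(\<delta> powr (- (real d / 2))) powr (2 / real d) \<le> (\<beta> / R) powr (2 / real d)"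
      using d0 by (intro powr_mono2) auto
    also have "(\<delta> powr (- (real d / 2))) powr (2 / real d) = 1 / \<delta>"
    proof -
      have "- (real d / 2) * (2 / real d) = - 1" using d0 by simp
      then show ?thesis unfolding powr_powr using \<delta> by (simp add: powr_neg_one)
    qed
    finally show ?thesis using \<delta> by (simp add: field_simps)
  qed
  \<comment> \<open>A lower bound for the ratio of the radii at the end and at the start of a
    stage.\<close>
  define s where "s = \<beta> * R"
  have s: "0 < s" "s \<le> 1" using \<beta> R by (auto simp: s_def intro!: mult_le_one)
  \<comment> \<open>The reciprocal of the loss in \<open>covol_ge_if_safe\<close>: a lattice above
    the bound by this factor is safe for one stage.\<close>
  define C where "C = P / s ^ (2 * m)"
  have C: "1 \<le> C"
  proof -
    have "s ^ (2 * m) \<le> 1" using s by (intro power_le_one) auto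
    then have "s ^ (2 * m) \<le> P" using P by linarith
    then show ?thesis using s by (simp add: C_def)
  qed
  have stage: "\<exists>k. forces \<beta> k (\<lambda>c' r'. \<beta> * (R * X) \<le> r' \<and> r' \<le> R * X \<and> covol_bound K c' r' \<and>
        (\<forall>\<Theta>\<in>cball c' r'. gram (map (\<lambda>v. snd (dani \<Theta> 1 v)) q) \<noteq> 0)) c r"
    if K: "ln C \<le> K" and X: "0 < X" "\<beta> * X \<le> r" "r \<le> X" and inv: "covol_bound K c r"
      and q: "length q = m" "0 < gram q"
    for K X r :: real and c :: "real ^ 'n ^ 'm" and q
  proof -
    have "0 < \<beta> * X" using \<beta> X by simp
    then have r: "0 < r" using X by linarith
    define bd where "bd j = exp (- K * (real j * (real d - real j)))" for j
    define dangerous where "dangerous j xs \<longleftrightarrow> set xs \<subseteq> integer_vectors \<and> 0 < gram xs \<and> length xs = j \<and> covol c r xs < C * bd j" for j xs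
    \<comment> \<open>By \<open>dangerous_span_unique\<close> one representative stands for all
      dangerous lists of a rank \<open>j\<close>. The default \<open>[]\<close> keeps the length at
      most \<open>d\<close>, so the forcing applies in every case.\<close>
    define D where "D j = (if \<exists>xs. dangerous j xs then SOME xs. dangerous j xs else [])" for j
    have D: "dangerous j (D j)" if "dangerous j xs" for j xs
      using that someI[of "dangerous j"] by (auto simp: D_def)
    have lenD: "length (D j) \<le> d" for j
    proof (cases "\<exists>xs. dangerous j xs")
      case True
      then have "0 < gram (D j)" using D by (auto simp: dangerous_def)
      then show ?thesis unfolding d_def by (rule length_le_if_gram_pos)
    qed (simp add: D_def)
    define Qq where "Qq c' r' \<longleftrightarrow> (\<forall>\<Theta>\<in>cball c' r'. gram (map (\<lambda>v. snd (dani \<Theta> 1 v)) q) \<noteq> 0)" for c' and r' :: real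
    define QD where "QD j c' r' \<longleftrightarrow> (\<forall>\<Theta>\<in>cball c' r'. \<forall>\<rho>'. 0 < \<rho>' \<and> \<rho>' \<le> r' \<longrightarrow>
        \<delta> * (((r / \<rho>')\<^sup>2) ^ min (length (D j)) m * gram (map (dani c r) (D j))) \<le> gram (map (dani \<Theta> \<rho>') (D j)))" for j c' r'
    \<comment> \<open>Rank 0 holds no danger, so slot 0 is free for \<open>q\<close>; the slots from
      1 to \<open>d - 1\<close> treat the dangerous subspaces.\<close>
    define Q where "Q j = (if j = 0 then Qq else QD j)" for j
    have "forces \<beta> (d * N) (\<lambda>c' r'. \<forall>i<d. Q i c' r') c r"
    proof (rule forces_conj[OF \<beta> r])
      show "Q i c'' r''" if "Q i c' r'" "0 < r''" "r'' \<le> r'" "cball c'' r'' \<subseteq> cball c' r'" for i c' r' c'' r''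
        using that by (cases "i = 0") (auto simp: Q_def Qq_def QD_def)
    next
      fix i c1 r1 assume r1: "\<beta> ^ (d * N) * r \<le> r1" "r1 \<le> r" and sub: "cball c1 r1 \<subseteq> cball c r"
      have \<kappa>r: "\<kappa> * r \<le> r1" using r1 by (simp add: \<kappa>_def)
      moreover have "0 < \<kappa> * r" using \<kappa> r by simp
      ultimately have r10: "0 < r1" by linarith
      show "forces \<beta> N (Q i) c1 r1"
      proof (cases "i = 0")
        case True
        have "forces \<beta> N2 (\<lambda>c r. \<forall>\<Theta>'\<in>cball c r. \<delta>2 * gram (map (dani c1 r1) q) \<le> gram (map (\<lambda>v. snd (dani \<Theta>' r1 v)) q)) c1 r1"
          using q(1) r10 by (intro N2) auto
        then have "forces \<beta> N2 Qq c1 r1"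
        proof (rule forces_weaken[OF _ \<beta> r10])
          fix c' r' assume H: "\<forall>\<Theta>'\<in>cball c' r'. \<delta>2 * gram (map (dani c1 r1) q) \<le> gram (map (\<lambda>v. snd (dani \<Theta>' r1 v)) q)"
          have "0 < gram (map (dani c1 r1) q)"
          proof (rule ccontr)
            assume "\<not> 0 < gram (map (dani c1 r1) q)"
            then have "gram (map (dani c1 r1) q) = 0" using gram_nonneg[of "map (dani c1 r1) q"] by linarith
            then show False using gram_le_gram_dani[OF r10, of q c1] q(2) by simp
          qed
          then have "0 < \<delta>2 * gram (map (dani c1 r1) q)" using \<delta>2 by simp
          then have "0 < gram (map (\<lambda>v. snd (dani \<Theta> r1 v)) q)" if "\<Theta> \<in> cball c' r'" for \<Theta>
            using H that by fastforce
          from gram_snd_dani_pos[OF r10 this] show "Qq c' r'" unfolding Qq_def by fastforce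
        qed
        then have "forces \<beta> N Qq c1 r1" by (rule forces_mono) (simp add: N_def)
        then show ?thesis using True by (simp add: Q_def)
      next
        case False
        define g where "g = gram (map (dani c r) (D i))"
        define g1 where "g1 = gram (map (dani c1 r1) (D i))"
        define \<mu> where "\<mu> = min (length (D i)) m"
        have nn: "0 \<le> g" "0 \<le> g1" by (auto simp: g_def g1_def gram_nonneg)
        have gg1: "g / P \<le> g1"
        proof -
          have "c1 \<in> cball c1 r1" using r10 by simp
          then have "c1 \<in> cball c r" using sub by blast
          then have "norm (c - c1) \<le> 2 * r" using r by (simp add: dist_norm)
          from gram_dani_le[OF r this] have "g \<le> 9 ^ length (D i) * gram (map (dani c1 r) (D i))" by (simp add: g_def)
          also have "\<dots> \<le> P * g1" unfolding P_def g1_def using lenD[of i] gram_dani_radius_mono[OF r10 r1(2)]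
            by (intro mult_mono power_increasing) (auto simp: gram_nonneg)
          finally show ?thesis using P by (simp add: pos_divide_le_eq mult.commute)
        qed
        have "forces \<beta> N1 (\<lambda>c r. \<forall>\<Theta>'\<in>cball c r. \<forall>\<rho>'. 0 < \<rho>' \<and> \<rho>' \<le> r1 \<longrightarrow>
            \<delta>1 * (((r1 / \<rho>')\<^sup>2) ^ \<mu> * g1) \<le> gram (map (dani \<Theta>' \<rho>') (D i))) c1 r1"
          unfolding \<mu>_def g1_def using lenD r10 by (intro N1) auto
        then have "forces \<beta> N1 (QD i) c1 r1"
        proof (rule forces_weaken[OF _ \<beta> r10])
          fix c' r' assume H: "\<forall>\<Theta>'\<in>cball c' r'. \<forall>\<rho>'. 0 < \<rho>' \<and> \<rho>' \<le> r1 \<longrightarrow>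
              \<delta>1 * (((r1 / \<rho>')\<^sup>2) ^ \<mu> * g1) \<le> gram (map (dani \<Theta>' \<rho>') (D i))" and r': "r' \<le> r1"
          have "\<delta> * (((r / \<rho>')\<^sup>2) ^ \<mu> * g) \<le> gram (map (dani \<Theta> \<rho>') (D i))"
            if "\<Theta> \<in> cball c' r'" "0 < \<rho>'" "\<rho>' \<le> r'" for \<Theta> \<rho>'
          proof -
            have "(\<kappa>\<^sup>2) ^ d * ((r / \<rho>')\<^sup>2) ^ \<mu> \<le> (\<kappa>\<^sup>2) ^ \<mu> * ((r / \<rho>')\<^sup>2) ^ \<mu>"
              using \<kappa> md by (intro mult_right_mono power_decreasing) (auto simp: \<mu>_def power_le_one)
            also have "\<dots> = ((\<kappa> * r / \<rho>')\<^sup>2) ^ \<mu>" by (simp add: power_mult_distrib power_divide)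
            also have "\<dots> \<le> ((r1 / \<rho>')\<^sup>2) ^ \<mu>"
              using \<kappa>r \<kappa> r that by (intro power_mono divide_right_mono) auto
            finally have "((\<kappa>\<^sup>2) ^ d * ((r / \<rho>')\<^sup>2) ^ \<mu>) * (g / P) \<le> ((r1 / \<rho>')\<^sup>2) ^ \<mu> * g1"
              using gg1 nn P by (intro mult_mono) auto
            then have "\<delta>1 * (((\<kappa>\<^sup>2) ^ d * ((r / \<rho>')\<^sup>2) ^ \<mu>) * (g / P)) \<le> \<delta>1 * (((r1 / \<rho>')\<^sup>2) ^ \<mu> * g1)"
              using \<delta>1 by (intro mult_left_mono) auto
            also have "\<dots> \<le> gram (map (dani \<Theta> \<rho>') (D i))"
              using H that r' by (meson order_trans)
            finally show ?thesis by (simp add: \<delta>_def mult_ac)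
          qed
          then show "QD i c' r'" by (auto simp: QD_def \<mu>_def g_def)
        qed
        then have "forces \<beta> N (QD i) c1 r1" by (rule forces_mono) (simp add: N_def)
        then show ?thesis using False by (simp add: Q_def)
      qed
    qed
    moreover obtain n0 where n0: "1 / R < 2 ^ n0" using real_arch_pow[of 2 "1 / R"] by auto
    ultimately have "forces \<beta> (d * N + n0) (\<lambda>c' r'. \<beta> * (R * X) \<le> r' \<and> r' \<le> R * X \<and> cball c' r' \<subseteq> cball c r \<and> r' \<le> r \<and> (\<forall>i<d. Q i c' r')) c r"
    proof (elim forces_trans[OF _ \<beta> r])
      fix c1 r1 assume Q1: "\<forall>i<d. Q i c1 r1" and r1: "\<beta> ^ (d * N) * r \<le> r1" "r1 \<le> r" and sub: "cball c1 r1 \<subseteq> cball c r"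
      have "\<beta> * (R * X) = R * (\<beta> * X)" by simp
      also have "\<dots> \<le> \<kappa> * r" using R X \<beta> \<kappa> by (intro mult_mono) auto
      also have "\<dots> \<le> r1" using r1 by (simp add: \<kappa>_def)
      finally have low: "\<beta> * (R * X) \<le> r1" .
      moreover have "1 \<le> 2 ^ n0 * R" using n0 R by (simp add: field_simps)
      then have "1 * X \<le> (2 ^ n0 * R) * X" using X by (intro mult_right_mono) auto
      then have "X \<le> 2 ^ n0 * (R * X)" by (simp only: mult.assoc mult_1_left)
      then have up: "r1 \<le> 2 ^ n0 * (R * X)" using r1 X by linarith
      have RX: "0 < R * X" using R X by simp
      have r10: "0 < r1" using low \<beta> RX by (smt (verit) mult_pos_pos)
      have "forces \<beta> n0 (\<lambda>c' r'. \<beta> * (R * X) \<le> r' \<and> r' \<le> R * X \<and> cball c' r' \<subseteq> cball c1 r1) c1 r1"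
        by (rule forces_radius_window[OF \<beta> low up RX])
      then show "forces \<beta> n0 (\<lambda>c' r'. \<beta> * (R * X) \<le> r' \<and> r' \<le> R * X \<and> cball c' r' \<subseteq> cball c r \<and> r' \<le> r \<and> (\<forall>i<d. Q i c' r')) c1 r1"
      proof (rule forces_weaken[OF _ \<beta> r10])
        fix c' r' assume w: "\<beta> * (R * X) \<le> r' \<and> r' \<le> R * X \<and> cball c' r' \<subseteq> cball c1 r1" and r'1: "r' \<le> r1"
        have "Q i c' r'" if "i < d" for i
          using Q1[rule_format, OF that] w r'1 by (cases "i = 0") (auto simp: Q_def Qq_def QD_def)
        then show "\<beta> * (R * X) \<le> r' \<and> r' \<le> R * X \<and> cball c' r' \<subseteq> cball c r \<and> r' \<le> r \<and> (\<forall>i<d. Q i c' r')"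
          using w sub r1 r'1 by auto
      qed
    qed
    then have "forces \<beta> (d * N + n0) (\<lambda>c' r'. \<beta> * (R * X) \<le> r' \<and> r' \<le> R * X \<and> covol_bound K c' r' \<and>
        (\<forall>\<Theta>\<in>cball c' r'. gram (map (\<lambda>v. snd (dani \<Theta> 1 v)) q) \<noteq> 0)) c r"
    proof (rule forces_weaken[OF _ \<beta> r])
      fix c' r' assume H: "\<beta> * (R * X) \<le> r' \<and> r' \<le> R * X \<and> cball c' r' \<subseteq> cball c r \<and> r' \<le> r \<and> (\<forall>i<d. Q i c' r')"
      have "0 < \<beta> * (R * X)" using \<beta> R X by simp
      then have r'0: "0 < r'" using H by linarith
      have "Qq c' r'" using H d0 by (auto simp: Q_def dest!: spec[of _ 0])
      moreover have "covol_bound K c' r'"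
        unfolding covol_bound_def
      proof (intro ballI allI impI)
        fix \<Theta> and xs :: "((real ^ 'n) \<times> (real ^ 'm)) list"
        assume \<Theta>: "\<Theta> \<in> cball c' r'" and "set xs \<subseteq> integer_vectors \<and> 0 < gram xs"
        then have xs: "set xs \<subseteq> integer_vectors" "0 < gram xs" by auto
        define j where "j = length xs"
        have "\<Theta> \<in> cball c r" using H \<Theta> by blast
        then have dist: "norm (c - \<Theta>) \<le> 2 * r" using r by (simp add: dist_norm)
        have jd: "j \<le> d" unfolding j_def d_def by (rule length_le_if_gram_pos[OF xs(2)])
        have bdj: "bd j \<le> covol c r xs"
          using inv xs r unfolding covol_bound_def bd_def j_def d_def by simp
        \<comment> \<open>In ranks 0 and \<open>d\<close> the bound is 1 and holds for free; a
          dangerous lattice does not shrink, by expansion; any other lattice had a factor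
          \<open>C\<close> to spare.\<close>
        consider "j = 0" | "j = d" | "0 < j" "j < d" "dangerous j xs" | "\<not> dangerous j xs" using jd by linarith
        then have "bd j \<le> covol \<Theta> r' xs"
        proof cases
          case 1
          then show ?thesis using covol_Nil[OF r'0, of \<Theta>] by (simp add: bd_def j_def)
        next
          case 2
          then show ?thesis using covol_full_rank_ge[OF xs _ r'0, of \<Theta>] by (simp add: bd_def j_def d_def)
        next
          case 3
          have DD: "set (D j) \<subseteq> integer_vectors" "0 < gram (D j)" "length (D j) = j" "covol c r (D j) < C * bd j"
            using D[OF 3(3)] by (auto simp: dangerous_def)
          have "covol c r xs < C * bd j" using 3(3) by (simp add: dangerous_def)
          then have "span (set xs) = span (set (D j))"
            using dangerous_span_unique[OF inv r C K xs j_def[symmetric] _ DD(1-3)] DD(4) unfolding bd_def d_def by blast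
          moreover have "length xs = length (D j)" using DD(3) by (simp add: j_def)
          \<comment> \<open>Both lists have the same real span, so their Gram determinants are in
            the same ratio after every linear map, and the expansion of \<open>D j\<close> passes to
            \<open>xs\<close>.\<close>
          ultimately obtain A where A: "A \<in> carrier_mat (length (D j)) (length (D j))"
            "\<And>i. i < length (D j) \<Longrightarrow> xs ! i = (\<Sum>k<length (D j). (A $$ (i, k)) *\<^sub>R (D j ! k))"
            by (rule same_span_lincomb) blast
          have gA: "gram (map f xs) = (det A)\<^sup>2 * gram (map f (D j))" if "linear f"
            for f :: "(real ^ 'n) \<times> (real ^ 'm) \<Rightarrow> (real ^ 'n) \<times> (real ^ 'm)"
            using gram_map_lincomb[OF that A(1) refl _ A(2)] DD(3) by (simp add: j_def)
          have "QD j c' r'" using H 3 by (auto simp: Q_def)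
          then have "\<delta> * (((r / r')\<^sup>2) ^ min (length (D j)) m * gram (map (dani c r) (D j))) \<le> gram (map (dani \<Theta> r') (D j))"
            using \<Theta> r'0 by (simp add: QD_def)
          then have "(det A)\<^sup>2 * (\<delta> * (((r / r')\<^sup>2) ^ min (length (D j)) m * gram (map (dani c r) (D j)))) \<le> (det A)\<^sup>2 * gram (map (dani \<Theta> r') (D j))"
            by (rule mult_left_mono) simp
          then have ex: "\<delta> * (((r / r')\<^sup>2) ^ min (length xs) CARD('m) * gram (map (dani c r) xs)) \<le> gram (map (dani \<Theta> r') xs)"
            unfolding gA[OF linear_dani] \<open>length xs = length (D j)\<close> m_def by (simp add: mult_ac)
          have "\<beta> / R \<le> r / r'"
          proof -
            have "\<beta> * r' \<le> \<beta> * (R * X)" using H \<beta> by (intro mult_left_mono) auto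
            also have "\<dots> = (\<beta> * X) * R" by simp
            also have "\<dots> \<le> r * R" using X R by (intro mult_right_mono) auto
            finally show ?thesis using R r'0 by (simp add: field_simps)
          qed
          then have "covol c r xs \<le> covol \<Theta> r' xs"
            using 3 H r'0 t0 \<beta> R \<delta> ex by (intro covol_ge_if_expanded[where \<delta> = \<delta> and ?t0.0 = "\<beta> / R"]) (auto simp: j_def d_def)
          then show ?thesis using bdj by linarith
        next
          case 4
          then have ge: "C * bd j \<le> covol c r xs" using xs by (simp add: dangerous_def j_def)
          have sr: "s * r \<le> r'"
          proof -
            have "s * r \<le> s * X" using X s by (intro mult_left_mono) auto
            also have "\<dots> = \<beta> * (R * X)" by (simp add: s_def)
            finally show ?thesis using H by linarith
          qed
          have "s ^ (2 * m) / P * (C * bd j) \<le> s ^ (2 * m) / P * covol c r xs"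
            using ge s P by (intro mult_left_mono) auto
          also have "\<dots> \<le> covol \<Theta> r' xs"
            unfolding m_def P_def d_def using H by (intro covol_ge_if_safe[OF xs(2) r'0 _ sr s dist]) auto
          finally show ?thesis using s P by (simp add: C_def)
        qed
        then show "exp (- K * (real (length xs) * (real (CARD('n) + CARD('m)) - real (length xs)))) \<le> covol \<Theta> r' xs"
          by (simp only: bd_def j_def d_def)
      qed
      ultimately show "\<beta> * (R * X) \<le> r' \<and> r' \<le> R * X \<and> covol_bound K c' r' \<and>
          (\<forall>\<Theta>\<in>cball c' r'. gram (map (\<lambda>v. snd (dani \<Theta> 1 v)) q) \<noteq> 0)"
        using H by (simp add: Qq_def)
    qed
    then show ?thesis by blast
  qed
  have "0 \<le> ln C" using C by simp
  then show ?thesis using R stage unfolding m_def by (intro exI[of _ R] exI[of _ "ln C"]) auto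
qed

section \<open>The winning strategy\<close>

text \<open>Integrality gives \<open>1 \<le> gram xs\<close>, and \<open>dani\<close> shrinks
  volumes by a bounded factor for \<Theta> in the ball, so in the ranks \<open>0 < j < d\<close> the
  covolumes are at least some \<open>\<epsilon>\<close>. There \<open>j (d - j) \<ge> 1\<close>, so
  every large \<open>K\<close> works.\<close>

lemma covol_bound_initial:
  fixes c :: "real ^ 'n ^ 'm"
  assumes r: "0 < r"
  shows "\<exists>K1. \<forall>K\<ge>K1. covol_bound K c r"
proof -
  define d where "d = CARD('n) + CARD('m)"
  define B where "B = 1 + norm c + 2 * r"
  have B: "1 \<le> B" using r by (simp add: B_def)
  define \<epsilon> where "\<epsilon> = min 1 (r powr real (2 * CARD('m))) / (B\<^sup>2) ^ d"
  have \<epsilon>: "0 < \<epsilon>" using B r by (simp add: \<epsilon>_def)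
  have "covol_bound K c r" if K: "max 0 (- ln \<epsilon>) \<le> K" for K
    unfolding covol_bound_def
  proof (intro ballI allI impI)
    fix \<Theta> and xs :: "((real ^ 'n) \<times> (real ^ 'm)) list"
    assume \<Theta>: "\<Theta> \<in> cball c r" and "set xs \<subseteq> integer_vectors \<and> 0 < gram xs"
    then have xs: "set xs \<subseteq> integer_vectors" "0 < gram xs" by auto
    define j where "j = length xs"
    have jd: "j \<le> d" unfolding j_def d_def by (rule length_le_if_gram_pos[OF xs(2)])
    then consider "j = 0" | "j = d" | "0 < j" "j < d" by linarith
    then have "exp (- K * (real j * (real d - real j))) \<le> covol \<Theta> r xs"
    proof cases
      case 1
      then show ?thesis using covol_Nil[OF r, of \<Theta>] by (simp add: j_def)
    next
      case 2
      then show ?thesis using covol_full_rank_ge[OF xs _ r, of \<Theta>] by (simp add: j_def d_def)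
    next
      case 3
      define a where "a = 2 * real (CARD('m)) / real d * real j"
      have a: "0 \<le> a" "a \<le> real (2 * CARD('m))"
      proof -
        have "a = real (2 * CARD('m)) * (real j / real d)" by (simp add: a_def)
        also have "\<dots> \<le> real (2 * CARD('m)) * 1" using jd by (intro mult_left_mono) (auto simp: divide_le_eq_1)
        finally show "a \<le> real (2 * CARD('m))" by simp
      qed (simp add: a_def)
      have "norm \<Theta> \<le> norm c + r" using \<Theta> norm_triangle_ineq4[of c "c - \<Theta>"] by (simp add: dist_norm)
      then have B': "1 + norm \<Theta> + r \<le> B" "0 \<le> 1 + norm \<Theta> + r" using r by (auto simp: B_def)
      have "1 \<le> gram xs" by (rule gram_ge_1[OF xs])
      also have "\<dots> \<le> ((1 + norm \<Theta> + r)\<^sup>2) ^ j * gram (map (dani \<Theta> r) xs)"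
        unfolding j_def by (rule gram_le_gram_dani[OF r])
      also have "\<dots> \<le> (B\<^sup>2) ^ d * gram (map (dani \<Theta> r) xs)"
      proof (rule mult_right_mono[OF _ gram_nonneg])
        have "((1 + norm \<Theta> + r)\<^sup>2) ^ j \<le> (B\<^sup>2) ^ j" using B' by (intro power_mono) auto
        also have "\<dots> \<le> (B\<^sup>2) ^ d" using B jd by (intro power_increasing) auto
        finally show "((1 + norm \<Theta> + r)\<^sup>2) ^ j \<le> (B\<^sup>2) ^ d" .
      qed
      finally have g: "1 / (B\<^sup>2) ^ d \<le> gram (map (dani \<Theta> r) xs)" using B by (simp add: divide_le_eq mult.commute)
      have "min 1 (r powr real (2 * CARD('m))) \<le> r powr a"
      proof (cases "1 \<le> r")
        case True
        then show ?thesis using a ge_one_powr_ge_zero[of r a] by (simp add: min_le_iff_disj)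
      next
        case False
        then show ?thesis using a r powr_mono'[of a "real (2 * CARD('m))" r] by (simp add: min_le_iff_disj)
      qed
      then have "min 1 (r powr real (2 * CARD('m))) * (1 / (B\<^sup>2) ^ d) \<le> r powr a * gram (map (dani \<Theta> r) xs)"
        using g B by (intro mult_mono) auto
      then have "\<epsilon> \<le> covol \<Theta> r xs" by (simp add: \<epsilon>_def covol_def a_def d_def j_def)
      moreover have "exp (- K * (real j * (real d - real j))) \<le> \<epsilon>"
      proof -
        have "1 * 1 \<le> real j * (real d - real j)" using 3 by (intro mult_mono) auto
        then have "K * 1 \<le> K * (real j * (real d - real j))" using K by (intro mult_left_mono) auto
        then have "- K * (real j * (real d - real j)) \<le> ln \<epsilon>" using K by simp
        then have "exp (- K * (real j * (real d - real j))) \<le> exp (ln \<epsilon>)" by (simp only: exp_le_cancel_iff)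
        then show ?thesis using \<epsilon> by simp
      qed
      ultimately show ?thesis by linarith
    qed
    then show "exp (- K * (real (length xs) * (real (CARD('n) + CARD('m)) - real (length xs)))) \<le> covol \<Theta> r xs"
      by (simp only: j_def d_def)
  qed
  then show ?thesis by blast
qed

section \<open>Rank 1: covolumes and bad approximability\<close>

lemma gram_singleton: "gram [v] = (norm (v :: 'v::euclidean_space))\<^sup>2"
  using gram_snoc_orthogonal[of 0 "[]" v] by (simp add: span_zero)

lemma norm_le_Max_cart:
  fixes x :: "real ^ 'n"
  shows "norm x \<le> CARD('n) * (MAX i\<in>UNIV. \<bar>x $ i\<bar>)"
proof -
  have "norm x \<le> (\<Sum>i\<in>UNIV. \<bar>x $ i\<bar>)" by (rule norm_le_l1_cart)
  also have "\<dots> \<le> of_nat (card (UNIV :: 'n set)) * (MAX i\<in>UNIV. \<bar>x $ i\<bar>)"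
    by (rule sum_bounded_above) (auto intro!: Max_ge)
  finally show ?thesis by simp
qed

lemma integer_vectors_Pair:
  fixes y :: "real ^ 'n" and p :: "real ^ 'm"
  assumes "\<And>i. y $ i \<in> \<int>" "\<And>j. p $ j \<in> \<int>"
  shows "(y, p) \<in> integer_vectors"
  using assms by (auto simp: integer_vectors_def Basis_prod_def Basis_vec_def inner_axis)

lemma powr_power_real: "0 < (x::real) \<Longrightarrow> (x powr u) ^ k = x powr (u * real k)"
  by (simp add: powr_powr flip: powr_realpow)

text \<open>One direction of the Dani correspondence. For a nonzero integer \<open>x\<close>, take
  the first scale at which the contribution of \<open>x\<close> to the squared length is at most
  \<open>e / 2\<close>: the contribution of \<open>\<Theta> x - p\<close> is then at least
  \<open>e / 2\<close>, and one scale earlier that of \<open>x\<close> was larger. These bound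
  \<open>S\<close> and \<open>A\<close> below by powers of the scale that cancel in the
  product.\<close>

lemma badly_approximable_if_covol_ge:
  fixes \<Theta> :: "real ^ 'n ^ 'm"
  assumes \<beta>: "0 < \<beta>" and R: "0 < R" "R < 1" and r0: "0 < r0" and e: "0 < e"
    and cov: "\<And>k. \<exists>r. \<beta> * (R ^ k * r0) \<le> r \<and> r \<le> R ^ k * r0 \<and>
       (\<forall>v \<in> integer_vectors. v \<noteq> 0 \<longrightarrow> e \<le> covol \<Theta> r [v])"
  shows "badly_approximable \<Theta>"
proof -
  define n m where "n = CARD('n)" and "m = CARD('m)"
  define d where "d = real (n + m)"
  \<comment> \<open>\<open>a\<close> and \<open>- b\<close> are the exponents of \<open>r\<close> in
    the two contributions. Raising the bounds to the powers \<open>n\<close> and \<open>m\<close>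
    turns them into \<open>- \<gamma>\<close> and \<open>\<gamma>\<close>.\<close>
  define a where "a = 2 * real m / d"
  define b where "b = 2 * real n / d"
  define \<gamma> where "\<gamma> = real n * real m / d"
  have nm: "0 < n" "0 < m" by (auto simp: n_def m_def)
  then have d: "0 < d" by (simp add: d_def)
  have ab: "0 < a" "0 < b" "a + b = 2" "a / 2 * real n = \<gamma>" "b / 2 * real m = \<gamma>"
    using nm d by (auto simp: a_def b_def \<gamma>_def field_simps) (simp add: d_def algebra_simps)
  \<comment> \<open>The divisors \<open>m\<close> here and \<open>n\<close> in \<open>z\<close> pay
    for comparing Euclidean norms with maxima of coordinates.\<close>
  define w where "w = sqrt (e / 2) / m"
  define z where "z = sqrt (e / 2) / n"
  have wz: "0 < w" "0 < z" using e nm by (auto simp: w_def z_def)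
  have wz2: "w\<^sup>2 = e / 2 / (real m)\<^sup>2" "z\<^sup>2 = e / 2 / (real n)\<^sup>2"
    using e by (auto simp: w_def z_def power_divide)
  define C1 where "C1 = w ^ m * (\<beta> * r0) powr \<gamma>"
  define C2 where "C2 = z ^ n * (w ^ m * (\<beta> * R) powr \<gamma>)"
  have C: "0 < C1" "0 < C2" using wz \<beta> R r0 by (auto simp: C1_def C2_def)
  \<comment> \<open>Halving turns the bound obtained below into a strict inequality.\<close>
  have "min C1 C2 / 2 < (MAX i\<in>UNIV. \<bar>real_of_int (x $ i)\<bar>) ^ CARD('n) *
        (MAX j\<in>UNIV. dist_nearest_int (\<Sum>i\<in>UNIV. \<Theta> $ j $ i * real_of_int (x $ i))) ^ CARD('m)"
    if x: "x \<noteq> 0" for x :: "int ^ 'n"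
  proof -
    define A where "A = (MAX i\<in>UNIV. \<bar>real_of_int (x $ i)\<bar>)"
    define S where "S = (MAX j\<in>UNIV. dist_nearest_int (\<Sum>i\<in>UNIV. \<Theta> $ j $ i * real_of_int (x $ i)))"
    define y :: "real ^ 'n" where "y = (\<chi> i. real_of_int (x $ i))"
    define p :: "real ^ 'm" where "p = (\<chi> j. of_int (round ((\<Theta> *v y) $ j)))"
    have A1: "1 \<le> A"
    proof -
      obtain i where "x $ i \<noteq> 0" using x by (auto simp: Finite_Cartesian_Product.vec_eq_iff)
      then have "1 \<le> \<bar>real_of_int (x $ i)\<bar>" by linarith
      also have "\<dots> \<le> A" unfolding A_def by (intro Max_ge) auto
      finally show ?thesis .
    qed
    have ny: "norm y \<le> n * A" using norm_le_Max_cart[of y] by (simp add: y_def A_def n_def)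
    have np: "norm (\<Theta> *v y - p) \<le> m * S"
      using norm_le_Max_cart[of "\<Theta> *v y - p"]
      by (simp add: S_def m_def p_def y_def dist_nearest_int_def matrix_vector_mult_def)
    have S0: "0 \<le> S"
    proof -
      have "0 \<le> m * S" using np norm_ge_zero order_trans by blast
      then show ?thesis using nm by (simp add: zero_le_mult_iff)
    qed
    have "y \<noteq> 0"
    proof
      assume "y = 0"
      then have "y $ i = 0" for i by simp
      then have "x = 0" by (simp add: y_def Finite_Cartesian_Product.vec_eq_iff)
      then show False using x by blast
    qed
    then have v: "(y, p) \<in> integer_vectors" "(y, p) \<noteq> 0"
      by (auto intro!: integer_vectors_Pair simp: y_def p_def prod_eq_iff)
    have cov_le: "covol \<Theta> r [(y, p)] \<le> r powr a * ((real n)\<^sup>2 * A\<^sup>2) + r powr (- b) * ((real m)\<^sup>2 * S\<^sup>2)" if r: "0 < r" for r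
    proof -
      have "covol \<Theta> r [(y, p)] = r powr a * (norm (dani \<Theta> r (y, p)))\<^sup>2"
        by (simp add: covol_def gram_singleton a_def d_def n_def m_def)
      also have "(norm (dani \<Theta> r (y, p)))\<^sup>2 = (norm y)\<^sup>2 + (norm (\<Theta> *v y - p) / r)\<^sup>2"
        using r by (simp add: dani_def norm_prod_def)
      also have "\<dots> \<le> (n * A)\<^sup>2 + (m * S / r)\<^sup>2"
        using ny np r by (intro add_mono power_mono divide_right_mono) auto
      finally have "covol \<Theta> r [(y, p)] \<le> r powr a * ((n * A)\<^sup>2 + (m * S / r)\<^sup>2)"
        by (simp add: mult_left_mono)
      also have "\<dots> = r powr a * ((real n)\<^sup>2 * A\<^sup>2) + r powr a * (1 / r\<^sup>2) * ((real m)\<^sup>2 * S\<^sup>2)"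
        by (simp add: distrib_left power_mult_distrib power_divide)
      also have "r powr a * (1 / r\<^sup>2) = r powr (- b)"
      proof -
        have "1 / r\<^sup>2 = r powr (- 2)" using r powr_realpow[of r 2] by (simp add: powr_minus_divide)
        moreover have "a + - 2 = - b" using ab(3) by linarith
        ultimately show ?thesis by (simp flip: powr_add)
      qed
      finally show ?thesis .
    qed
    define u where "u k = (R ^ k * r0) powr a * ((real n)\<^sup>2 * A\<^sup>2)" for k
    have S_ge: "w ^ m * (\<beta> * (R ^ k * r0)) powr \<gamma> \<le> S ^ m" if uk: "u k \<le> e / 2" for k
    proof -
      define Y where "Y = R ^ k * r0"
      have Y: "0 < Y" using R r0 by (simp add: Y_def)
      obtain r where r: "\<beta> * Y \<le> r" "r \<le> Y" "\<forall>v \<in> integer_vectors. v \<noteq> 0 \<longrightarrow> e \<le> covol \<Theta> r [v]"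
        using cov[of k] unfolding Y_def by blast
      have \<beta>Y: "0 < \<beta> * Y" using \<beta> Y by simp
      then have rp: "0 < r" using r by linarith
      have "e \<le> covol \<Theta> r [(y, p)]" using r(3) v by blast
      moreover have "r powr a * ((real n)\<^sup>2 * A\<^sup>2) \<le> u k"
        unfolding u_def using r(2) rp ab by (intro mult_right_mono powr_mono2) (auto simp: Y_def)
      ultimately have "e / 2 \<le> r powr (- b) * ((real m)\<^sup>2 * S\<^sup>2)" using cov_le[OF rp] uk by linarith
      also have "\<dots> \<le> (\<beta> * Y) powr (- b) * ((real m)\<^sup>2 * S\<^sup>2)"
        using r(1) \<beta>Y ab by (intro mult_right_mono powr_mono2') auto
      also have "\<dots> = (real m)\<^sup>2 * S\<^sup>2 / (\<beta> * Y) powr b" by (simp add: powr_minus_divide)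
      finally have "e / 2 * (\<beta> * Y) powr b \<le> (real m)\<^sup>2 * S\<^sup>2"
        using \<beta>Y by (subst (asm) pos_le_divide_eq) auto
      moreover have "((\<beta> * Y) powr (b / 2))\<^sup>2 = (\<beta> * Y) powr b"
        by (simp add: power2_eq_square flip: powr_add)
      ultimately have "(w * (\<beta> * Y) powr (b / 2))\<^sup>2 \<le> S\<^sup>2"
        using nm by (simp add: power_mult_distrib wz2 divide_le_eq mult.commute[of "S\<^sup>2"])
      then have "w * (\<beta> * Y) powr (b / 2) \<le> S" by (rule power2_le_imp_le[OF _ S0])
      then have "(w * (\<beta> * Y) powr (b / 2)) ^ m \<le> S ^ m" using wz by (intro power_mono) auto
      moreover have "((\<beta> * Y) powr (b / 2)) ^ m = (\<beta> * Y) powr \<gamma>"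
        unfolding powr_power_real[OF \<beta>Y] ab(5) ..
      ultimately show ?thesis by (simp add: power_mult_distrib Y_def)
    qed
    have "\<exists>k. u k \<le> e / 2"
    proof -
      define M where "M = r0 powr a * ((real n)\<^sup>2 * A\<^sup>2)"
      have M: "0 < M" using r0 nm A1 by (simp add: M_def)
      have "R powr a < 1" using R ab powr_less_mono2[of a R 1] by simp
      moreover have "0 < e / 2 / M" using e M by simp
      ultimately obtain k where "(R powr a) ^ k < e / 2 / M" using real_arch_pow_inv by blast
      then have "(R powr a) ^ k * M < e / 2" using M by (simp add: pos_less_divide_eq)
      moreover have "u k = (R powr a) ^ k * M"
      proof -
        have "(R ^ k * r0) powr a = (R ^ k) powr a * r0 powr a" using R r0 by (simp add: powr_mult)
        also have "(R ^ k) powr a = (R powr a) ^ k"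
          using R by (simp add: powr_power_real powr_powr mult.commute flip: powr_realpow)
        finally show ?thesis by (simp add: u_def M_def)
      qed
      ultimately show ?thesis by (intro exI[of _ k]) linarith
    qed
    define k where "k = (LEAST k. u k \<le> e / 2)"
    have uk: "u k \<le> e / 2" unfolding k_def using \<open>\<exists>k. u k \<le> e / 2\<close> by (rule LeastI_ex)
    have "min C1 C2 \<le> A ^ n * S ^ m"
    \<comment> \<open>For \<open>k = 0\<close> there is no earlier scale, and
      \<open>1 \<le> A\<close> takes the place of the lower bound on \<open>A\<close>.\<close>
    proof (cases k)
      case 0
      have "1 * C1 \<le> A ^ n * S ^ m"
        using S_ge[OF uk] A1 C wz by (intro mult_mono) (auto simp: 0 C1_def)
      then show ?thesis by simp
    next
      case (Suc k')
      define Y where "Y = R ^ k' * r0"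
      have Y: "0 < Y" using R r0 by (simp add: Y_def)
      have "\<not> u k' \<le> e / 2" using not_less_Least[of k' "\<lambda>k. u k \<le> e / 2"] Suc by (simp add: k_def)
      then have "e / 2 \<le> Y powr a * ((real n)\<^sup>2 * A\<^sup>2)" by (simp add: u_def Y_def)
      then have "e / 2 * Y powr (- a) \<le> Y powr a * ((real n)\<^sup>2 * A\<^sup>2) * Y powr (- a)" by (rule mult_right_mono) simp
      also have "\<dots> = (real n)\<^sup>2 * A\<^sup>2" using Y by (simp add: powr_minus)
      finally have "e / 2 * Y powr (- a) \<le> (real n)\<^sup>2 * A\<^sup>2" .
      moreover have "(Y powr (- (a / 2)))\<^sup>2 = Y powr (- a)" by (simp add: power2_eq_square flip: powr_add)
      ultimately have "(z * Y powr (- (a / 2)))\<^sup>2 \<le> A\<^sup>2"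
        using nm by (simp add: power_mult_distrib wz2 divide_le_eq mult.commute[of "A\<^sup>2"])
      then have "z * Y powr (- (a / 2)) \<le> A" by (rule power2_le_imp_le) (use A1 in simp)
      then have "(z * Y powr (- (a / 2))) ^ n \<le> A ^ n" using wz by (intro power_mono) auto
      moreover have "(Y powr (- (a / 2))) ^ n = Y powr (- \<gamma>)"
        unfolding powr_power_real[OF Y] mult_minus_left ab(4) ..
      ultimately have An: "z ^ n * Y powr (- \<gamma>) \<le> A ^ n" by (simp add: power_mult_distrib)
      have "\<beta> * (R ^ k * r0) = (\<beta> * R) * Y" by (simp add: Suc Y_def)
      then have Sm: "w ^ m * ((\<beta> * R) powr \<gamma> * Y powr \<gamma>) \<le> S ^ m"
        using S_ge[OF uk] \<beta> R Y by (simp add: powr_mult)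
      have "C2 = (z ^ n * Y powr (- \<gamma>)) * (w ^ m * ((\<beta> * R) powr \<gamma> * Y powr \<gamma>))"
        using Y by (simp add: C2_def powr_minus)
      also have "\<dots> \<le> A ^ n * S ^ m"
        using An Sm wz A1 by (intro mult_mono) auto
      finally show ?thesis by simp
    qed
    then show ?thesis using C unfolding A_def[symmetric] S_def[symmetric] n_def[symmetric] m_def[symmetric]
      by (simp add: min_def split: if_splits)
  qed
  moreover have "0 < min C1 C2 / 2" using C by simp
  ultimately show ?thesis unfolding badly_approximable_def by blast
qed

section \<open>Transversality and complete irrationality\<close>

lemma dim_graph_subspace:
  fixes \<Theta> :: "real ^ 'n ^ 'm"
  shows "subspace (graph_subspace \<Theta>)" "dim (graph_subspace \<Theta>) = CARD('n)"
proof -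
  define f where "f x = (x, \<Theta> *v x)" for x
  have f: "linear f" by (rule linearI) (auto simp: f_def matrix_vector_right_distrib matrix_vector_mult_scaleR)
  have eq: "graph_subspace \<Theta> = f ` UNIV" by (auto simp: graph_subspace_def f_def)
  show "subspace (graph_subspace \<Theta>)" unfolding eq by (rule linear_subspace_image[OF f subspace_UNIV])
  have "inj f" by (auto simp: inj_def f_def)
  then show "dim (graph_subspace \<Theta>) = CARD('n)"
    unfolding eq using dim_image_eq[OF f, of UNIV] by simp
qed

text \<open>For \<open>v = (x, y)\<close> the vector \<open>snd (dani \<Theta> 1 v)\<close> is
  \<open>\<Theta> x - y\<close>, so the kernel of this map is the graph. A nonzero Gram determinant
  of the images of a basis makes the map injective on the subspace.\<close>

lemma I_set_if_transversal:
  fixes \<Theta> :: "real ^ 'n ^ 'm"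
  assumes tr: "\<And>xs. set xs \<subseteq> integer_vectors \<Longrightarrow> length xs = CARD('m) \<Longrightarrow> 0 < gram xs \<Longrightarrow>
      gram (map (\<lambda>v. snd (dani \<Theta> 1 v)) xs) \<noteq> 0"
  shows "\<Theta> \<in> I_set"
proof -
  have "graph_subspace \<Theta> \<inter> M = {0}" if M: "rational_subspace M" "dim M = CARD('m)" for M :: "((real ^ 'n) \<times> (real ^ 'm)) set"
  proof -
    obtain B where B: "B \<subseteq> integer_vectors" "independent B" "span B = M" using M(1) by (auto simp: rational_subspace_def)
    obtain xs where xs: "set xs = B" "distinct xs"
      using finite_distinct_list[OF independent_imp_finite[OF B(2)]] by blast
    have gr: "0 < gram xs" using xs B(2) by (simp add: gram_pos_iff_independent)
    have len: "length xs = CARD('m)" using dim_span_list[OF gr] xs(1) B(3) M(2) by simp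
    define ys where "ys = map (\<lambda>v. snd (dani \<Theta> 1 v)) xs"
    have "gram ys \<noteq> 0" unfolding ys_def using tr[of xs] xs(1) B(1) len gr by blast
    then have gy: "0 < gram ys" using gram_nonneg[of ys] by linarith
    have lin: "linear (\<lambda>v. snd (dani \<Theta> 1 v))" using linear_compose[OF linear_dani linear_snd] by (simp add: o_def)
    have "v = 0" if v: "v \<in> graph_subspace \<Theta>" "v \<in> M" for v
    proof -
      have "v \<in> span (set xs)" using v(2) B(3) xs(1) by simp
      then obtain c where c: "v = (\<Sum>j<length xs. c j *\<^sub>R (xs ! j))" by (rule span_list_lincomb)
      have "snd (dani \<Theta> 1 v) = 0" using v(1) by (auto simp: graph_subspace_def dani_def)
      moreover have "snd (dani \<Theta> 1 v) = (\<Sum>j<length ys. c j *\<^sub>R (ys ! j))"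
        unfolding c linear_sum[OF lin] linear_scale[OF lin] by (simp add: ys_def)
      ultimately have "c j = 0" if "j < length ys" for j
        using lincomb_eq_0_imp[OF gy _ that] by metis
      then show "v = 0" unfolding c by (simp add: ys_def)
    qed
    moreover have "0 \<in> graph_subspace \<Theta>" "0 \<in> M"
      using subspace_0[OF dim_graph_subspace(1)] B(3) span_zero by auto
    ultimately show ?thesis by blast
  qed
  then show ?thesis
    using dim_graph_subspace[of \<Theta>] by (auto simp: I_set_def completely_irrational_def)
qed

section \<open>Assembling the stages\<close>

lemma countable_integer_vectors: "countable (integer_vectors :: 'a::euclidean_space set)"
proof -
  define F where "F g = (\<Sum>b\<in>Basis. of_int (g b) *\<^sub>R b)" for g :: "'a \<Rightarrow> int"
  have "integer_vectors \<subseteq> F ` (Pi\<^sub>E Basis (\<lambda>_. UNIV))"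
  proof
    fix v :: 'a assume v: "v \<in> integer_vectors"
    define g where "g = restrict (\<lambda>b. \<lfloor>v \<bullet> b\<rfloor>) Basis"
    have "F g = (\<Sum>b\<in>Basis. (v \<bullet> b) *\<^sub>R b)"
      unfolding F_def using v by (intro sum.cong) (auto simp: g_def integer_vectors_def)
    then have "v = F g" by (simp add: euclidean_representation)
    then show "v \<in> F ` (Pi\<^sub>E Basis (\<lambda>_. UNIV))" by (auto simp: g_def)
  qed
  moreover have "countable (Pi\<^sub>E (Basis :: 'a set) (\<lambda>_. UNIV :: int set))" by (intro countable_PiE) auto
  ultimately show ?thesis by (meson countable_image countable_subset)
qed

lemma N_irr_winning:
  assumes \<beta>: "0 < \<beta>" "\<beta> < 1"
  shows "hyperplane_absolute_winning \<beta> (N_irr :: (real ^ 'n ^ 'm) set)"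
proof -
  from forces_next_stage[OF \<beta>, where 'n = 'n and 'm = 'm]
  obtain R K0 where RK: "0 < R \<and> R < \<beta> \<and> 0 \<le> K0 \<and> (\<forall>K (c :: real ^ 'n ^ 'm) r X q. K0 \<le> K \<longrightarrow> 0 < X \<longrightarrow>
     \<beta> * X \<le> r \<longrightarrow> r \<le> X \<longrightarrow> covol_bound K c r \<longrightarrow> length q = CARD('m) \<longrightarrow> 0 < gram q \<longrightarrow>
     (\<exists>k. forces \<beta> k (\<lambda>c' r'. \<beta> * (R * X) \<le> r' \<and> r' \<le> R * X \<and> covol_bound K c' r' \<and>
        (\<forall>\<Theta>\<in>cball c' r'. gram (map (\<lambda>v. snd (dani \<Theta> 1 v)) q) \<noteq> 0)) c r))"
    by (elim exE)
  then have R: "0 < R" "R < \<beta>" by simp_all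
  note stage = RK[THEN conjunct2, THEN conjunct2, THEN conjunct2, rule_format]
  \<comment> \<open>Integer bases of the rational subspaces of dimension \<open>m\<close>;
    \<open>q\<close> enumerates them.\<close>
  define Z where "Z = {xs :: ((real ^ 'n) \<times> (real ^ 'm)) list. set xs \<subseteq> integer_vectors \<and> length xs = CARD('m) \<and> 0 < gram xs}"
  have "Z \<subseteq> lists integer_vectors" by (auto simp: Z_def)
  then have cZ: "countable Z" using countable_lists[OF countable_integer_vectors] countable_subset by blast
  have "Z \<noteq> {}"
  proof -
    obtain es :: "((real ^ 'n) \<times> (real ^ 'm)) list" where es: "set es = Basis" "distinct es"
      using finite_distinct_list[OF finite_Basis] by blast
    have "length es = CARD('n) + CARD('m)" using distinct_card[OF es(2)] es(1) by simp
    moreover have "(Basis :: ((real ^ 'n) \<times> (real ^ 'm)) set) \<subseteq> integer_vectors"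
    proof
      fix v :: "(real ^ 'n) \<times> (real ^ 'm)" assume "v \<in> Basis"
      then have "v \<bullet> b \<in> \<int>" if "b \<in> Basis" for b unfolding inner_Basis[OF \<open>v \<in> Basis\<close> that] by simp
      then show "v \<in> integer_vectors" by (simp add: integer_vectors_def)
    qed
    moreover have "0 < gram (take CARD('m) es)"
      by (rule gram_pos_append[of _ "drop CARD('m) es"]) (use es in \<open>simp add: gram_pos_iff_independent independent_Basis\<close>)
    ultimately have "take CARD('m) es \<in> Z"
      using es(1) set_take_subset[of "CARD('m)" es] by (auto simp: Z_def)
    then show ?thesis by blast
  qed
  define q where "q = from_nat_into Z"
  have q: "q i \<in> Z" for i unfolding q_def using from_nat_into[OF \<open>Z \<noteq> {}\<close>] .
  show ?thesis
  proof (rule winning_if_stages[OF \<beta>(1)])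
    fix c0 :: "real ^ 'n ^ 'm" and r0 :: real assume r0: "0 < r0"
    obtain K1 where K1: "\<And>K. K1 \<le> K \<Longrightarrow> covol_bound K c0 r0" using covol_bound_initial[OF r0] by blast
    \<comment> \<open>\<open>K1\<close> depends on Bob's first ball, whereas \<open>R\<close> and
      \<open>K0\<close> were fixed before it.\<close>
    define K where "K = max K0 K1"
    \<comment> \<open>Since \<open>R < \<beta>\<close>, the radius windows of consecutive stages are
      disjoint. Stage 0 is only the start, so the subspace of \<open>q i\<close> is settled on
      reaching stage \<open>Suc i\<close>.\<close>
    define Inv where "Inv k c r \<longleftrightarrow> \<beta> * (R ^ k * r0) \<le> r \<and> r \<le> R ^ k * r0 \<and> covol_bound K c r \<and>
      (\<forall>i. k = Suc i \<longrightarrow> (\<forall>\<Theta>\<in>cball c r. gram (map (\<lambda>v. snd (dani \<Theta> 1 v)) (q i)) \<noteq> 0))"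
      for k and c :: "real ^ 'n ^ 'm" and r
    have pos: "0 < R ^ k * r0" for k using R r0 by simp
    have i0: "Inv 0 c0 r0" using K1[of K] \<beta> r0 by (simp add: Inv_def K_def)
    have i1: "\<not> Inv (Suc k) c r" if "Inv k c r" for k c r
    proof
      assume "Inv (Suc k) c r"
      then have "r \<le> R * (R ^ k * r0)" by (simp add: Inv_def mult.assoc)
      also have "\<dots> < \<beta> * (R ^ k * r0)" using R pos by (intro mult_strict_right_mono)
      finally show False using that by (simp add: Inv_def)
    qed
    have i2: "\<exists>n. forces \<beta> n (Inv (Suc k)) c r" if "0 < r" "Inv k c r" for k c r
    proof -
      have "length (q k) = CARD('m)" "0 < gram (q k)" using q[of k] by (auto simp: Z_def)
      moreover have "\<beta> * (R ^ k * r0) \<le> r" "r \<le> R ^ k * r0" "covol_bound K c r" using that by (auto simp: Inv_def)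
      moreover have "K0 \<le> K" by (simp add: K_def)
      ultimately have "\<exists>n. forces \<beta> n (\<lambda>c' r'. \<beta> * (R * (R ^ k * r0)) \<le> r' \<and> r' \<le> R * (R ^ k * r0) \<and> covol_bound K c' r' \<and>
        (\<forall>\<Theta>\<in>cball c' r'. gram (map (\<lambda>v. snd (dani \<Theta> 1 v)) (q k)) \<noteq> 0)) c r"
        using pos[of k] by (intro stage)
      moreover have "Inv (Suc k) = (\<lambda>c' r'. \<beta> * (R * (R ^ k * r0)) \<le> r' \<and> r' \<le> R * (R ^ k * r0) \<and> covol_bound K c' r' \<and>
        (\<forall>\<Theta>\<in>cball c' r'. gram (map (\<lambda>v. snd (dani \<Theta> 1 v)) (q k)) \<noteq> 0))"
        by (intro ext) (simp add: Inv_def mult.assoc)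
      ultimately show ?thesis by (simp only:)
    qed
    have i3: "\<Theta> \<in> N_irr" if lim: "\<forall>k. \<exists>c r. Inv k c r \<and> \<Theta> \<in> cball c r" for \<Theta>
    proof -
      have "\<Theta> \<in> I_set"
      proof (rule I_set_if_transversal)
        fix xs :: "((real ^ 'n) \<times> (real ^ 'm)) list"
        assume "set xs \<subseteq> integer_vectors" "length xs = CARD('m)" "0 < gram xs"
        then have "xs \<in> Z" by (simp add: Z_def)
        then obtain i where "xs = q i" unfolding q_def using from_nat_into_surj[OF cZ] by metis
        moreover obtain c r where "Inv (Suc i) c r" "\<Theta> \<in> cball c r" using lim by blast
        ultimately show "gram (map (\<lambda>v. snd (dani \<Theta> 1 v)) xs) \<noteq> 0" by (auto simp: Inv_def)
      qed
      moreover have "badly_approximable \<Theta>"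
      proof (rule badly_approximable_if_covol_ge[OF \<beta>(1) R(1) _ r0])
        show "R < 1" using R \<beta> by linarith
        define e where "e = exp (- K * (1 * (real (CARD('n) + CARD('m)) - 1)))"
        show "0 < e" by (simp add: e_def)
        fix k
        obtain c r where I: "Inv k c r" "\<Theta> \<in> cball c r" using lim by blast
        have "e \<le> covol \<Theta> r [v]" if "v \<in> integer_vectors" "v \<noteq> 0" for v
        proof -
          have "set [v] \<subseteq> integer_vectors \<and> 0 < gram [v]" using that by (simp add: gram_singleton)
          then have "exp (- K * (real (length [v]) * (real (CARD('n) + CARD('m)) - real (length [v])))) \<le> covol \<Theta> r [v]"
            using I unfolding Inv_def covol_bound_def by blast
          then show ?thesis by (simp add: e_def)
        qed
        then show "\<exists>r. \<beta> * (R ^ k * r0) \<le> r \<and> r \<le> R ^ k * r0 \<and> (\<forall>v \<in> integer_vectors. v \<noteq> 0 \<longrightarrow> e \<le> covol \<Theta> r [v])"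
          using I(1) by (intro exI[of _ r]) (auto simp: Inv_def)
      qed
      ultimately show ?thesis by (simp add: N_irr_def)
    qed
    show "\<exists>Inv. Inv 0 c0 r0 \<and> (\<forall>k c r. Inv k c r \<longrightarrow> \<not> Inv (Suc k) c r) \<and>
       (\<forall>k c r. 0 < r \<and> Inv k c r \<longrightarrow> (\<exists>n. forces \<beta> n (Inv (Suc k)) c r)) \<and>
       (\<forall>x. (\<forall>k. \<exists>c r. Inv k c r \<and> x \<in> cball c r) \<longrightarrow> x \<in> (N_irr :: (real ^ 'n ^ 'm) set))"
      using i0 i1 i2 i3 by (intro exI[of _ Inv] conjI allI impI) auto
  qed
qed

lemma hyperplane_absolute_winning_mono:
  assumes "hyperplane_absolute_winning \<beta> S" "S \<subseteq> T"
  shows "hyperplane_absolute_winning \<beta> T"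
proof -
  obtain \<sigma> where \<sigma>: "legal_strategy \<beta> \<sigma>"
    "\<forall>c \<rho>. legal_bob_play \<beta> \<sigma> c \<rho> \<longrightarrow> (\<Inter>i. cball (c i) (\<rho> i)) \<inter> S \<noteq> {}"
    using assms(1) unfolding hyperplane_absolute_winning_def by (elim exE conjE)
  have "(\<Inter>i. cball (c i) (\<rho> i)) \<inter> T \<noteq> {}" if play: "legal_bob_play \<beta> \<sigma> c \<rho>" for c \<rho>
  proof -
    have "(\<Inter>i. cball (c i) (\<rho> i)) \<inter> S \<noteq> {}" using \<sigma>(2) play by (elim allE impE)
    then obtain x where "x \<in> (\<Inter>i. cball (c i) (\<rho> i)) \<inter> S" unfolding ex_in_conv[symmetric] by (elim exE)
    then have "x \<in> (\<Inter>i. cball (c i) (\<rho> i)) \<inter> T" using assms(2) by (meson IntD1 IntD2 IntI subsetD)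
    then show ?thesis unfolding ex_in_conv[symmetric] by (rule exI)
  qed
  with \<sigma>(1) show ?thesis unfolding hyperplane_absolute_winning_def by (intro exI[of _ \<sigma>] conjI allI impI)
qed

theorem theorem2p3:
  shows "HAW (I_set :: (real ^ 'n::finite ^ 'm::finite) set) \<and>
         HAW (N_irr :: (real ^ 'n::finite ^ 'm::finite) set)"
proof -
  have "hyperplane_absolute_winning \<beta> (N_irr :: (real ^ 'n ^ 'm) set)" if "0 < \<beta>" "\<beta> < 1 / 3" for \<beta>
    using that by (intro N_irr_winning) auto
  moreover have "(N_irr :: (real ^ 'n ^ 'm) set) \<subseteq> I_set" by (auto simp: N_irr_def)
  ultimately show ?thesis unfolding HAW_def using hyperplane_absolute_winning_mono by blast
qed

end
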